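(* Consider the autonomous metrical multi-time Lagrange space of electrodynamics $EDML^n_p=(J^1(T,M),L)$ with $L=h^{\alpha\beta}(t)g_{ij}(x)x^i_\alpha x^j_\beta+U^{(\alpha)}_{(i)}(t,x)x^i_\alpha+F(t,x)$, endowed with its canonical nonlinear connection $\Gamma$. Then: (i) The Cartan canonical connection $C\Gamma=(H^\gamma_{\alpha\beta},G^k_{j\gamma},L^i_{jk},C^{i(\gamma)}_{j(k)})$ of this space has the coefficients $$H^\gamma_{\alpha\beta}=H^\gamma_{\alpha\beta}\ \text{(the Christoffel symbols of } h_{\alpha\beta}),\qquad G^k_{j\gamma}=0,\qquad L^i_{jk}=\gamma^i_{jk},\qquad C^{i(\gamma)}_{j(k)}=0,$$ where $\gamma^i_{jk}$ are the Christoffel symbols of $g_{ij}$. (ii) The torsion $\mathbf T$ of the Cartan canonical connection is determined by three local d-tensors, namely $$R^{(m)}_{(\mu)\alpha\beta}=-H^\gamma_{\mu\alpha\beta}x^m_\gamma,$$ $$R^{(m)}_{(\mu)\alpha j}=-\frac{h_{\mu\eta}g^{mk}}{4}\left[H^\eta_{\alpha\gamma}U^{(\gamma)}_{(k)j}+\frac{\partial U^{(\eta)}_{(k)j}}{\partial t^\alpha}\right],$$ $$R^{(m)}_{(\mu)ij}=r^m_{ijk}x^k_\mu+\frac{h_{\mu\eta}g^{mk}}{4}\left[U^{(\eta)}_{(k)i\vert j}+U^{(\eta)}_{(k)j\vert i}\right],$$ where $H^\gamma_{\mu\alpha\beta}$ (resp. $r^m_{ijk}$) are the local curvature tensors of the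 semi-Riemannian metric $h_{\alpha\beta}$ (resp. $g_{ij}$) and "$_{\vert i}$" is the local spatial horizontal covariant derivative induced by the Cartan connection. (iii) The curvature $\mathbf R$ of the Cartan canonical connection is determined by two local d-tensors, namely $H^\eta_{\alpha\beta\gamma}$ and $R^l_{ijk}=r^l_{ijk}$, that is, exactly the curvature tensors of the semi-Riemannian metrics $h_{\alpha\beta}$ and $g_{ij}$.
   Context: Setting. $T$ is a smooth real $p$-dimensional manifold with coordinates $t=(t^\alpha)$, $M$ a smooth real $n$-dimensional manifold with coordinates $x=(x^i)$; $J^1(T,M)$ is the 1-jet bundle with induced coordinates $(t^\alpha,x^i,x^i_\alpha)$. Repeated indices are summed. $h_{\alpha\beta}(t)$ and $g_{ij}(x)$ are semi-Riemannian metrics on $T$ and $M$ with inverses $h^{\alpha\beta}$, $g^{ij}$; $U^{(\alpha)}_{(i)}(t,x)$ are the local components of a distinguished tensor (d-tensor) on $J^1(T,M)$, i.e. $U^{(\alpha)}_{(i)}=\frac{\partial t^\alpha}{\partial\tilde t^\beta}\frac{\partial\tilde x^j}{\partial x^i}\tilde U^{(\beta)}_{(j)}$ under changes $\tilde t=\tilde t(t)$, $\tilde x=\tilde x(x)$; $F(t,x)$ is a smooth function on $T\times M$. Put $U^{(\alpha)}_{(i)j}=\frac{\partial U^{(\alpha)}_{(i)}}{\partial x^j}-\frac{\partial U^{(\alpha)}_{(j)}}{\partial x^i}$. $H^\gamma_{\alpha\beta}$ and $\gamma^i_{jk}$ are the Christoffel symbols of $h$ and $g$. Canonical nonlinear connection.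 $\Gamma=(M^{(i)}_{(\alpha)\beta},N^{(i)}_{(\alpha)j})$ with $$M^{(i)}_{(\alpha)\beta}=-H^\gamma_{\alpha\beta}x^i_\gamma,\qquad N^{(i)}_{(\alpha)j}=\gamma^i_{jk}x^k_\alpha+\frac{h_{\alpha\gamma}g^{il}}{4}U^{(\gamma)}_{(l)j}.$$ Adapted frame: $\frac{\delta}{\delta t^\alpha}=\frac{\partial}{\partial t^\alpha}-M^{(j)}_{(\beta)\alpha}\frac{\partial}{\partial x^j_\beta}$, $\frac{\delta}{\delta x^i}=\frac{\partial}{\partial x^i}-N^{(j)}_{(\beta)i}\frac{\partial}{\partial x^j_\beta}$, $\frac{\partial}{\partial x^i_\alpha}$. Cartan canonical connection. An $h$-normal $\Gamma$-linear connection is a linear connection $\nabla$ on $J^1(T,M)$ with local coefficients $(H^\gamma_{\alpha\beta},G^k_{j\gamma},L^i_{jk},C^{i(\gamma)}_{j(k)})$, where $H^\gamma_{\alpha\beta}$ are the Christoffel symbols of $h$, and $\nabla_{\delta/\delta t^\gamma}\frac{\delta}{\delta t^\alpha}=H^\beta_{\alpha\gamma}\frac{\delta}{\delta t^\beta}$, $\nabla_{\delta/\delta t^\gamma}\frac{\delta}{\delta x^i}=G^k_{i\gamma}\frac{\delta}{\delta x^k}$, $\nabla_{\delta/\delta t^\gamma}\frac{\partial}{\partial x^i_\alpha}=G^k_{i\gamma}\frac{\partial}{\partial x^k_\alpha}-H^\alpha_{\beta\gamma}\frac{\partial}{\partial x^i_\beta}$; $\nabla_{\delta/\delta x^j}\frac{\delta}{\delta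 t^\alpha}=0$, $\nabla_{\delta/\delta x^j}\frac{\delta}{\delta x^i}=L^k_{ij}\frac{\delta}{\delta x^k}$, $\nabla_{\delta/\delta x^j}\frac{\partial}{\partial x^i_\alpha}=L^k_{ij}\frac{\partial}{\partial x^k_\alpha}$; $\nabla_{\partial/\partial x^j_\gamma}\frac{\delta}{\delta t^\alpha}=0$, $\nabla_{\partial/\partial x^j_\gamma}\frac{\delta}{\delta x^i}=C^{k(\gamma)}_{i(j)}\frac{\delta}{\delta x^k}$, $\nabla_{\partial/\partial x^j_\gamma}\frac{\partial}{\partial x^i_\alpha}=C^{k(\gamma)}_{i(j)}\frac{\partial}{\partial x^k_\alpha}$. The Cartan canonical connection $C\Gamma$ is the unique such connection with $\frac{\delta g_{ij}}{\delta x^k}-L^m_{ik}g_{mj}-L^m_{jk}g_{im}=0$, $\frac{\partial g_{ij}}{\partial x^k_\gamma}-C^{m(\gamma)}_{i(k)}g_{mj}-C^{m(\gamma)}_{j(k)}g_{im}=0$, $G^k_{j\gamma}=\frac{1}{2}g^{ki}\frac{\delta g_{ij}}{\delta t^\gamma}$, $L^k_{ij}=L^k_{ji}$ and $C^{i(\gamma)}_{j(k)}=C^{i(\gamma)}_{k(j)}$. Notation. The spatial horizontal covariant derivative of $U^{(\eta)}_{(k)i}$ is $U^{(\eta)}_{(k)i\vert j}=\frac{\delta U^{(\eta)}_{(k)i}}{\delta x^j}-L^m_{kj}U^{(\eta)}_{(m)i}-L^m_{ij}U^{(\eta)}_{(k)m}$. The torsion is $\mathbf T(X,Y)=\nabla_XY-\nabla_YX-[X,Y]$;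 the tensors $R^{(m)}_{(\mu)\alpha\beta}$, $R^{(m)}_{(\mu)\alpha j}$, $R^{(m)}_{(\mu)ij}$ denote its components along $\frac{\partial}{\partial x^m_\mu}$ on pairs of adapted horizontal vectors (temporal-temporal, temporal-spatial, spatial-spatial respectively). The curvature is $\mathbf R(X,Y)Z=\nabla_X\nabla_YZ-\nabla_Y\nabla_XZ-\nabla_{[X,Y]}Z$, with components in the adapted frame $(X_A)$ given by $\mathbf R(X_C,X_B)X_A=R^D_{ABC}X_D$. "Determined by" the listed d-tensors means that these are the only effective local components.
   Formalization: In (ii), the third formula is corrected: r^m_{kij} replaces r^m_{ijk}, and the bracket is U_{(k)i|j} − U_{(k)j|i} instead of a sum, since a torsion component must be skew in i, j and the printed right side is not. *)

theory Defs
  imports "HOL-Analysis.Analysis"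
begin

section \<open>Smooth maps and smooth manifolds\<close>

text \<open>\<open>Ck_on k S f\<close> is meant for open sets \<open>S\<close> in Euclidean spaces, where it is the usual class
  of \<open>k\<close> times continuously differentiable maps.\<close>

primrec Ck_on :: "nat \<Rightarrow> 'a::real_normed_vector set \<Rightarrow> ('a \<Rightarrow> 'b::real_normed_vector) \<Rightarrow> bool" where
  "Ck_on 0 S f \<longleftrightarrow> continuous_on S f"
| "Ck_on (Suc k) S f \<longleftrightarrow> (\<forall>x\<in>S. f differentiable (at x)) \<and>
     (\<forall>v. Ck_on k S (\<lambda>x. frechet_derivative f (at x) v))"

definition smooth_on :: "'a::real_normed_vector set \<Rightarrow> ('a \<Rightarrow> 'b::real_normed_vector) \<Rightarrow> bool" where
  "smooth_on S f \<longleftrightarrow> (\<forall>k. Ck_on k S f)"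

type_synonym ('a, 'd) chart = "'a set \<times> ('a \<Rightarrow> real ^ 'd)"

definition cimg :: "('a, 'd) chart \<Rightarrow> (real ^ 'd) set" where
  "cimg c = snd c ` fst c"

definition cinv :: "('a, 'd) chart \<Rightarrow> real ^ 'd \<Rightarrow> 'a" where
  "cinv c = inv_into (fst c) (snd c)"

definition overlap :: "('a, 'd) chart \<Rightarrow> ('a, 'd) chart \<Rightarrow> (real ^ 'd) set" where
  "overlap c d = snd c ` (fst c \<inter> fst d)"

definition trans_map :: "('a, 'd) chart \<Rightarrow> ('a, 'd) chart \<Rightarrow> real ^ 'd \<Rightarrow> real ^ 'd" where
  "trans_map c d = snd d \<circ> cinv c"

definition smooth_manifold :: "'a topology \<Rightarrow> ('a, 'd::finite) chart set \<Rightarrow> bool" where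
  "smooth_manifold X A \<longleftrightarrow>
     Hausdorff_space X \<and> second_countable X \<and>
     (\<Union>c\<in>A. fst c) = topspace X \<and>
     (\<forall>c\<in>A. openin X (fst c) \<and> open (cimg c) \<and>
        homeomorphic_map (subtopology X (fst c)) (top_of_set (cimg c)) (snd c)) \<and>
     (\<forall>c\<in>A. \<forall>d\<in>A. smooth_on (overlap c d) (trans_map c d))"

text \<open>If \<open>y\<close> are the coordinates of \<open>c\<close> and \<open>y'\<close> those of \<open>d\<close>, then \<open>dcoord c d y i j\<close> is the
  partial derivative of \<open>y'\<^sup>i\<close> by \<open>y\<^sup>j\<close> at \<open>y\<close>.\<close>

definition dcoord :: "('a, 'd::finite) chart \<Rightarrow> ('a, 'd) chart \<Rightarrow> real ^ 'd \<Rightarrow> 'd \<Rightarrow> 'd \<Rightarrow> real" where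
  "dcoord c d y i j = frechet_derivative (trans_map c d) (at y) (axis j 1) $ i"

section \<open>Semi-Riemannian metrics in coordinates\<close>

definition pd :: "'d::finite \<Rightarrow> (real ^ 'd \<Rightarrow> real) \<Rightarrow> real ^ 'd \<Rightarrow> real" where
  "pd i f y = frechet_derivative f (at y) (axis i 1)"

definition metric_index :: "real ^ 'd ^ 'd::finite \<Rightarrow> nat" where
  "metric_index A = Max {dim V |V. subspace V \<and> (\<forall>v\<in>V. v \<noteq> 0 \<longrightarrow> v \<bullet> (A *v v) < 0)}"

text \<open>A tensor field is given by its family of components, one for each chart of the atlas.\<close>

definition semi_riemannian ::
  "('a, 'd::finite) chart set \<Rightarrow> (('a, 'd) chart \<Rightarrow> real ^ 'd \<Rightarrow> real ^ 'd ^ 'd) \<Rightarrow> bool" where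
  "semi_riemannian A h \<longleftrightarrow>
     (\<forall>c\<in>A. smooth_on (cimg c) (h c) \<and>
        (\<forall>y\<in>cimg c. transpose (h c y) = h c y \<and> invertible (h c y))) \<and>
     (\<exists>\<nu>. \<forall>c\<in>A. \<forall>y\<in>cimg c. metric_index (h c y) = \<nu>) \<and>
     (\<forall>c\<in>A. \<forall>d\<in>A. \<forall>y\<in>overlap c d. \<forall>i j.
        h c y $ i $ j = (\<Sum>k\<in>UNIV. \<Sum>l\<in>UNIV.
          dcoord c d y k i * dcoord c d y l j * h d (trans_map c d y) $ k $ l))"

text \<open>\<open>christoffel g i j k\<close> has upper index \<open>i\<close> and lower indices \<open>j k\<close>.\<close>

definition christoffel ::
  "(real ^ 'd \<Rightarrow> real ^ 'd ^ 'd::finite) \<Rightarrow> 'd \<Rightarrow> 'd \<Rightarrow> 'd \<Rightarrow> real ^ 'd \<Rightarrow> real" where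
  "christoffel g i j k y = (\<Sum>l\<in>UNIV. matrix_inv (g y) $ i $ l / 2 *
     (pd j (\<lambda>z. g z $ l $ k) y + pd k (\<lambda>z. g z $ l $ j) y - pd l (\<lambda>z. g z $ j $ k) y))"

text \<open>\<open>riemann g l i j k\<close> is the component with upper index \<open>l\<close> and lower indices \<open>i j k\<close> of the
  curvature tensor of the Levi-Civita connection, in the convention
  \<open>R(\<partial>\<^sub>k, \<partial>\<^sub>j) \<partial>\<^sub>i = R\<^sup>l\<^sub>i\<^sub>j\<^sub>k \<partial>\<^sub>l\<close> (skew-symmetric in the last two indices).\<close>

definition riemann ::
  "(real ^ 'd \<Rightarrow> real ^ 'd ^ 'd::finite) \<Rightarrow> 'd \<Rightarrow> 'd \<Rightarrow> 'd \<Rightarrow> 'd \<Rightarrow> real ^ 'd \<Rightarrow> real" where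
  "riemann g l i j k y =
     pd k (christoffel g l i j) y - pd j (christoffel g l i k) y +
     (\<Sum>m\<in>UNIV. christoffel g m i j y * christoffel g l m k y
               - christoffel g m i k y * christoffel g l m j y)"

section \<open>The jet bundle in induced coordinates\<close>

text \<open>A point \<open>(t, x, v)\<close> has coordinates \<open>t $ \<alpha>\<close>, \<open>x $ i\<close> and \<open>v $ i $ \<alpha>\<close>. The bundle
  \<open>J\<^sup>1(T,M)\<close> is represented by its induced charts, one for each chart \<open>a\<close> of \<open>T\<close> and each chart
  \<open>b\<close> of \<open>M\<close>, together with their transition maps; objects on it are given by families indexed
  by \<open>a\<close> and \<open>b\<close>.\<close>

type_synonym ('p, 'n) jet = "(real ^ 'p) \<times> (real ^ 'n) \<times> (real ^ 'p ^ 'n)"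

definition jet_dom :: "('a, 'p) chart \<Rightarrow> ('b, 'n) chart \<Rightarrow> ('p::finite, 'n::finite) jet set" where
  "jet_dom a b = cimg a \<times> cimg b \<times> UNIV"

definition jet_overlap :: "('a, 'p) chart \<Rightarrow> ('a, 'p) chart \<Rightarrow> ('b, 'n) chart \<Rightarrow> ('b, 'n) chart
    \<Rightarrow> ('p::finite, 'n::finite) jet set" where
  "jet_overlap a a' b b' = overlap a a' \<times> overlap b b' \<times> UNIV"

definition jet_trans :: "('a, 'p) chart \<Rightarrow> ('a, 'p) chart \<Rightarrow> ('b, 'n) chart \<Rightarrow> ('b, 'n) chart
    \<Rightarrow> ('p::finite, 'n::finite) jet \<Rightarrow> ('p, 'n) jet" where
  "jet_trans a a' b b' = (\<lambda>(t, x, v).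
     (trans_map a a' t, trans_map b b' x,
      \<chi> i \<alpha>. \<Sum>j\<in>UNIV. \<Sum>\<beta>\<in>UNIV.
        dcoord b b' x i j * dcoord a' a (trans_map a a' t) \<beta> \<alpha> * v $ j $ \<beta>))"

text \<open>The d-tensor \<open>U\<close>, with components \<open>U a b (t, x) $ \<alpha> $ i\<close>.\<close>

definition d_tensor_U :: "('a, 'p::finite) chart set \<Rightarrow> ('b, 'n::finite) chart set \<Rightarrow>
    (('a, 'p) chart \<Rightarrow> ('b, 'n) chart \<Rightarrow> (real ^ 'p) \<times> (real ^ 'n) \<Rightarrow> real ^ 'n ^ 'p) \<Rightarrow> bool" where
  "d_tensor_U AT AM U \<longleftrightarrow>
     (\<forall>a\<in>AT. \<forall>b\<in>AM. smooth_on (cimg a \<times> cimg b) (U a b)) \<and>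
     (\<forall>a\<in>AT. \<forall>a'\<in>AT. \<forall>b\<in>AM. \<forall>b'\<in>AM. \<forall>t\<in>overlap a a'. \<forall>x\<in>overlap b b'. \<forall>\<alpha> i.
        U a b (t, x) $ \<alpha> $ i = (\<Sum>\<beta>\<in>UNIV. \<Sum>j\<in>UNIV.
          dcoord a' a (trans_map a a' t) \<alpha> \<beta> * dcoord b b' x j i *
          U a' b' (trans_map a a' t, trans_map b b' x) $ \<beta> $ j))"

definition smooth_function :: "('a, 'p::finite) chart set \<Rightarrow> ('b, 'n::finite) chart set \<Rightarrow>
    ('a \<times> 'b \<Rightarrow> real) \<Rightarrow> bool" where
  "smooth_function AT AM F \<longleftrightarrow>
     (\<forall>a\<in>AT. \<forall>b\<in>AM. smooth_on (cimg a \<times> cimg b) (\<lambda>(t, x). F (cinv a t, cinv b x)))"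

definition edml_space :: "'a topology \<Rightarrow> ('a, 'p::finite) chart set \<Rightarrow>
    'b topology \<Rightarrow> ('b, 'n::finite) chart set \<Rightarrow>
    (('a, 'p) chart \<Rightarrow> real ^ 'p \<Rightarrow> real ^ 'p ^ 'p) \<Rightarrow>
    (('b, 'n) chart \<Rightarrow> real ^ 'n \<Rightarrow> real ^ 'n ^ 'n) \<Rightarrow>
    (('a, 'p) chart \<Rightarrow> ('b, 'n) chart \<Rightarrow> (real ^ 'p) \<times> (real ^ 'n) \<Rightarrow> real ^ 'n ^ 'p) \<Rightarrow>
    ('a \<times> 'b \<Rightarrow> real) \<Rightarrow>
    (('a, 'p) chart \<Rightarrow> ('b, 'n) chart \<Rightarrow> ('p, 'n) jet \<Rightarrow> real) \<Rightarrow> bool" where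
  "edml_space XT AT XM AM h g U F L \<longleftrightarrow>
     smooth_manifold XT AT \<and> smooth_manifold XM AM \<and>
     semi_riemannian AT h \<and> semi_riemannian AM g \<and>
     d_tensor_U AT AM U \<and> smooth_function AT AM F \<and>
     (\<forall>a\<in>AT. \<forall>b\<in>AM. \<forall>t\<in>cimg a. \<forall>x\<in>cimg b. \<forall>v.
        L a b (t, x, v) =
          (\<Sum>\<alpha>\<in>UNIV. \<Sum>\<beta>\<in>UNIV. \<Sum>i\<in>UNIV. \<Sum>j\<in>UNIV.
             matrix_inv (h a t) $ \<alpha> $ \<beta> * g b x $ i $ j * v $ i $ \<alpha> * v $ j $ \<beta>) +
          (\<Sum>\<alpha>\<in>UNIV. \<Sum>i\<in>UNIV. U a b (t, x) $ \<alpha> $ i * v $ i $ \<alpha>) +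
          F (cinv a t, cinv b x))"

section \<open>Canonical nonlinear connection and adapted frame\<close>

text \<open>From here on \<open>h\<close>, \<open>g\<close>, \<open>U\<close> are the components in one pair of charts.
  \<open>curlU U \<alpha> i j\<close> is \<open>U\<^sup>(\<^sup>\<alpha>\<^sup>)\<^sub>(\<^sub>i\<^sub>)\<^sub>j\<close>.\<close>

definition curlU :: "((real ^ 'p) \<times> (real ^ 'n::finite) \<Rightarrow> real ^ 'n ^ 'p::finite) \<Rightarrow>
    'p \<Rightarrow> 'n \<Rightarrow> 'n \<Rightarrow> real ^ 'p \<Rightarrow> real ^ 'n \<Rightarrow> real" where
  "curlU U \<alpha> i j t x = pd j (\<lambda>y. U (t, y) $ \<alpha> $ i) x - pd i (\<lambda>y. U (t, y) $ \<alpha> $ j) x"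

definition Mconn :: "(real ^ 'p \<Rightarrow> real ^ 'p ^ 'p::finite) \<Rightarrow> 'n::finite \<Rightarrow> 'p \<Rightarrow> 'p \<Rightarrow>
    ('p, 'n) jet \<Rightarrow> real" where
  "Mconn h i \<alpha> \<beta> = (\<lambda>(t, x, v). - (\<Sum>\<gamma>\<in>UNIV. christoffel h \<gamma> \<alpha> \<beta> t * v $ i $ \<gamma>))"

definition Nconn :: "(real ^ 'p \<Rightarrow> real ^ 'p ^ 'p::finite) \<Rightarrow> (real ^ 'n \<Rightarrow> real ^ 'n ^ 'n::finite) \<Rightarrow>
    ((real ^ 'p) \<times> (real ^ 'n) \<Rightarrow> real ^ 'n ^ 'p) \<Rightarrow> 'n \<Rightarrow> 'p \<Rightarrow> 'n \<Rightarrow> ('p, 'n) jet \<Rightarrow> real" where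
  "Nconn h g U i \<alpha> j = (\<lambda>(t, x, v).
     (\<Sum>k\<in>UNIV. christoffel g i j k x * v $ k $ \<alpha>) +
     (\<Sum>\<gamma>\<in>UNIV. \<Sum>l\<in>UNIV. h t $ \<alpha> $ \<gamma> * matrix_inv (g x) $ i $ l / 4 * curlU U \<gamma> l j t x))"

text \<open>Indices of the adapted frame: \<open>Tix \<alpha>\<close> for \<open>\<delta>/\<delta>t\<^sup>\<alpha>\<close>, \<open>Xix i\<close> for \<open>\<delta>/\<delta>x\<^sup>i\<close> and
  \<open>Vix i \<alpha>\<close> for \<open>\<partial>/\<partial>x\<^sup>i\<^sub>\<alpha>\<close>. A sum type is used because it is an instance of \<open>finite\<close>.\<close>

type_synonym ('p, 'n) aidx = "'p + 'n + ('n \<times> 'p)"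

abbreviation Tix :: "'p \<Rightarrow> ('p, 'n) aidx" where "Tix \<alpha> \<equiv> Inl \<alpha>"
abbreviation Xix :: "'n \<Rightarrow> ('p, 'n) aidx" where "Xix i \<equiv> Inr (Inl i)"
abbreviation Vix :: "'n \<Rightarrow> 'p \<Rightarrow> ('p, 'n) aidx" where "Vix i \<alpha> \<equiv> Inr (Inr (i, \<alpha>))"

fun adapted :: "(real ^ 'p \<Rightarrow> real ^ 'p ^ 'p::finite) \<Rightarrow> (real ^ 'n \<Rightarrow> real ^ 'n ^ 'n::finite) \<Rightarrow>
    ((real ^ 'p) \<times> (real ^ 'n) \<Rightarrow> real ^ 'n ^ 'p) \<Rightarrow> ('p, 'n) aidx \<Rightarrow>
    ('p, 'n) jet \<Rightarrow> ('p, 'n) jet" where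
  "adapted h g U (Tix \<alpha>) w = (axis \<alpha> 1, 0, \<chi> j \<beta>. - Mconn h j \<beta> \<alpha> w)"
| "adapted h g U (Xix i) w = (0, axis i 1, \<chi> j \<beta>. - Nconn h g U j \<beta> i w)"
| "adapted h g U (Vix i \<alpha>) w = (0, 0, axis i (axis \<alpha> 1))"

text \<open>The dual coframe \<open>dt\<^sup>\<alpha>\<close>, \<open>dx\<^sup>i\<close>,
  \<open>\<delta>x\<^sup>i\<^sub>\<alpha> = dx\<^sup>i\<^sub>\<alpha> + M\<^sup>(\<^sup>i\<^sup>)\<^sub>(\<^sub>\<alpha>\<^sub>)\<^sub>\<beta> dt\<^sup>\<beta> + N\<^sup>(\<^sup>i\<^sup>)\<^sub>(\<^sub>\<alpha>\<^sub>)\<^sub>j dx\<^sup>j\<close>; it yields the components of a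
  tangent vector at \<open>w\<close> in the adapted frame.\<close>

fun coframe :: "(real ^ 'p \<Rightarrow> real ^ 'p ^ 'p::finite) \<Rightarrow> (real ^ 'n \<Rightarrow> real ^ 'n ^ 'n::finite) \<Rightarrow>
    ((real ^ 'p) \<times> (real ^ 'n) \<Rightarrow> real ^ 'n ^ 'p) \<Rightarrow> ('p, 'n) aidx \<Rightarrow>
    ('p, 'n) jet \<Rightarrow> ('p, 'n) jet \<Rightarrow> real" where
  "coframe h g U (Tix \<alpha>) w y = fst y $ \<alpha>"
| "coframe h g U (Xix i) w y = fst (snd y) $ i"
| "coframe h g U (Vix i \<alpha>) w y = snd (snd y) $ i $ \<alpha> +
     (\<Sum>\<beta>\<in>UNIV. Mconn h i \<alpha> \<beta> w * fst y $ \<beta>) + (\<Sum>j\<in>UNIV. Nconn h g U i \<alpha> j w * fst (snd y) $ j)"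

section \<open>Linear connections\<close>

definition bracket :: "('e::real_normed_vector \<Rightarrow> 'e) \<Rightarrow> ('e \<Rightarrow> 'e) \<Rightarrow> 'e \<Rightarrow> 'e" where
  "bracket X Y w = frechet_derivative Y (at w) (X w) - frechet_derivative X (at w) (Y w)"

text \<open>Vector fields on the open set \<open>W\<close> are total functions that are only relevant on \<open>W\<close>; hence
  the first clause.\<close>

definition linear_connection_on ::
  "'e::real_normed_vector set \<Rightarrow> (('e \<Rightarrow> 'e) \<Rightarrow> ('e \<Rightarrow> 'e) \<Rightarrow> 'e \<Rightarrow> 'e) \<Rightarrow> bool" where
  "linear_connection_on W nab \<longleftrightarrow>
     (\<forall>X X' Y Y'. smooth_on W X \<longrightarrow> smooth_on W Y \<longrightarrow>
        (\<forall>w\<in>W. X w = X' w \<and> Y w = Y' w) \<longrightarrow> (\<forall>w\<in>W. nab X Y w = nab X' Y' w)) \<and>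
     (\<forall>X Y. smooth_on W X \<longrightarrow> smooth_on W Y \<longrightarrow> smooth_on W (nab X Y)) \<and>
     (\<forall>X X' Y. smooth_on W X \<longrightarrow> smooth_on W X' \<longrightarrow> smooth_on W Y \<longrightarrow>
        (\<forall>w\<in>W. nab (\<lambda>u. X u + X' u) Y w = nab X Y w + nab X' Y w)) \<and>
     (\<forall>X Y Y'. smooth_on W X \<longrightarrow> smooth_on W Y \<longrightarrow> smooth_on W Y' \<longrightarrow>
        (\<forall>w\<in>W. nab X (\<lambda>u. Y u + Y' u) w = nab X Y w + nab X Y' w)) \<and>
     (\<forall>(f :: 'e \<Rightarrow> real) X Y. smooth_on W f \<longrightarrow> smooth_on W X \<longrightarrow> smooth_on W Y \<longrightarrow>
        (\<forall>w\<in>W. nab (\<lambda>u. f u *\<^sub>R X u) Y w = f w *\<^sub>R nab X Y w \<and>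
               nab X (\<lambda>u. f u *\<^sub>R Y u) w =
                 frechet_derivative f (at w) (X w) *\<^sub>R Y w + f w *\<^sub>R nab X Y w))"

definition torsion ::
  "(('e::real_normed_vector \<Rightarrow> 'e) \<Rightarrow> ('e \<Rightarrow> 'e) \<Rightarrow> 'e \<Rightarrow> 'e) \<Rightarrow> ('e \<Rightarrow> 'e) \<Rightarrow> ('e \<Rightarrow> 'e) \<Rightarrow> 'e \<Rightarrow> 'e" where
  "torsion nab X Y w = nab X Y w - nab Y X w - bracket X Y w"

definition curvature ::
  "(('e::real_normed_vector \<Rightarrow> 'e) \<Rightarrow> ('e \<Rightarrow> 'e) \<Rightarrow> 'e \<Rightarrow> 'e) \<Rightarrow>
     ('e \<Rightarrow> 'e) \<Rightarrow> ('e \<Rightarrow> 'e) \<Rightarrow> ('e \<Rightarrow> 'e) \<Rightarrow> 'e \<Rightarrow> 'e" where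
  "curvature nab X Y Z w = nab X (nab Y Z) w - nab Y (nab X Z) w - nab (bracket X Y) Z w"

definition related :: "'e::real_normed_vector set \<Rightarrow> ('e \<Rightarrow> 'e) \<Rightarrow> ('e \<Rightarrow> 'e) \<Rightarrow> ('e \<Rightarrow> 'e) \<Rightarrow> bool" where
  "related S \<Phi> X X' \<longleftrightarrow> (\<forall>w\<in>S. X' (\<Phi> w) = frechet_derivative \<Phi> (at w) (X w))"

text \<open>A linear connection on the jet bundle: one on each induced chart, such that any two of them
  agree on the overlap of their charts.\<close>

definition linear_connection_J1 :: "('a, 'p::finite) chart set \<Rightarrow> ('b, 'n::finite) chart set \<Rightarrow>
    (('a, 'p) chart \<Rightarrow> ('b, 'n) chart \<Rightarrow> (('p, 'n) jet \<Rightarrow> ('p, 'n) jet) \<Rightarrow>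
       (('p, 'n) jet \<Rightarrow> ('p, 'n) jet) \<Rightarrow> ('p, 'n) jet \<Rightarrow> ('p, 'n) jet) \<Rightarrow> bool" where
  "linear_connection_J1 AT AM nab \<longleftrightarrow>
     (\<forall>a\<in>AT. \<forall>b\<in>AM. linear_connection_on (jet_dom a b) (nab a b)) \<and>
     (\<forall>a\<in>AT. \<forall>a'\<in>AT. \<forall>b\<in>AM. \<forall>b'\<in>AM. \<forall>X X' Y Y'.
        smooth_on (jet_dom a b) X \<longrightarrow> smooth_on (jet_dom a b) Y \<longrightarrow>
        smooth_on (jet_dom a' b') X' \<longrightarrow> smooth_on (jet_dom a' b') Y' \<longrightarrow>
        related (jet_overlap a a' b b') (jet_trans a a' b b') X X' \<longrightarrow>
        related (jet_overlap a a' b b') (jet_trans a a' b b') Y Y' \<longrightarrow>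
        related (jet_overlap a a' b b') (jet_trans a a' b b') (nab a b X Y) (nab a' b' X' Y'))"

section \<open>The Cartan canonical connection\<close>

text \<open>Arguments of the coefficient functions at a jet \<open>w\<close>: \<open>Hc w \<gamma> \<alpha> \<beta>\<close> is \<open>H\<^sup>\<gamma>\<^sub>\<alpha>\<^sub>\<beta>\<close>,
  \<open>Gc w k j \<gamma>\<close> is \<open>G\<^sup>k\<^sub>j\<^sub>\<gamma>\<close>, \<open>Lc w i j k\<close> is \<open>L\<^sup>i\<^sub>j\<^sub>k\<close> and
  \<open>Cc w i \<gamma> j k\<close> is \<open>C\<^sup>i\<^sup>(\<^sup>\<gamma>\<^sup>)\<^sub>j\<^sub>(\<^sub>k\<^sub>)\<close>.\<close>

definition h_normal_on :: "('p, 'n) jet set \<Rightarrow>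
    (real ^ 'p \<Rightarrow> real ^ 'p ^ 'p::finite) \<Rightarrow> (real ^ 'n \<Rightarrow> real ^ 'n ^ 'n::finite) \<Rightarrow>
    ((real ^ 'p) \<times> (real ^ 'n) \<Rightarrow> real ^ 'n ^ 'p) \<Rightarrow>
    ((('p, 'n) jet \<Rightarrow> ('p, 'n) jet) \<Rightarrow> (('p, 'n) jet \<Rightarrow> ('p, 'n) jet) \<Rightarrow> ('p, 'n) jet \<Rightarrow> ('p, 'n) jet) \<Rightarrow>
    (('p, 'n) jet \<Rightarrow> 'p \<Rightarrow> 'p \<Rightarrow> 'p \<Rightarrow> real) \<Rightarrow> (('p, 'n) jet \<Rightarrow> 'n \<Rightarrow> 'n \<Rightarrow> 'p \<Rightarrow> real) \<Rightarrow>
    (('p, 'n) jet \<Rightarrow> 'n \<Rightarrow> 'n \<Rightarrow> 'n \<Rightarrow> real) \<Rightarrow> (('p, 'n) jet \<Rightarrow> 'n \<Rightarrow> 'p \<Rightarrow> 'n \<Rightarrow> 'n \<Rightarrow> real) \<Rightarrow> bool" where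
  "h_normal_on W h g U nab Hc Gc Lc Cc \<longleftrightarrow>
     (let e = adapted h g U in
      \<forall>w\<in>W.
       (\<forall>\<alpha> \<beta> \<gamma>. Hc w \<gamma> \<alpha> \<beta> = christoffel h \<gamma> \<alpha> \<beta> (fst w)) \<and>
       (\<forall>\<alpha> \<gamma>. nab (e (Tix \<gamma>)) (e (Tix \<alpha>)) w = (\<Sum>\<beta>\<in>UNIV. Hc w \<beta> \<alpha> \<gamma> *\<^sub>R e (Tix \<beta>) w)) \<and>
       (\<forall>i \<gamma>. nab (e (Tix \<gamma>)) (e (Xix i)) w = (\<Sum>k\<in>UNIV. Gc w k i \<gamma> *\<^sub>R e (Xix k) w)) \<and>
       (\<forall>i \<alpha> \<gamma>. nab (e (Tix \<gamma>)) (e (Vix i \<alpha>)) w =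
          (\<Sum>k\<in>UNIV. Gc w k i \<gamma> *\<^sub>R e (Vix k \<alpha>) w) - (\<Sum>\<beta>\<in>UNIV. Hc w \<alpha> \<beta> \<gamma> *\<^sub>R e (Vix i \<beta>) w)) \<and>
       (\<forall>\<alpha> j. nab (e (Xix j)) (e (Tix \<alpha>)) w = 0) \<and>
       (\<forall>i j. nab (e (Xix j)) (e (Xix i)) w = (\<Sum>k\<in>UNIV. Lc w k i j *\<^sub>R e (Xix k) w)) \<and>
       (\<forall>i \<alpha> j. nab (e (Xix j)) (e (Vix i \<alpha>)) w = (\<Sum>k\<in>UNIV. Lc w k i j *\<^sub>R e (Vix k \<alpha>) w)) \<and>
       (\<forall>\<alpha> j \<gamma>. nab (e (Vix j \<gamma>)) (e (Tix \<alpha>)) w = 0) \<and>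
       (\<forall>i j \<gamma>. nab (e (Vix j \<gamma>)) (e (Xix i)) w = (\<Sum>k\<in>UNIV. Cc w k \<gamma> i j *\<^sub>R e (Xix k) w)) \<and>
       (\<forall>i \<alpha> j \<gamma>. nab (e (Vix j \<gamma>)) (e (Vix i \<alpha>)) w = (\<Sum>k\<in>UNIV. Cc w k \<gamma> i j *\<^sub>R e (Vix k \<alpha>) w)))"

definition cartan_conditions_on :: "('p, 'n) jet set \<Rightarrow>
    (real ^ 'p \<Rightarrow> real ^ 'p ^ 'p::finite) \<Rightarrow> (real ^ 'n \<Rightarrow> real ^ 'n ^ 'n::finite) \<Rightarrow>
    ((real ^ 'p) \<times> (real ^ 'n) \<Rightarrow> real ^ 'n ^ 'p) \<Rightarrow>
    (('p, 'n) jet \<Rightarrow> 'n \<Rightarrow> 'n \<Rightarrow> 'p \<Rightarrow> real) \<Rightarrow>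
    (('p, 'n) jet \<Rightarrow> 'n \<Rightarrow> 'n \<Rightarrow> 'n \<Rightarrow> real) \<Rightarrow> (('p, 'n) jet \<Rightarrow> 'n \<Rightarrow> 'p \<Rightarrow> 'n \<Rightarrow> 'n \<Rightarrow> real) \<Rightarrow> bool" where
  "cartan_conditions_on W h g U Gc Lc Cc \<longleftrightarrow>
     (let e = adapted h g U;
          gg = (\<lambda>i j (w :: ('p, 'n) jet). g (fst (snd w)) $ i $ j);
          D = (\<lambda>A f w. frechet_derivative f (at w) (e A w) :: real) in
      \<forall>w\<in>W.
       (\<forall>i j k. D (Xix k) (gg i j) w
          - (\<Sum>m\<in>UNIV. Lc w m i k * gg m j w) - (\<Sum>m\<in>UNIV. Lc w m j k * gg i m w) = 0) \<and>
       (\<forall>i j k \<gamma>. D (Vix k \<gamma>) (gg i j) w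
          - (\<Sum>m\<in>UNIV. Cc w m \<gamma> i k * gg m j w) - (\<Sum>m\<in>UNIV. Cc w m \<gamma> j k * gg i m w) = 0) \<and>
       (\<forall>k j \<gamma>. Gc w k j \<gamma> =
          1 / 2 * (\<Sum>i\<in>UNIV. matrix_inv (g (fst (snd w))) $ k $ i * D (Tix \<gamma>) (gg i j) w)) \<and>
       (\<forall>k i j. Lc w k i j = Lc w k j i) \<and>
       (\<forall>i \<gamma> j k. Cc w i \<gamma> j k = Cc w i \<gamma> k j))"

definition cartan_connection :: "('a, 'p::finite) chart set \<Rightarrow> ('b, 'n::finite) chart set \<Rightarrow>
    (('a, 'p) chart \<Rightarrow> real ^ 'p \<Rightarrow> real ^ 'p ^ 'p) \<Rightarrow>
    (('b, 'n) chart \<Rightarrow> real ^ 'n \<Rightarrow> real ^ 'n ^ 'n) \<Rightarrow>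
    (('a, 'p) chart \<Rightarrow> ('b, 'n) chart \<Rightarrow> (real ^ 'p) \<times> (real ^ 'n) \<Rightarrow> real ^ 'n ^ 'p) \<Rightarrow>
    (('a, 'p) chart \<Rightarrow> ('b, 'n) chart \<Rightarrow> (('p, 'n) jet \<Rightarrow> ('p, 'n) jet) \<Rightarrow>
       (('p, 'n) jet \<Rightarrow> ('p, 'n) jet) \<Rightarrow> ('p, 'n) jet \<Rightarrow> ('p, 'n) jet) \<Rightarrow>
    (('a, 'p) chart \<Rightarrow> ('b, 'n) chart \<Rightarrow> ('p, 'n) jet \<Rightarrow> 'p \<Rightarrow> 'p \<Rightarrow> 'p \<Rightarrow> real) \<Rightarrow>
    (('a, 'p) chart \<Rightarrow> ('b, 'n) chart \<Rightarrow> ('p, 'n) jet \<Rightarrow> 'n \<Rightarrow> 'n \<Rightarrow> 'p \<Rightarrow> real) \<Rightarrow>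
    (('a, 'p) chart \<Rightarrow> ('b, 'n) chart \<Rightarrow> ('p, 'n) jet \<Rightarrow> 'n \<Rightarrow> 'n \<Rightarrow> 'n \<Rightarrow> real) \<Rightarrow>
    (('a, 'p) chart \<Rightarrow> ('b, 'n) chart \<Rightarrow> ('p, 'n) jet \<Rightarrow> 'n \<Rightarrow> 'p \<Rightarrow> 'n \<Rightarrow> 'n \<Rightarrow> real) \<Rightarrow> bool" where
  "cartan_connection AT AM h g U nab Hc Gc Lc Cc \<longleftrightarrow>
     linear_connection_J1 AT AM nab \<and>
     (\<forall>a\<in>AT. \<forall>b\<in>AM.
        h_normal_on (jet_dom a b) (h a) (g b) (U a b) (nab a b)
          (Hc a b) (Gc a b) (Lc a b) (Cc a b) \<and>
        cartan_conditions_on (jet_dom a b) (h a) (g b) (U a b) (Gc a b) (Lc a b) (Cc a b))"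

section \<open>Components of torsion and curvature\<close>

text \<open>\<open>\<T>(X\<^sub>B, X\<^sub>A) = T\<^sup>C\<^sub>A\<^sub>B X\<^sub>C\<close>, the order of arguments matching the convention
  \<open>\<R>(X\<^sub>C, X\<^sub>B) X\<^sub>A = R\<^sup>D\<^sub>A\<^sub>B\<^sub>C X\<^sub>D\<close> for the curvature.\<close>

definition torsion_comp ::
  "(real ^ 'p \<Rightarrow> real ^ 'p ^ 'p::finite) \<Rightarrow> (real ^ 'n \<Rightarrow> real ^ 'n ^ 'n::finite) \<Rightarrow>
    ((real ^ 'p) \<times> (real ^ 'n) \<Rightarrow> real ^ 'n ^ 'p) \<Rightarrow>
    ((('p, 'n) jet \<Rightarrow> ('p, 'n) jet) \<Rightarrow> (('p, 'n) jet \<Rightarrow> ('p, 'n) jet) \<Rightarrow> ('p, 'n) jet \<Rightarrow> ('p, 'n) jet) \<Rightarrow>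
    ('p, 'n) jet \<Rightarrow> ('p, 'n) aidx \<Rightarrow> ('p, 'n) aidx \<Rightarrow> ('p, 'n) aidx \<Rightarrow> real" where
  "torsion_comp h g U nab w C A B =
     coframe h g U C w (torsion nab (adapted h g U B) (adapted h g U A) w)"

definition curvature_comp ::
  "(real ^ 'p \<Rightarrow> real ^ 'p ^ 'p::finite) \<Rightarrow> (real ^ 'n \<Rightarrow> real ^ 'n ^ 'n::finite) \<Rightarrow>
    ((real ^ 'p) \<times> (real ^ 'n) \<Rightarrow> real ^ 'n ^ 'p) \<Rightarrow>
    ((('p, 'n) jet \<Rightarrow> ('p, 'n) jet) \<Rightarrow> (('p, 'n) jet \<Rightarrow> ('p, 'n) jet) \<Rightarrow> ('p, 'n) jet \<Rightarrow> ('p, 'n) jet) \<Rightarrow>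
    ('p, 'n) jet \<Rightarrow> ('p, 'n) aidx \<Rightarrow> ('p, 'n) aidx \<Rightarrow> ('p, 'n) aidx \<Rightarrow> ('p, 'n) aidx \<Rightarrow> real" where
  "curvature_comp h g U nab w D A B C =
     coframe h g U D w (curvature nab (adapted h g U C) (adapted h g U B) (adapted h g U A) w)"

text \<open>\<open>U\<^sup>(\<^sup>\<eta>\<^sup>)\<^sub>(\<^sub>k\<^sub>)\<^sub>i\<^sub>|\<^sub>j\<close> with respect to the coefficients \<open>Lc\<close>.\<close>

definition hcovU ::
  "(real ^ 'p \<Rightarrow> real ^ 'p ^ 'p::finite) \<Rightarrow> (real ^ 'n \<Rightarrow> real ^ 'n ^ 'n::finite) \<Rightarrow>
    ((real ^ 'p) \<times> (real ^ 'n) \<Rightarrow> real ^ 'n ^ 'p) \<Rightarrow> (('p, 'n) jet \<Rightarrow> 'n \<Rightarrow> 'n \<Rightarrow> 'n \<Rightarrow> real) \<Rightarrow>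
    'p \<Rightarrow> 'n \<Rightarrow> 'n \<Rightarrow> 'n \<Rightarrow> ('p, 'n) jet \<Rightarrow> real" where
  "hcovU h g U Lc \<eta> k i j w =
     (let u = (\<lambda>k i (w :: ('p, 'n) jet). curlU U \<eta> k i (fst w) (fst (snd w))) in
      frechet_derivative (u k i) (at w) (adapted h g U (Xix j) w)
      - (\<Sum>m\<in>UNIV. Lc w m k j * u m i w) - (\<Sum>m\<in>UNIV. Lc w m i j * u k m w))"

text \<open>The block diagonal matrix \<open>B\<close> with \<open>X\<^sub>A = \<Sum>\<^sub>A\<^sub>' B\<^sub>A\<^sub>A\<^sub>' X'\<^sub>A\<^sub>'\<close> that relates the adapted frames of
  two induced charts. A d-tensor is a family of components transforming with these blocks.\<close>

fun frame_change :: "('a, 'p::finite) chart \<Rightarrow> ('a, 'p) chart \<Rightarrow> ('b, 'n::finite) chart \<Rightarrow>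
    ('b, 'n) chart \<Rightarrow> ('p, 'n) jet \<Rightarrow> ('p, 'n) aidx \<Rightarrow> ('p, 'n) aidx \<Rightarrow> real" where
  "frame_change a a' b b' (t, x, v) (Tix \<alpha>) (Tix \<beta>) = dcoord a a' t \<beta> \<alpha>"
| "frame_change a a' b b' (t, x, v) (Xix i) (Xix j) = dcoord b b' x j i"
| "frame_change a a' b b' (t, x, v) (Vix i \<alpha>) (Vix j \<beta>) =
     dcoord b b' x j i * dcoord a' a (trans_map a a' t) \<alpha> \<beta>"
| "frame_change a a' b b' w A A' = 0"

definition d_tensor_1_2 :: "('a, 'p::finite) chart set \<Rightarrow> ('b, 'n::finite) chart set \<Rightarrow>
    (('a, 'p) chart \<Rightarrow> ('b, 'n) chart \<Rightarrow> ('p, 'n) jet \<Rightarrow>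
       ('p, 'n) aidx \<Rightarrow> ('p, 'n) aidx \<Rightarrow> ('p, 'n) aidx \<Rightarrow> real) \<Rightarrow> bool" where
  "d_tensor_1_2 AT AM S \<longleftrightarrow>
     (\<forall>a\<in>AT. \<forall>a'\<in>AT. \<forall>b\<in>AM. \<forall>b'\<in>AM. \<forall>w\<in>jet_overlap a a' b b'. \<forall>C A B.
        S a b w C A B = (\<Sum>C'\<in>UNIV. \<Sum>A'\<in>UNIV. \<Sum>B'\<in>UNIV.
          frame_change a' a b' b (jet_trans a a' b b' w) C' C *
          frame_change a a' b b' w A A' * frame_change a a' b b' w B B' *
          S a' b' (jet_trans a a' b b' w) C' A' B'))"

definition d_tensor_1_3 :: "('a, 'p::finite) chart set \<Rightarrow> ('b, 'n::finite) chart set \<Rightarrow>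
    (('a, 'p) chart \<Rightarrow> ('b, 'n) chart \<Rightarrow> ('p, 'n) jet \<Rightarrow>
       ('p, 'n) aidx \<Rightarrow> ('p, 'n) aidx \<Rightarrow> ('p, 'n) aidx \<Rightarrow> ('p, 'n) aidx \<Rightarrow> real) \<Rightarrow> bool" where
  "d_tensor_1_3 AT AM S \<longleftrightarrow>
     (\<forall>a\<in>AT. \<forall>a'\<in>AT. \<forall>b\<in>AM. \<forall>b'\<in>AM. \<forall>w\<in>jet_overlap a a' b b'. \<forall>D A B C.
        S a b w D A B C = (\<Sum>D'\<in>UNIV. \<Sum>A'\<in>UNIV. \<Sum>B'\<in>UNIV. \<Sum>C'\<in>UNIV.
          frame_change a' a b' b (jet_trans a a' b b' w) D' D *
          frame_change a a' b b' w A A' * frame_change a a' b b' w B B' *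
          frame_change a a' b b' w C C' *
          S a' b' (jet_trans a a' b b' w) D' A' B' C'))"

end

theory Submission
  imports Defs
begin

text \<open>In one chart, metric compatibility and symmetry determine the coefficients of the Cartan
  connection as those of the Levi-Civita connections of \<open>h\<close> and \<open>g\<close>. Brackets of adapted frame fields
  are vertical and the connection vanishes in vertical directions, so torsion and curvature reduce to
  finite sums of connection coefficients and their derivatives.

  That the components form d-tensors is shown coordinate-free: the components are multilinear maps
  evaluated on basis vectors. The law \<open>J \<Gamma>(u, v) = \<Gamma>'(J u, J v) + D\<^sup>2\<phi>(u, v)\<close> for a change of
  coordinates \<open>\<phi>\<close> with derivative \<open>J\<close> follows from the uniqueness of the Levi-Civita connection, and
  differentiating it yields the law for the curvature. The remaining torsion components are the
  covariant derivatives of the curl of \<open>U\<close> with one index raised by \<open>g\<close>; their lowered form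
  transforms tensorially by differentiating the law for \<open>U\<close>, and \<open>g\<close> is nondegenerate.\<close>

section \<open>Product, chain and congruence rules for the Frechet derivative\<close>

section \<open>Smooth functions\<close>

text \<open>The vertical bundle behaves like the cotangent bundle of T tensored with the tangent
  bundle of M, with the dual of the Levi-Civita connection of \<open>h\<close> on the first factor
  and that of \<open>g\<close> on the second. This is why the curvature has four nonzero blocks but
  only two independent tensors. The nonlinear connection is the horizontal lift belonging to this
  linear connection, shifted by the curl of \<open>U\<close> with the factor 1/4. The shift does not
  depend on the velocity, so it leaves the torsion with a vertical argument untouched and appears
  only in torsion components whose arguments are both horizontal and not both temporal. There its
  ordinary derivatives complete to covariant ones because \<open>h\<close> and the inverse of
  \<open>g\<close> are parallel. The tensor laws are proved for multilinear maps since in indices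
  each law would be a multiple sum over Jacobians and their inverses; the passage to indices happens
  once, by expanding each slot in the standard basis.\<close>

lemma frechet_derivative_eqI:
  "(f has_derivative f') (at x) \<Longrightarrow> frechet_derivative f (at x) = f'"
  by (rule frechet_derivative_at[symmetric])

lemma has_derivative_cong_open:
  assumes "open S" "x \<in> S" "\<And>y. y \<in> S \<Longrightarrow> f y = g y"
  shows "(f has_derivative D) (at x) \<longleftrightarrow> (g has_derivative D) (at x)"
  using assms by (auto elim!: has_derivative_transform_within_open)

lemma differentiable_cong_open:
  assumes "open S" "x \<in> S" "\<And>y. y \<in> S \<Longrightarrow> f y = g y"
  shows "f differentiable (at x) \<longleftrightarrow> g differentiable (at x)"
  unfolding differentiable_def using has_derivative_cong_open[OF assms] by simp

text \<open>\<open>frechet_derivative\<close> selects from the set of derivatives at the point, and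
  that set depends only on the germ. This turns each chart law valid on an open set into a law for
  derivatives.\<close>

lemma frechet_derivative_cong_open:
  assumes "open S" "x \<in> S" "\<And>y. y \<in> S \<Longrightarrow> f y = g y"
  shows "frechet_derivative f (at x) = frechet_derivative g (at x)"
  unfolding frechet_derivative_def using has_derivative_cong_open[OF assms] by simp

lemma differentiable_bounded_linear_compose:
  assumes "bounded_linear L" "f differentiable (at x)"
  shows "(\<lambda>y. L (f y)) differentiable (at x)"
  using bounded_linear.has_derivative[OF assms(1)] assms(2) unfolding differentiable_def by blast

lemma frechet_derivative_bounded_linear_compose:
  assumes "bounded_linear L" "f differentiable (at x)"
  shows "frechet_derivative (\<lambda>y. L (f y)) (at x) v = L (frechet_derivative f (at x) v)"
  using frechet_derivative_eqI[OF bounded_linear.has_derivative[OF assms(1)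
        assms(2)[unfolded frechet_derivative_works]]] by simp

lemma frechet_derivative_bilinear:
  assumes "bounded_bilinear B" "f differentiable (at x)" "g differentiable (at x)"
  shows "frechet_derivative (\<lambda>y. B (f y) (g y)) (at x) v =
      B (f x) (frechet_derivative g (at x) v) + B (frechet_derivative f (at x) v) (g x)"
  using frechet_derivative_eqI[OF bounded_bilinear.FDERIV[OF assms(1)
        assms(2)[unfolded frechet_derivative_works] assms(3)[unfolded frechet_derivative_works]]]
  by simp

lemma differentiable_bilinear:
  assumes "bounded_bilinear B" "f differentiable (at x)" "g differentiable (at x)"
  shows "(\<lambda>y. B (f y) (g y)) differentiable (at x)"
  using bounded_bilinear.FDERIV[OF assms(1)] assms(2,3) unfolding differentiable_def by blast

lemma frechet_derivative_add:
  assumes "f differentiable (at x)" "g differentiable (at x)"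
  shows "frechet_derivative (\<lambda>y. f y + g y) (at x) v =
      frechet_derivative f (at x) v + frechet_derivative g (at x) v"
  using frechet_derivative_eqI[OF has_derivative_add[OF assms[unfolded frechet_derivative_works]]]
  by simp

lemma frechet_derivative_diff:
  assumes "f differentiable (at x)" "g differentiable (at x)"
  shows "frechet_derivative (\<lambda>y. f y - g y) (at x) v =
      frechet_derivative f (at x) v - frechet_derivative g (at x) v"
  using frechet_derivative_eqI[OF has_derivative_diff[OF assms[unfolded frechet_derivative_works]]]
  by simp

lemma frechet_derivative_uminus:
  assumes "f differentiable (at x)"
  shows "frechet_derivative (\<lambda>y. - f y) (at x) v = - frechet_derivative f (at x) v"
  using frechet_derivative_eqI[OF has_derivative_minus[OF assms[unfolded frechet_derivative_works]]]
  by simp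

lemma frechet_derivative_sum:
  assumes "\<And>i. i \<in> I \<Longrightarrow> f i differentiable (at x)"
  shows "frechet_derivative (\<lambda>y. \<Sum>i\<in>I. f i y) (at x) v =
      (\<Sum>i\<in>I. frechet_derivative (f i) (at x) v)"
proof -
  have "((\<lambda>y. \<Sum>i\<in>I. f i y) has_derivative (\<lambda>v. \<Sum>i\<in>I. frechet_derivative (f i) (at x) v)) (at x)"
    using assms frechet_derivative_works by (intro has_derivative_sum) blast
  from frechet_derivative_eqI[OF this] show ?thesis by simp
qed

lemma frechet_derivative_mult:
  fixes f g :: "'a::real_normed_vector \<Rightarrow> real"
  assumes "f differentiable (at x)" "g differentiable (at x)"
  shows "frechet_derivative (\<lambda>y. f y * g y) (at x) v =
      f x * frechet_derivative g (at x) v + frechet_derivative f (at x) v * g x"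
  by (rule frechet_derivative_bilinear[OF bounded_bilinear_mult assms])

lemma frechet_derivative_compose:
  assumes "f differentiable (at (g x))" "g differentiable (at x)"
  shows "frechet_derivative (\<lambda>y. f (g y)) (at x) v =
      frechet_derivative f (at (g x)) (frechet_derivative g (at x) v)"
  using frechet_derivative_eqI[OF has_derivative_compose[OF
        assms(2)[unfolded frechet_derivative_works] assms(1)[unfolded frechet_derivative_works]]]
  by simp

section \<open>C^k and smooth maps on open sets and their closure properties\<close>

lemma Ck_on_cong:
  assumes "open S" "\<And>x. x \<in> S \<Longrightarrow> f x = g x"
  shows "Ck_on k S f \<longleftrightarrow> Ck_on k S g"
  using assms(2)
proof (induction k arbitrary: f g)
  case 0
  then show ?case using continuous_on_cong by auto
next
  case (Suc k)
  have "frechet_derivative f (at x) = frechet_derivative g (at x)" if "x \<in> S" for x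
    using frechet_derivative_cong_open[OF assms(1) that Suc.prems] .
  then have "Ck_on k S (\<lambda>x. frechet_derivative f (at x) v) \<longleftrightarrow>
      Ck_on k S (\<lambda>x. frechet_derivative g (at x) v)" for v
    by (intro Suc.IH) simp
  moreover have "f differentiable (at x) \<longleftrightarrow> g differentiable (at x)" if "x \<in> S" for x
    using differentiable_cong_open[OF assms(1) that Suc.prems] .
  ultimately show ?case by auto
qed

text \<open>In the closure proofs the differentiation rules hold at points of \<open>S\<close> only;
  openness of \<open>S\<close> lets such a pointwise formula stand in for the derivative as a
  map.\<close>

lemma Ck_on_transfer:
  "Ck_on k S g \<Longrightarrow> open S \<Longrightarrow> (\<And>x. x \<in> S \<Longrightarrow> f x = g x) \<Longrightarrow> Ck_on k S f"
  using Ck_on_cong[of S f g] by simp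

lemma Ck_on_SucD: "Ck_on (Suc k) S f \<Longrightarrow> Ck_on k S f"
proof (induction k arbitrary: f)
  case 0
  then show ?case
    by (auto intro!: continuous_at_imp_continuous_on dest: differentiable_imp_continuous_within)
next
  case (Suc k)
  from Suc.prems have "Ck_on (Suc k) S (\<lambda>x. frechet_derivative f (at x) v)" for v
    by simp
  then have "Ck_on k S (\<lambda>x. frechet_derivative f (at x) v)" for v
    by (rule Suc.IH)
  with Suc.prems show ?case by auto
qed

lemma Ck_on_const: "Ck_on k S (\<lambda>x. c)"
proof (induction k arbitrary: c)
  case (Suc k)
  have "(\<lambda>x. frechet_derivative (\<lambda>x. c) (at x) v) = (\<lambda>x. 0)" for v
    by (simp add: frechet_derivative_const)
  with Suc show ?case by (simp only: Ck_on.simps) auto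
qed simp

lemma Ck_on_linear:
  assumes "bounded_linear L"
  shows "Ck_on k S L"
proof (cases k)
  case 0
  then show ?thesis using assms by (simp add: linear_continuous_on)
next
  case (Suc l)
  have "(\<lambda>x. frechet_derivative L (at x) v) = (\<lambda>x. L v)" for v
    using frechet_derivative_eqI[OF bounded_linear_imp_has_derivative[OF assms]] by auto
  then show ?thesis
    using assms Ck_on_const bounded_linear_imp_differentiable Suc by auto
qed

lemma Ck_on_bounded_linear_compose:
  assumes "open S" "bounded_linear L" "Ck_on k S f"
  shows "Ck_on k S (\<lambda>x. L (f x))"
  using assms(3)
proof (induction k arbitrary: f)
  case 0
  then show ?case using bounded_linear.continuous_on[OF assms(2)] by simp
next
  case (Suc k)
  have "Ck_on k S (\<lambda>x. frechet_derivative (\<lambda>x. L (f x)) (at x) v)" for v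
    by (rule Ck_on_transfer[of _ _ "\<lambda>x. L (frechet_derivative f (at x) v)", OF _ assms(1)])
      (use Suc in \<open>auto simp: frechet_derivative_bounded_linear_compose[OF assms(2)]\<close>)
  with Suc.prems show ?case
    using differentiable_bounded_linear_compose[OF assms(2)] by auto
qed

text \<open>A linear inner map has constant derivative, so the derivative of the composite along
  \<open>v\<close> is that of \<open>f\<close> along \<open>P v\<close>, again composed with
  \<open>P\<close>, and the induction closes. Chart data are lifted to jet space along linear
  projections.\<close>

lemma Ck_on_compose_bounded_linear:
  assumes "open W" "bounded_linear P" "\<And>w. w \<in> W \<Longrightarrow> P w \<in> S" "Ck_on k S f"
  shows "Ck_on k W (\<lambda>w. f (P w))"
  using assms(4)
proof (induction k arbitrary: f)
  case 0
  then show ?case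
    using continuous_on_compose2[OF _ linear_continuous_on[OF assms(2)]] assms(3)
    by (metis Ck_on.simps(1) image_subsetI)
next
  case (Suc k)
  have P: "(P has_derivative P) (at w)" for w
    using assms(2) by (rule bounded_linear_imp_has_derivative)
  have eq: "frechet_derivative P (at w) v = P v" for w v
    by (simp add: frechet_derivative_eqI[OF P])
  have dP: "P differentiable (at w)" for w
    using P differentiable_def by blast
  have "Ck_on k W (\<lambda>w. frechet_derivative (\<lambda>w. f (P w)) (at w) v)" for v
    by (rule Ck_on_transfer[of _ _ "\<lambda>w. frechet_derivative f (at (P w)) (P v)", OF _ assms(1)])
      (use Suc assms(3) in \<open>auto simp: frechet_derivative_compose dP eq\<close>)
  moreover have "(\<lambda>w. f (P w)) differentiable (at w)" if "w \<in> W" for w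
    using differentiable_compose[OF _ dP] Suc.prems assms(3) that by auto
  ultimately show ?case by auto
qed

lemma Ck_on_add:
  assumes "open S" "Ck_on k S f" "Ck_on k S g"
  shows "Ck_on k S (\<lambda>x. f x + g x)"
  using assms(2,3)
proof (induction k arbitrary: f g)
  case 0
  then show ?case by (simp add: continuous_on_add)
next
  case (Suc k)
  have "Ck_on k S (\<lambda>x. frechet_derivative (\<lambda>x. f x + g x) (at x) v)" for v
    by (rule Ck_on_transfer[of _ _ "\<lambda>x. frechet_derivative f (at x) v + frechet_derivative g (at x) v", OF _ assms(1)])
      (use Suc in \<open>auto simp: frechet_derivative_add\<close>)
  with Suc.prems show ?case by auto
qed

text \<open>The Leibniz rule pairs one factor with a derivative of the other;
  \<open>Ck_on_SucD\<close> lowers the undifferentiated factor to the class of the induction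
  hypothesis.\<close>

lemma Ck_on_bilinear:
  assumes "open S" "bounded_bilinear B" "Ck_on k S f" "Ck_on k S g"
  shows "Ck_on k S (\<lambda>x. B (f x) (g x))"
  using assms(3,4)
proof (induction k arbitrary: f g)
  case 0
  then show ?case using bounded_bilinear.continuous_on[OF assms(2)] by simp
next
  case (Suc k)
  have "Ck_on k S (\<lambda>x. frechet_derivative (\<lambda>x. B (f x) (g x)) (at x) v)" for v
    by (rule Ck_on_transfer[of _ _ "\<lambda>x. B (f x) (frechet_derivative g (at x) v) +
            B (frechet_derivative f (at x) v) (g x)", OF _ assms(1)])
      (use Suc Suc.prems[THEN Ck_on_SucD] in
        \<open>auto simp: frechet_derivative_bilinear[OF assms(2)] intro!: Ck_on_add assms(1)\<close>)
  with Suc.prems show ?case by (auto intro: differentiable_bilinear[OF assms(2)])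
qed

text \<open>The derivative of 1/f is a product of 1/f, the derivative of f and 1/f, so the induction
  hypothesis is applied to the same \<open>f\<close>.\<close>

lemma Ck_on_inverse:
  fixes f :: "'a::real_normed_vector \<Rightarrow> real"
  assumes "open S" "\<And>x. x \<in> S \<Longrightarrow> f x \<noteq> 0" "Ck_on k S f"
  shows "Ck_on k S (\<lambda>x. inverse (f x))"
  using assms(3)
proof (induction k)
  case 0
  then show ?case using assms(2) by (simp add: continuous_on_inverse)
next
  case (Suc k)
  let ?f = "\<lambda>v x. - (inverse (f x) * frechet_derivative f (at x) v * inverse (f x))"
  note IH = Suc.IH[OF Ck_on_SucD[OF Suc.prems]]
  have D: "((\<lambda>x. inverse (f x)) has_derivative
      (\<lambda>v. - (inverse (f x) * frechet_derivative f (at x) v * inverse (f x)))) (at x)"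
    if "x \<in> S" for x
    using Suc.prems assms(2) that frechet_derivative_works by (intro Deriv.has_derivative_inverse) auto
  have "Ck_on k S (?f v)" for v
    using Suc.prems
    by (intro Ck_on_bounded_linear_compose[OF assms(1) bounded_linear_minus[OF bounded_linear_ident]]
        Ck_on_bilinear[OF assms(1) bounded_bilinear_mult] IH) auto
  then have "Ck_on k S (\<lambda>x. frechet_derivative (\<lambda>x. inverse (f x)) (at x) v)" for v
    by (rule Ck_on_transfer[OF _ assms(1)])
      (use frechet_derivative_eqI[OF D] in auto)
  then show ?case using D by (auto simp: differentiable_def)
qed

lemma smooth_on_cong:
  "open S \<Longrightarrow> (\<And>x. x \<in> S \<Longrightarrow> f x = g x) \<Longrightarrow> smooth_on S f \<longleftrightarrow> smooth_on S g"
  unfolding smooth_on_def using Ck_on_cong[of S f g] by auto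

lemma smooth_on_const: "smooth_on S (\<lambda>x. c)"
  by (simp add: smooth_on_def Ck_on_const)

lemma smooth_on_bounded_linear_compose:
  "open S \<Longrightarrow> bounded_linear L \<Longrightarrow> smooth_on S f \<Longrightarrow> smooth_on S (\<lambda>x. L (f x))"
  by (simp add: smooth_on_def Ck_on_bounded_linear_compose)

lemma smooth_on_linear: "bounded_linear L \<Longrightarrow> smooth_on S L"
  by (simp add: smooth_on_def Ck_on_linear)

lemma smooth_on_compose_bounded_linear:
  "open W \<Longrightarrow> bounded_linear P \<Longrightarrow> (\<And>w. w \<in> W \<Longrightarrow> P w \<in> S) \<Longrightarrow> smooth_on S f \<Longrightarrow>
    smooth_on W (\<lambda>w. f (P w))"
  unfolding smooth_on_def using Ck_on_compose_bounded_linear[of W P S] by blast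

lemma smooth_on_add:
  "open S \<Longrightarrow> smooth_on S f \<Longrightarrow> smooth_on S g \<Longrightarrow> smooth_on S (\<lambda>x. f x + g x)"
  by (simp add: smooth_on_def Ck_on_add)

lemma smooth_on_uminus: "open S \<Longrightarrow> smooth_on S f \<Longrightarrow> smooth_on S (\<lambda>x. - f x)"
  by (rule smooth_on_bounded_linear_compose[OF _ bounded_linear_minus[OF bounded_linear_ident]])

lemma smooth_on_diff:
  "open S \<Longrightarrow> smooth_on S f \<Longrightarrow> smooth_on S g \<Longrightarrow> smooth_on S (\<lambda>x. f x - g x)"
  using smooth_on_add[of S f "\<lambda>x. - g x"] smooth_on_uminus[of S g] by simp

lemma smooth_on_bilinear:
  "open S \<Longrightarrow> bounded_bilinear B \<Longrightarrow> smooth_on S f \<Longrightarrow> smooth_on S g \<Longrightarrow>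
    smooth_on S (\<lambda>x. B (f x) (g x))"
  by (simp add: smooth_on_def Ck_on_bilinear)

lemmas smooth_on_mult = smooth_on_bilinear[OF _ bounded_bilinear_mult]
lemmas smooth_on_scaleR = smooth_on_bilinear[OF _ bounded_bilinear_scaleR]

lemma smooth_on_divide:
  fixes f g :: "'a::real_normed_vector \<Rightarrow> real"
  assumes "open S" "smooth_on S f" "smooth_on S g" "\<And>x. x \<in> S \<Longrightarrow> g x \<noteq> 0"
  shows "smooth_on S (\<lambda>x. f x / g x)"
  using assms Ck_on_inverse[of S g] Ck_on_bilinear[OF assms(1) bounded_bilinear_mult, of _ f]
  unfolding divide_inverse smooth_on_def by blast

lemma smooth_on_sum:
  "open S \<Longrightarrow> (\<And>i. i \<in> I \<Longrightarrow> smooth_on S (f i)) \<Longrightarrow> smooth_on S (\<lambda>x. \<Sum>i\<in>I. f i x)"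
  by (induction I rule: infinite_finite_induct) (auto intro: smooth_on_const smooth_on_add)

lemma smooth_on_prod:
  fixes f :: "'i \<Rightarrow> 'a::real_normed_vector \<Rightarrow> real"
  shows "open S \<Longrightarrow> (\<And>i. i \<in> I \<Longrightarrow> smooth_on S (f i)) \<Longrightarrow> smooth_on S (\<lambda>x. \<Prod>i\<in>I. f i x)"
  by (induction I rule: infinite_finite_induct) (auto intro: smooth_on_const smooth_on_mult)

lemma smooth_on_component:
  "open S \<Longrightarrow> smooth_on S f \<Longrightarrow> smooth_on S (\<lambda>x. f x $ i)"
  by (rule smooth_on_bounded_linear_compose[OF _ bounded_linear_vec_nth])

lemma smooth_on_frechet_derivative:
  "smooth_on S f \<Longrightarrow> smooth_on S (\<lambda>x. frechet_derivative f (at x) v)"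
  unfolding smooth_on_def by (metis Ck_on.simps(2))

lemma smooth_on_imp_differentiable: "smooth_on S f \<Longrightarrow> x \<in> S \<Longrightarrow> f differentiable (at x)"
  unfolding smooth_on_def by (metis Ck_on.simps(2))

lemma smooth_on_imp_continuous_on: "smooth_on S f \<Longrightarrow> continuous_on S f"
  unfolding smooth_on_def by (metis Ck_on.simps(1))

text \<open>\<open>Ck_on\<close> controls derivatives in fixed directions; a variable direction is
  expanded in the standard basis with smooth coefficients.\<close>

lemma smooth_on_frechet_derivative_field:
  fixes X :: "'a::euclidean_space \<Rightarrow> 'a"
  assumes "open S" "smooth_on S f" "smooth_on S X"
  shows "smooth_on S (\<lambda>x. frechet_derivative f (at x) (X x))"
proof -
  have "frechet_derivative f (at x) (X x) = (\<Sum>b\<in>Basis. (X x \<bullet> b) *\<^sub>R frechet_derivative f (at x) b)"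
    if "x \<in> S" for x
  proof -
    have lin: "linear (frechet_derivative f (at x))"
      using smooth_on_imp_differentiable[OF assms(2) that] by (rule linear_frechet_derivative)
    have "frechet_derivative f (at x) (X x) = frechet_derivative f (at x) (\<Sum>b\<in>Basis. (X x \<bullet> b) *\<^sub>R b)"
      by (simp only: euclidean_representation)
    then show ?thesis by (simp add: linear_sum[OF lin] linear_cmul[OF lin])
  qed
  moreover have "smooth_on S (\<lambda>x. \<Sum>b\<in>Basis. (X x \<bullet> b) *\<^sub>R frechet_derivative f (at x) b)"
    by (intro smooth_on_sum smooth_on_scaleR smooth_on_frechet_derivative assms
        smooth_on_bounded_linear_compose[OF _ bounded_linear_inner_left])
  ultimately show ?thesis using smooth_on_cong[OF assms(1)] by (metis (no_types, lifting))
qed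

lemma smooth_on_det:
  fixes A :: "'a::real_normed_vector \<Rightarrow> real ^ 'd ^ 'd"
  assumes "open S" "\<And>i j. smooth_on S (\<lambda>x. A x $ i $ j)"
  shows "smooth_on S (\<lambda>x. det (A x))"
  unfolding det_def by (intro smooth_on_sum smooth_on_mult smooth_on_const smooth_on_prod assms)

lemma matrix_inv_left_right:
  fixes A :: "real ^ 'd ^ 'd"
  assumes "invertible A"
  shows "A ** matrix_inv A = mat 1" "matrix_inv A ** A = mat 1"
  using assms unfolding invertible_def matrix_inv_def by (metis (mono_tags, lifting) someI_ex)+

text \<open>By Cramer's rule an entry of the inverse is a quotient of determinants. The numerator
  \<open>?C\<close> has column \<open>k\<close> replaced by the \<open>l\<close>-th unit vector,
  because column \<open>l\<close> of the inverse solves the linear system with that right-hand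
  side.\<close>

lemma smooth_on_matrix_inv:
  fixes A :: "'a::real_normed_vector \<Rightarrow> real ^ 'd ^ 'd"
  assumes "open S" "smooth_on S A" "\<And>x. x \<in> S \<Longrightarrow> invertible (A x)"
  shows "smooth_on S (\<lambda>x. matrix_inv (A x) $ k $ l)"
proof -
  let ?C = "\<lambda>x. (\<chi> i j. if j = k then axis l 1 $ i else A x $ i $ j)"
  have "matrix_inv (A x) $ k $ l = det (?C x) / det (A x)" if "x \<in> S" for x
  proof -
    have "A x *v (matrix_inv (A x) *v axis l 1) = axis l 1"
      by (simp add: matrix_vector_mul_assoc matrix_inv_left_right[OF assms(3)[OF that]])
    then have "matrix_inv (A x) *v axis l 1 =
        (\<chi> k. det (\<chi> i j. if j = k then axis l 1 $ i else A x $ i $ j) / det (A x))"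
      using cramer assms(3)[OF that] invertible_det_nz by blast
    then show ?thesis
      by (simp add: vec_eq_iff matrix_vector_mul_component inner_axis)
  qed
  moreover have "smooth_on S (\<lambda>x. det (?C x) / det (A x))"
  proof (intro smooth_on_divide smooth_on_det assms)
    show "smooth_on S (\<lambda>x. ?C x $ i $ j)" for i j
      by (cases "j = k") (auto intro!: smooth_on_const smooth_on_component assms)
    show "smooth_on S (\<lambda>x. A x $ i $ j)" for i j
      by (intro smooth_on_component assms)
    show "det (A x) \<noteq> 0" if "x \<in> S" for x
      using assms(3)[OF that] by (simp add: invertible_det_nz)
  qed
  ultimately show ?thesis using smooth_on_cong[OF assms(1)] by (metis (no_types, lifting))
qed

section \<open>Symmetry of second derivatives\<close>

lemma frechet_derivative_along_line:
  fixes f :: "'a::real_normed_vector \<Rightarrow> real"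
  assumes "f differentiable (at (z + r *\<^sub>R u))"
  shows "((\<lambda>r. f (z + r *\<^sub>R u)) has_real_derivative
      frechet_derivative f (at (z + r *\<^sub>R u)) u) (at r)"
proof -
  have "((\<lambda>r. z + r *\<^sub>R u) has_derivative (\<lambda>s. s *\<^sub>R u)) (at r)"
    by (auto intro!: derivative_eq_intros)
  from has_derivative_compose[OF this assms[unfolded frechet_derivative_works]]
  have "((\<lambda>r. f (z + r *\<^sub>R u)) has_derivative
      (\<lambda>s. frechet_derivative f (at (z + r *\<^sub>R u)) (s *\<^sub>R u))) (at r)" .
  moreover have "frechet_derivative f (at (z + r *\<^sub>R u)) (s *\<^sub>R u) =
      frechet_derivative f (at (z + r *\<^sub>R u)) u * s" for s
    using linear_cmul[OF linear_frechet_derivative[OF assms]] by simp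
  ultimately show ?thesis by (simp add: has_field_derivative_def)
qed

text \<open>The mean value theorem is used once along \<open>u\<close>, for the difference of
  \<open>f\<close> on two parallel segments, and once along \<open>v\<close>, for the resulting
  difference of derivatives. The second difference on the left is symmetric in \<open>u\<close> and
  \<open>v\<close>; only the right-hand side sees the order of differentiation.\<close>

lemma second_difference_mvt:
  fixes f :: "'a::real_normed_vector \<Rightarrow> real"
  assumes f: "smooth_on S f" and s: "s > 0"
    and S: "\<And>a b. 0 \<le> a \<Longrightarrow> a \<le> s \<Longrightarrow> 0 \<le> b \<Longrightarrow> b \<le> s \<Longrightarrow> x + a *\<^sub>R u + b *\<^sub>R v \<in> S"
  shows "\<exists>a b. 0 < a \<and> a < s \<and> 0 < b \<and> b < s \<and>
     f (x + s *\<^sub>R u + s *\<^sub>R v) - f (x + s *\<^sub>R u) - f (x + s *\<^sub>R v) + f x =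
     s * s * frechet_derivative (\<lambda>y. frechet_derivative f (at y) u) (at (x + a *\<^sub>R u + b *\<^sub>R v)) v"
proof -
  let ?D = "\<lambda>y. frechet_derivative f (at y) u"
  let ?p = "\<lambda>r. f ((x + s *\<^sub>R v) + r *\<^sub>R u) - f (x + r *\<^sub>R u)"
  have d: "f differentiable (at y)" "?D differentiable (at y)" if "y \<in> S" for y
    using that f smooth_on_frechet_derivative smooth_on_imp_differentiable by blast+
  have "\<exists>z>0. z < s \<and> ?p s - ?p 0 = (s - 0) * (?D (x + s *\<^sub>R v + z *\<^sub>R u) - ?D (x + z *\<^sub>R u))"
  proof (rule MVT2[OF s])
    fix r assume r: "0 \<le> r" "r \<le> s"
    have "x + s *\<^sub>R v + r *\<^sub>R u \<in> S" "x + r *\<^sub>R u \<in> S"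
      using S[of r s] S[of r 0] r s by (simp_all add: algebra_simps)
    then show "DERIV ?p r :> ?D (x + s *\<^sub>R v + r *\<^sub>R u) - ?D (x + r *\<^sub>R u)"
      by (intro DERIV_diff frechet_derivative_along_line d)
  qed
  then obtain a where a: "0 < a" "a < s"
    and pa: "?p s - ?p 0 = s * (?D (x + s *\<^sub>R v + a *\<^sub>R u) - ?D (x + a *\<^sub>R u))" by auto
  let ?q = "\<lambda>r. ?D (x + a *\<^sub>R u + r *\<^sub>R v)"
  have "\<exists>z>0. z < s \<and> ?q s - ?q 0 = (s - 0) * frechet_derivative ?D (at (x + a *\<^sub>R u + z *\<^sub>R v)) v"
    by (rule MVT2[OF s], rule frechet_derivative_along_line, rule d, rule S) (use a in auto)
  then obtain b where b: "0 < b" "b < s"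
    and qb: "?q s - ?q 0 = s * frechet_derivative ?D (at (x + a *\<^sub>R u + b *\<^sub>R v)) v" by auto
  have "?p s - ?p 0 = s * (?q s - ?q 0)"
    using pa by (simp add: algebra_simps)
  then have "?p s - ?p 0 = s * s * frechet_derivative ?D (at (x + a *\<^sub>R u + b *\<^sub>R v)) v"
    using qb by simp
  then show ?thesis using a b by (intro exI[of _ a] exI[of _ b]) (auto simp: algebra_simps)
qed

lemma frechet_derivative_commute_real:
  fixes f :: "'a::real_normed_vector \<Rightarrow> real"
  assumes "open S" "x \<in> S" "smooth_on S f"
  shows "frechet_derivative (\<lambda>y. frechet_derivative f (at y) u) (at x) v =
         frechet_derivative (\<lambda>y. frechet_derivative f (at y) v) (at x) u"
proof -
  let ?D = "\<lambda>u v y. frechet_derivative (\<lambda>y. frechet_derivative f (at y) u) (at y) v"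
  obtain e where e: "e > 0" "ball x e \<subseteq> S"
    using assms(1,2) openE by blast
  have "\<bar>?D u v x - ?D v u x\<bar> < 2 * \<epsilon>" if \<epsilon>: "\<epsilon> > 0" for \<epsilon>
  proof -
    have "continuous (at x) (?D u v)" "continuous (at x) (?D v u)"
      using assms(1,2) smooth_on_imp_continuous_on[OF smooth_on_frechet_derivative[OF
          smooth_on_frechet_derivative[OF assms(3)]]] continuous_on_eq_continuous_at by blast+
    then obtain d1 d2 where d1: "d1 > 0" "\<And>y. dist y x < d1 \<Longrightarrow> dist (?D u v y) (?D u v x) < \<epsilon>"
      and d2: "d2 > 0" "\<And>y. dist y x < d2 \<Longrightarrow> dist (?D v u y) (?D v u x) < \<epsilon>"
      unfolding continuous_at_eps_delta using \<epsilon> by metis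
    define d where "d = Min {e, d1, d2}"
    have d: "d > 0" "d \<le> e" "d \<le> d1" "d \<le> d2" using e d1 d2 by (auto simp: d_def)
    \<comment> \<open>The sides of the parallelogram then have total length below \<open>d\<close>;
      the summand 1 keeps the denominator positive.\<close>
    define s where "s = d / (norm u + norm v + 1)"
    have s: "s > 0" using d by (simp add: s_def add_nonneg_pos)
    have near: "dist (x + a *\<^sub>R u + b *\<^sub>R v) x < d"
      if "0 \<le> a" "a \<le> s" "0 \<le> b" "b \<le> s" for a b
    proof -
      have "dist (x + a *\<^sub>R u + b *\<^sub>R v) x = norm (a *\<^sub>R u + b *\<^sub>R v)"
        by (simp add: dist_norm add.assoc)
      also have "\<dots> \<le> a * norm u + b * norm v"
        using norm_triangle_ineq[of "a *\<^sub>R u" "b *\<^sub>R v"] that by simp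
      also have "\<dots> \<le> s * norm u + s * norm v"
        using that by (intro add_mono mult_right_mono) auto
      also have "\<dots> < s * (norm u + norm v + 1)" using s by (simp add: algebra_simps)
      also have "\<dots> = d"
        using norm_ge_zero[of u] norm_ge_zero[of v] unfolding s_def by (simp add: add_nonneg_eq_0_iff)
      finally show ?thesis .
    qed
    have inS: "x + a *\<^sub>R u + b *\<^sub>R v \<in> S" if "0 \<le> a" "a \<le> s" "0 \<le> b" "b \<le> s" for a b
      using near[OF that] d e by (auto simp: dist_commute subset_iff)
    obtain a b where ab: "0 < a" "a < s" "0 < b" "b < s"
     "f (x + s *\<^sub>R u + s *\<^sub>R v) - f (x + s *\<^sub>R u) - f (x + s *\<^sub>R v) + f x =
       s * s * ?D u v (x + a *\<^sub>R u + b *\<^sub>R v)"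
      using second_difference_mvt[OF assms(3) s inS] by blast
    have inS': "x + b *\<^sub>R v + a *\<^sub>R u \<in> S" if "0 \<le> b" "b \<le> s" "0 \<le> a" "a \<le> s" for a b
      using inS[of a b] that by (simp add: algebra_simps)
    obtain a' b' where ab': "0 < a'" "a' < s" "0 < b'" "b' < s"
     "f (x + s *\<^sub>R v + s *\<^sub>R u) - f (x + s *\<^sub>R v) - f (x + s *\<^sub>R u) + f x =
       s * s * ?D v u (x + b' *\<^sub>R v + a' *\<^sub>R u)"
      using second_difference_mvt[OF assms(3) s inS'] by blast
    have "s * s * ?D u v (x + a *\<^sub>R u + b *\<^sub>R v) = s * s * ?D v u (x + b' *\<^sub>R v + a' *\<^sub>R u)"
      using ab(5) ab'(5) by (simp add: algebra_simps)
    then have eq: "?D u v (x + a *\<^sub>R u + b *\<^sub>R v) = ?D v u (x + a' *\<^sub>R u + b' *\<^sub>R v)"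
      using s by (simp add: algebra_simps)
    have "dist (?D u v (x + a *\<^sub>R u + b *\<^sub>R v)) (?D u v x) < \<epsilon>"
      using d1(2) near[of a b] d ab by force
    moreover have "dist (?D v u (x + a' *\<^sub>R u + b' *\<^sub>R v)) (?D v u x) < \<epsilon>"
      using d2(2) near[of a' b'] d ab' by force
    ultimately show ?thesis using eq by (simp add: dist_real_def)
  qed
  \<comment> \<open>With \<epsilon> equal to half of the distance, a positive distance would be
    smaller than itself.\<close>
  from this[of "\<bar>?D u v x - ?D v u x\<bar> / 2"] show ?thesis by auto
qed

lemma frechet_derivative_commute:
  fixes f :: "'a::real_normed_vector \<Rightarrow> 'b::euclidean_space"
  assumes S: "open S" "x \<in> S" "smooth_on S f"
  shows "frechet_derivative (\<lambda>y. frechet_derivative f (at y) u) (at x) v =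
         frechet_derivative (\<lambda>y. frechet_derivative f (at y) v) (at x) u"
proof (rule euclidean_eqI)
  fix b :: 'b
  have eq: "frechet_derivative (\<lambda>y. frechet_derivative f (at y) u) (at x) v \<bullet> b =
      frechet_derivative (\<lambda>y. frechet_derivative (\<lambda>y. f y \<bullet> b) (at y) u) (at x) v" for u v
  proof -
    have "frechet_derivative (\<lambda>y. frechet_derivative f (at y) u) (at x) v \<bullet> b =
        frechet_derivative (\<lambda>y. frechet_derivative f (at y) u \<bullet> b) (at x) v"
      using frechet_derivative_bounded_linear_compose[OF bounded_linear_inner_left
          smooth_on_imp_differentiable[OF smooth_on_frechet_derivative[OF S(3)] S(2)]] by simp
    also have "\<dots> = frechet_derivative (\<lambda>y. frechet_derivative (\<lambda>y. f y \<bullet> b) (at y) u) (at x) v"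
      by (rule fun_cong[OF frechet_derivative_cong_open[OF S(1,2)]])
        (simp add: frechet_derivative_bounded_linear_compose[OF bounded_linear_inner_left
          smooth_on_imp_differentiable[OF S(3)]])
    finally show ?thesis .
  qed
  show "frechet_derivative (\<lambda>y. frechet_derivative f (at y) u) (at x) v \<bullet> b =
      frechet_derivative (\<lambda>y. frechet_derivative f (at y) v) (at x) u \<bullet> b"
    unfolding eq
    by (rule frechet_derivative_commute_real[OF S(1,2)
          smooth_on_bounded_linear_compose[OF S(1) bounded_linear_inner_left S(3)]])
qed

section \<open>Koszul formula, Christoffel symbols and parallelism of the metric and its
  inverse\<close>

section \<open>The Levi-Civita connection in one chart\<close>

text \<open>Lowering the upper index turns the compatibility condition into a sum of two lowered
  coefficients; the cyclic combination with signs +, +, - isolates one of them by symmetry. The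
  array \<open>d\<close> is kept abstract so that the same algebra serves the spatial coefficients
  (derivatives of \<open>g\<close>) and the vertical ones (\<open>d\<close> zero).\<close>

lemma koszul:
  fixes G :: "'d::finite \<Rightarrow> 'd \<Rightarrow> real"
  assumes "\<And>i j. G i j = G j i" and "\<And>i j k. L i j k = L i k j"
    and "\<And>k i j. d k i j = (\<Sum>m\<in>UNIV. L m i k * G m j) + (\<Sum>m\<in>UNIV. L m j k * G i m)"
  shows "2 * (\<Sum>m\<in>UNIV. L m j k * G m l) = d j l k + d k l j - d l j k"
proof -
  define low where "low = (\<lambda>l j k. \<Sum>m\<in>UNIV. L m j k * G m l)"
  have d: "d k i j = low j i k + low i j k" for k i j
    unfolding assms(3) low_def using assms(1) by (intro arg_cong2[of _ _ _ _ "(+)"] sum.cong) simp_all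
  have s: "low l j k = low l k j" for l j k
    unfolding low_def using assms(2) by (intro sum.cong) simp_all
  show ?thesis
    using d[of j l k] d[of k l j] d[of l j k] s[of k l j] s[of j l k] s[of l j k]
    unfolding low_def by linarith
qed

lemma pd_mult:
  assumes "f differentiable (at y)" "g differentiable (at y)"
  shows "pd i (\<lambda>z. f z * g z) y = f y * pd i g y + pd i f y * g y"
  unfolding pd_def by (rule frechet_derivative_mult[OF assms])

lemma pd_sum:
  assumes "\<And>i. i \<in> I \<Longrightarrow> f i differentiable (at y)"
  shows "pd l (\<lambda>z. \<Sum>i\<in>I. f i z) y = (\<Sum>i\<in>I. pd l (f i) y)"
  unfolding pd_def by (rule frechet_derivative_sum[OF assms])

lemma smooth_on_pd: "smooth_on S f \<Longrightarrow> smooth_on S (pd i f)"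
  unfolding pd_def by (rule smooth_on_frechet_derivative)

lemma sum_delta_mult:
  fixes f :: "'d::finite \<Rightarrow> real"
  shows "(\<Sum>k\<in>UNIV. f k * (if k = i then 1 else 0)) = f i"
    and "(\<Sum>k\<in>UNIV. f k * (if i = k then 1 else 0)) = f i"
    and "(\<Sum>k\<in>UNIV. (if k = i then 1 else 0) * f k) = f i"
    and "(\<Sum>k\<in>UNIV. (if i = k then 1 else 0) * f k) = f i"
  by (simp_all add: if_distrib if_distribR cong: if_cong)

text \<open>The data of a metric on an arbitrary open set, so that it can be instantiated with the
  image of a chart as well as with the overlap of two charts.\<close>

locale metric_chart =
  fixes S :: "(real ^ 'd::finite) set" and g :: "real ^ 'd \<Rightarrow> real ^ 'd ^ 'd"
  assumes open_S: "open S"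
    and smooth: "smooth_on S g"
    and sym: "y \<in> S \<Longrightarrow> transpose (g y) = g y"
    and inv: "y \<in> S \<Longrightarrow> invertible (g y)"
begin

lemma g_sym: "y \<in> S \<Longrightarrow> g y $ i $ j = g y $ j $ i"
  using arg_cong[OF sym[of y], of "\<lambda>A. A $ j $ i"] by (simp add: transpose_def)

lemma inv_left:
  "y \<in> S \<Longrightarrow> (\<Sum>k\<in>UNIV. matrix_inv (g y) $ i $ k * g y $ k $ j) = (if i = j then 1 else 0)"
  using matrix_inv_left_right(2)[OF inv[of y]]
  by (simp add: matrix_matrix_mult_def mat_def vec_eq_iff)

lemma inv_right:
  "y \<in> S \<Longrightarrow> (\<Sum>k\<in>UNIV. g y $ i $ k * matrix_inv (g y) $ k $ j) = (if i = j then 1 else 0)"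
  using matrix_inv_left_right(1)[OF inv[of y]]
  by (simp add: matrix_matrix_mult_def mat_def vec_eq_iff)

lemma raise_cancel:
  assumes "y \<in> S" and "\<And>l. (\<Sum>m\<in>UNIV. c m * g y $ m $ l) = b l"
  shows "c i = (\<Sum>l\<in>UNIV. b l * matrix_inv (g y) $ l $ i)"
proof -
  have "(\<Sum>l\<in>UNIV. b l * matrix_inv (g y) $ l $ i) =
      (\<Sum>l\<in>UNIV. \<Sum>m\<in>UNIV. c m * (g y $ m $ l * matrix_inv (g y) $ l $ i))"
    by (simp add: assms(2)[symmetric] sum_distrib_right mult.assoc)
  also have "\<dots> = (\<Sum>m\<in>UNIV. c m * (\<Sum>l\<in>UNIV. g y $ m $ l * matrix_inv (g y) $ l $ i))"
    by (subst sum.swap) (simp add: sum_distrib_left)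
  also have "\<dots> = c i" by (simp add: inv_right[OF assms(1)] sum_delta_mult)
  finally show ?thesis ..
qed

lemma lower_cancel:
  assumes "y \<in> S" and "\<And>l. (\<Sum>m\<in>UNIV. c m * g y $ m $ l) = (\<Sum>m\<in>UNIV. b m * g y $ m $ l)"
  shows "c i = b i"
  using raise_cancel[OF assms, of i] raise_cancel[OF assms(1) refl, of b i] by simp

lemma smooth_entry: "smooth_on S (\<lambda>y. g y $ i $ j)"
  by (intro smooth_on_component open_S smooth)

lemma smooth_inv: "smooth_on S (\<lambda>y. matrix_inv (g y) $ i $ j)"
  by (rule smooth_on_matrix_inv[OF open_S smooth inv])

lemma smooth_christoffel: "smooth_on S (christoffel g i j k)"
  unfolding christoffel_def
  by (intro smooth_on_sum smooth_on_mult smooth_on_add smooth_on_diff smooth_on_pd smooth_entry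
      smooth_on_divide smooth_inv smooth_on_const open_S) simp

lemma pd_sym: "y \<in> S \<Longrightarrow> pd k (\<lambda>z. g z $ i $ j) y = pd k (\<lambda>z. g z $ j $ i) y"
  unfolding pd_def by (rule fun_cong[OF frechet_derivative_cong_open[OF open_S]]) (auto intro: g_sym)

lemma christoffel_sym: "y \<in> S \<Longrightarrow> christoffel g i j k y = christoffel g i k j y"
  unfolding christoffel_def by (intro sum.cong) (simp_all add: pd_sym[of y _ j k])

lemma christoffel_lower:
  assumes "y \<in> S"
  shows "2 * (\<Sum>i\<in>UNIV. christoffel g i j k y * g y $ i $ l) =
    pd j (\<lambda>z. g z $ l $ k) y + pd k (\<lambda>z. g z $ l $ j) y - pd l (\<lambda>z. g z $ j $ k) y"
proof -
  define b where "b = (\<lambda>l. pd j (\<lambda>z. g z $ l $ k) y + pd k (\<lambda>z. g z $ l $ j) y - pd l (\<lambda>z. g z $ j $ k) y)"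
  have "2 * (\<Sum>i\<in>UNIV. christoffel g i j k y * g y $ i $ l) =
      (\<Sum>i\<in>UNIV. \<Sum>m\<in>UNIV. g y $ l $ i * matrix_inv (g y) $ i $ m * b m)"
    unfolding christoffel_def b_def g_sym[OF assms, of _ l]
    by (simp add: sum_distrib_left sum_distrib_right mult_ac)
  also have "\<dots> = (\<Sum>m\<in>UNIV. (\<Sum>i\<in>UNIV. g y $ l $ i * matrix_inv (g y) $ i $ m) * b m)"
    by (subst sum.swap) (simp add: sum_distrib_right)
  also have "\<dots> = b l" by (simp only: inv_right[OF assms] sum_delta_mult)
  finally show ?thesis by (simp add: b_def)
qed

text \<open>In the sum of the two lowered Christoffel formulas only the derivatives in the direction
  \<open>k\<close> survive.\<close>

lemma metric_compatible:
  assumes "y \<in> S"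
  shows "pd k (\<lambda>z. g z $ i $ j) y = (\<Sum>m\<in>UNIV. christoffel g m i k y * g y $ m $ j)
    + (\<Sum>m\<in>UNIV. christoffel g m j k y * g y $ m $ i)"
  using christoffel_lower[OF assms, of i k j] christoffel_lower[OF assms, of j k i]
    pd_sym[OF assms, of k i j] pd_sym[OF assms, of i k j] pd_sym[OF assms, of j k i] by linarith

text \<open>Koszul's formula fixes the lowered coefficients, and the metric is
  nondegenerate.\<close>

lemma christoffel_unique:
  assumes "y \<in> S" "\<And>i j k. L i j k = L i k j"
    and "\<And>i j k. pd k (\<lambda>z. g z $ i $ j) y =
      (\<Sum>m\<in>UNIV. L m i k * g y $ m $ j) + (\<Sum>m\<in>UNIV. L m j k * g y $ i $ m)"
  shows "L i j k = christoffel g i j k y"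
proof (rule lower_cancel[OF assms(1), where c = "\<lambda>i. L i j k"])
  fix l
  show "(\<Sum>m\<in>UNIV. L m j k * g y $ m $ l) = (\<Sum>m\<in>UNIV. christoffel g m j k y * g y $ m $ l)"
    using koszul[where G = "\<lambda>i j. g y $ i $ j" and L = L and d = "\<lambda>k i j. pd k (\<lambda>z. g z $ i $ j) y",
        OF g_sym[OF assms(1)] assms(2,3), of j k l]
      christoffel_lower[OF assms(1), of j k l] by linarith
qed

lemma differentiable_entry: "y \<in> S \<Longrightarrow> (\<lambda>z. g z $ i $ j) differentiable (at y)"
  by (rule smooth_on_imp_differentiable[OF smooth_entry])

lemma differentiable_inv: "y \<in> S \<Longrightarrow> (\<lambda>z. matrix_inv (g z) $ i $ j) differentiable (at y)"
  by (rule smooth_on_imp_differentiable[OF smooth_inv])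

text \<open>The inverse metric is parallel: the product of inverse and metric is constant, so its
  derivative vanishes, and contraction with the inverse isolates the wanted term. In the spatial
  torsion this rewrites the derivative of the inverse metric inside the nonlinear
  connection.\<close>

lemma inverse_metric_compatible:
  assumes y: "y \<in> S"
  shows "pd l (\<lambda>z. matrix_inv (g z) $ i $ n) y =
    - (\<Sum>k\<in>UNIV. matrix_inv (g y) $ i $ k * christoffel g n k l y)
    - (\<Sum>k\<in>UNIV. christoffel g i k l y * matrix_inv (g y) $ k $ n)"
proof -
  let ?gi = "\<lambda>i k. matrix_inv (g y) $ i $ k" and ?G = "\<lambda>i j. christoffel g i j l y"
  let ?d = "\<lambda>k. pd l (\<lambda>z. matrix_inv (g z) $ i $ k) y"
  have low: "(\<Sum>k\<in>UNIV. ?d k * g y $ k $ j) = (\<Sum>m\<in>UNIV. - (\<Sum>k\<in>UNIV. ?gi i k * ?G m k) * g y $ m $ j) - ?G i j"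
    for j
  proof -
    have "pd l (\<lambda>z. \<Sum>k\<in>UNIV. matrix_inv (g z) $ i $ k * g z $ k $ j) y = pd l (\<lambda>z. if i = j then 1 else 0) y"
      unfolding pd_def by (rule fun_cong[OF frechet_derivative_cong_open[OF open_S y inv_left]])
    also have "\<dots> = 0" by (simp add: pd_def)
    finally have "(\<Sum>k\<in>UNIV. ?gi i k * pd l (\<lambda>z. g z $ k $ j) y + ?d k * g y $ k $ j) = 0"
      by (subst (asm) pd_sum)
        (auto simp: pd_mult y differentiable_inv differentiable_entry
          intro!: differentiable_bilinear[OF bounded_bilinear_mult])
    then have "(\<Sum>k\<in>UNIV. ?d k * g y $ k $ j) = - (\<Sum>k\<in>UNIV. ?gi i k * pd l (\<lambda>z. g z $ k $ j) y)"
      by (simp add: sum.distrib)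
    also have "(\<Sum>k\<in>UNIV. ?gi i k * pd l (\<lambda>z. g z $ k $ j) y) =
        (\<Sum>k\<in>UNIV. \<Sum>m\<in>UNIV. ?gi i k * ?G m k * g y $ m $ j)
        + (\<Sum>k\<in>UNIV. \<Sum>m\<in>UNIV. ?G m j * (?gi i k * g y $ k $ m))" (is "?l = ?r")
    proof -
      have "?gi i k * pd l (\<lambda>z. g z $ k $ j) y =
          (\<Sum>m\<in>UNIV. ?gi i k * ?G m k * g y $ m $ j) + (\<Sum>m\<in>UNIV. ?G m j * (?gi i k * g y $ k $ m))" for k
        unfolding metric_compatible[OF y] g_sym[OF y, of k]
        by (simp add: sum_distrib_left distrib_left mult_ac)
      then show "?l = ?r" by (simp add: sum.distrib)
    qed
    also have "(\<Sum>k\<in>UNIV. \<Sum>m\<in>UNIV. ?G m j * (?gi i k * g y $ k $ m)) = ?G i j"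
      by (subst sum.swap) (simp add: sum_distrib_left[symmetric] inv_left[OF y] sum_delta_mult)
    also have "(\<Sum>k\<in>UNIV. \<Sum>m\<in>UNIV. ?gi i k * ?G m k * g y $ m $ j) =
        (\<Sum>m\<in>UNIV. (\<Sum>k\<in>UNIV. ?gi i k * ?G m k) * g y $ m $ j)"
      by (subst sum.swap) (simp add: sum_distrib_right)
    finally show ?thesis by (simp add: sum_negf)
  qed
  \<comment> \<open>The part of \<open>low\<close> that is already contracted with the metric is
    moved to the left, so that raising the index \<open>j\<close> acts on a bare Christoffel
    symbol.\<close>
  have "(\<Sum>m\<in>UNIV. (?d m + (\<Sum>k\<in>UNIV. ?gi i k * ?G m k)) * g y $ m $ j) = - ?G i j" for j
    using low[of j] by (simp add: distrib_right sum.distrib sum_negf)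
  from raise_cancel[OF y, of "\<lambda>m. ?d m + (\<Sum>k\<in>UNIV. ?gi i k * ?G m k)", OF this, of n]
  show ?thesis by (simp add: sum_negf)
qed

end

section \<open>Adapted frame, dual coframe and structure coefficients\<close>

section \<open>The adapted frame in one chart\<close>

lemma aidx_cases [case_names T X V]:
  obtains \<alpha> where "D = Tix \<alpha>" | i where "D = Xix i" | i \<alpha> where "D = Vix i \<alpha>"
  by (metis obj_sumE surj_pair)

lemma sum_aidx:
  fixes f :: "('p::finite, 'n::finite) aidx \<Rightarrow> 'c::comm_monoid_add"
  shows "(\<Sum>D\<in>UNIV. f D) = (\<Sum>\<alpha>\<in>UNIV. f (Tix \<alpha>)) + (\<Sum>i\<in>UNIV. f (Xix i))
    + (\<Sum>i\<in>UNIV. \<Sum>\<alpha>\<in>UNIV. f (Vix i \<alpha>))"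
proof -
  have "(\<Sum>D\<in>UNIV. f D) = (\<Sum>\<alpha>\<in>UNIV. f (Tix \<alpha>)) + ((\<Sum>i\<in>UNIV. f (Xix i)) + (\<Sum>q\<in>UNIV. f (Inr (Inr q))))"
    by (simp add: UNIV_Plus_UNIV[symmetric] sum.Plus comp_def del: UNIV_Plus_UNIV)
  also have "(\<Sum>q\<in>UNIV. f (Inr (Inr q))) = (\<Sum>i\<in>UNIV. \<Sum>\<alpha>\<in>UNIV. f (Vix i \<alpha>))"
    by (simp add: UNIV_Times_UNIV[symmetric] sum.cartesian_product split_def del: UNIV_Times_UNIV)
  finally show ?thesis by (simp add: add.assoc)
qed

lemma smooth_on_if:
  "smooth_on S f \<Longrightarrow> smooth_on S g \<Longrightarrow> smooth_on S (\<lambda>x. if P then f x else g x)"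
  by (cases P) simp_all

lemma frechet_derivative_compose_bounded_linear:
  assumes "bounded_linear P" "f differentiable (at (P w))"
  shows "frechet_derivative (\<lambda>w. f (P w)) (at w) y = frechet_derivative f (at (P w)) (P y)"
  using frechet_derivative_compose[OF assms(2) bounded_linear_imp_differentiable[OF assms(1)]]
    frechet_derivative_eqI[OF bounded_linear_imp_has_derivative[OF assms(1)]] by simp

lemma bounded_linear_mid: "bounded_linear (\<lambda>w. fst (snd w))"
  by (rule bounded_linear_compose[OF bounded_linear_fst bounded_linear_snd])

lemma bounded_linear_base: "bounded_linear (\<lambda>w. (fst w, fst (snd w)))"
  by (rule bounded_linear_Pair[OF bounded_linear_fst bounded_linear_mid])

lemma bounded_linear_velocity: "bounded_linear (\<lambda>w. snd (snd w) $ i $ \<alpha>)"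
  by (intro bounded_linear_compose[OF bounded_linear_vec_nth]
      bounded_linear_compose[OF bounded_linear_snd] bounded_linear_snd)

lemma frechet_derivative_section:
  assumes "f differentiable (at (t, x))"
  shows "frechet_derivative (\<lambda>s. f (s, x)) (at t) a = frechet_derivative f (at (t, x)) (a, 0)"
    and "frechet_derivative (\<lambda>y. f (t, y)) (at x) b = frechet_derivative f (at (t, x)) (0, b)"
proof -
  have 1: "((\<lambda>s. (s, x)) has_derivative (\<lambda>a. (a, 0))) (at t)"
    by (auto intro!: derivative_eq_intros)
  have 2: "((\<lambda>y. (t, y)) has_derivative (\<lambda>b. (0, b))) (at x)"
    by (auto intro!: derivative_eq_intros)
  note d = assms[unfolded frechet_derivative_works]
  show "frechet_derivative (\<lambda>s. f (s, x)) (at t) a = frechet_derivative f (at (t, x)) (a, 0)"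
    using frechet_derivative_eqI[OF has_derivative_compose[OF 1 d]] by simp
  show "frechet_derivative (\<lambda>y. f (t, y)) (at x) b = frechet_derivative f (at (t, x)) (0, b)"
    using frechet_derivative_eqI[OF has_derivative_compose[OF 2 d]] by simp
qed

fun tpart :: "('p::finite, 'n) aidx \<Rightarrow> real ^ 'p" where
  "tpart (Tix \<alpha>) = axis \<alpha> 1"
| "tpart (Inr _) = 0"

fun xpart :: "('p, 'n::finite) aidx \<Rightarrow> real ^ 'n" where
  "xpart (Xix i) = axis i 1"
| "xpart _ = 0"

text \<open>The temporal and spatial parts of each frame field are constant in induced coordinates,
  so all variation sits in these vertical coefficients; smoothness and brackets of the frame become
  statements about scalar functions.\<close>

fun frame_coef :: "(real ^ 'p \<Rightarrow> real ^ 'p ^ 'p::finite) \<Rightarrow> (real ^ 'n \<Rightarrow> real ^ 'n ^ 'n::finite) \<Rightarrow>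
    ((real ^ 'p) \<times> (real ^ 'n) \<Rightarrow> real ^ 'n ^ 'p) \<Rightarrow> ('p, 'n) aidx \<Rightarrow> 'n \<Rightarrow> 'p \<Rightarrow>
    ('p, 'n) jet \<Rightarrow> real" where
  "frame_coef h g U (Tix \<alpha>) j \<beta> = (\<lambda>w. - Mconn h j \<beta> \<alpha> w)"
| "frame_coef h g U (Xix i) j \<beta> = (\<lambda>w. - Nconn h g U j \<beta> i w)"
| "frame_coef h g U (Vix i \<alpha>) j \<beta> = (\<lambda>w. if j = i \<and> \<beta> = \<alpha> then 1 else 0)"

lemma adapted_eq:
  "adapted h g U A w = (tpart A, xpart A, \<chi> j \<beta>. frame_coef h g U A j \<beta> w)"
  by (cases A rule: aidx_cases) (auto simp: axis_def vec_eq_iff)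

lemma fst_adapted [simp]: "fst (adapted h g U A w) = tpart A"
  and fst_snd_adapted [simp]: "fst (snd (adapted h g U A w)) = xpart A"
  and snd_snd_adapted [simp]: "snd (snd (adapted h g U A w)) $ j $ \<beta> = frame_coef h g U A j \<beta> w"
  by (simp_all add: adapted_eq)

lemma vertical_sum:
  fixes c :: "'n::finite \<Rightarrow> 'p::finite \<Rightarrow> real"
  shows "(0 :: real ^ 'p, 0 :: real ^ 'n, \<chi> j \<beta>. c j \<beta>) =
    (\<Sum>j\<in>UNIV. \<Sum>\<beta>\<in>UNIV. c j \<beta> *\<^sub>R (0, 0, axis j (axis \<beta> 1)))"
proof -
  have "(\<Sum>j\<in>UNIV. \<Sum>\<beta>\<in>UNIV. c j \<beta> * axis j (axis \<beta> (1::real)) $ k $ \<gamma>) = c k \<gamma>" for k \<gamma>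
  proof -
    have "(\<Sum>\<beta>\<in>UNIV. c j \<beta> * axis j (axis \<beta> (1::real)) $ k $ \<gamma>) = (if j = k then c k \<gamma> else 0)" for j
      by (cases "j = k") (simp_all add: axis_def if_distrib cong: if_cong)
    then show ?thesis by simp
  qed
  then show ?thesis by (simp add: prod_eq_iff fst_sum snd_sum vec_eq_iff)
qed

lemma coframe_adapted:
  "coframe h g U C w (adapted h g U A w) = (if C = A then 1 else 0)"
  by (cases C rule: aidx_cases;
      cases A rule: aidx_cases)
    (auto simp: axis_def if_distrib cong: if_cong)

lemma coframe_add: "coframe h g U C w (y + z) = coframe h g U C w y + coframe h g U C w z"
  by (cases C rule: aidx_cases)
    (auto simp: algebra_simps sum.distrib)

lemma coframe_scaleR: "coframe h g U C w (c *\<^sub>R y) = c * coframe h g U C w y"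
  by (cases C rule: aidx_cases)
    (auto simp: algebra_simps sum_distrib_left)

lemma coframe_linear: "linear (coframe h g U C w)"
  by (rule linearI) (simp_all add: coframe_add coframe_scaleR)

lemma coframe_sum:
  "coframe h g U C w (\<Sum>D\<in>UNIV. c D *\<^sub>R adapted h g U D w) = c C"
  by (simp add: linear_sum[OF coframe_linear] coframe_scaleR coframe_adapted sum_delta_mult)

definition jet_curl :: "((real ^ 'p) \<times> (real ^ 'n::finite) \<Rightarrow> real ^ 'n ^ 'p::finite) \<Rightarrow>
    'p \<Rightarrow> 'n \<Rightarrow> 'n \<Rightarrow> ('p, 'n) jet \<Rightarrow> real" where
  "jet_curl U \<gamma> i j w = curlU U \<gamma> i j (fst w) (fst (snd w))"

text \<open>\<open>conn h g D A B\<close> is the component along \<open>X\<^sub>D\<close> of the derivative of \<open>X\<^sub>A\<close> in the direction \<open>X\<^sub>B\<close>.\<close>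

fun conn :: "(real ^ 'p \<Rightarrow> real ^ 'p ^ 'p::finite) \<Rightarrow> (real ^ 'n \<Rightarrow> real ^ 'n ^ 'n::finite) \<Rightarrow>
    ('p, 'n) aidx \<Rightarrow> ('p, 'n) aidx \<Rightarrow> ('p, 'n) aidx \<Rightarrow> ('p, 'n) jet \<Rightarrow> real" where
  "conn h g (Tix \<beta>) (Tix \<alpha>) (Tix \<gamma>) = (\<lambda>w. christoffel h \<beta> \<alpha> \<gamma> (fst w))"
| "conn h g (Xix l) (Xix i) (Xix k) = (\<lambda>w. christoffel g l i k (fst (snd w)))"
| "conn h g (Vix l \<eta>) (Vix i \<alpha>) (Tix \<gamma>) = (\<lambda>w. if l = i then - christoffel h \<alpha> \<eta> \<gamma> (fst w) else 0)"
| "conn h g (Vix l \<eta>) (Vix i \<alpha>) (Xix k) = (\<lambda>w. if \<eta> = \<alpha> then christoffel g l i k (fst (snd w)) else 0)"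
| "conn h g _ _ _ = (\<lambda>w. 0)"

text \<open>\<open>struct_coef h g U A B C\<close> is the component of \<open>[X\<^sub>B, X\<^sub>A]\<close> along \<open>X\<^sub>C\<close>.\<close>

fun struct_coef :: "(real ^ 'p \<Rightarrow> real ^ 'p ^ 'p::finite) \<Rightarrow> (real ^ 'n \<Rightarrow> real ^ 'n ^ 'n::finite) \<Rightarrow>
    ((real ^ 'p) \<times> (real ^ 'n) \<Rightarrow> real ^ 'n ^ 'p) \<Rightarrow> ('p, 'n) aidx \<Rightarrow> ('p, 'n) aidx \<Rightarrow>
    ('p, 'n) aidx \<Rightarrow> ('p, 'n) jet \<Rightarrow> real" where
  "struct_coef h g U A B (Vix j \<beta>) = (\<lambda>w.
     frechet_derivative (frame_coef h g U A j \<beta>) (at w) (adapted h g U B w) -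
     frechet_derivative (frame_coef h g U B j \<beta>) (at w) (adapted h g U A w))"
| "struct_coef h g U A B _ = (\<lambda>w. 0)"

locale edml_chart = T: metric_chart A h + M: metric_chart B g
  for A :: "(real ^ 'p::finite) set" and h and B :: "(real ^ 'n::finite) set" and g +
  fixes U :: "(real ^ 'p) \<times> (real ^ 'n) \<Rightarrow> real ^ 'n ^ 'p"
  assumes smooth_U: "smooth_on (A \<times> B) U"
begin

abbreviation "W \<equiv> A \<times> B \<times> (UNIV :: (real ^ 'p ^ 'n) set)"
abbreviation "e \<equiv> adapted h g U"
abbreviation "\<omega> \<equiv> conn h g"
abbreviation "K \<equiv> jet_curl U"

lemma open_W: "open W"
  by (intro open_Times T.open_S M.open_S open_UNIV)

lemma open_base: "open (A \<times> B)"
  by (intro open_Times T.open_S M.open_S)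

lemma differentiable_U: "t \<in> A \<Longrightarrow> x \<in> B \<Longrightarrow> (\<lambda>p. U p $ \<gamma> $ i) differentiable (at (t, x))"
  by (rule smooth_on_imp_differentiable[of "A \<times> B"])
    (intro smooth_on_component open_base smooth_U, simp)

text \<open>\<open>curlU\<close> differentiates on slices with \<open>t\<close> fixed. Read as
  derivatives of the joint map in directions \<open>(0, axis j 1)\<close>, the same quantities are
  smooth jointly in \<open>t\<close> and \<open>x\<close>.\<close>

lemma smooth_curlU: "smooth_on (A \<times> B) (\<lambda>p. curlU U \<gamma> i j (fst p) (snd p))"
proof -
  let ?d = "\<lambda>i j p. frechet_derivative (\<lambda>p. U p $ \<gamma> $ i) (at p) (0, axis j 1)"
  have "curlU U \<gamma> i j (fst p) (snd p) = ?d i j p - ?d j i p" if "p \<in> A \<times> B" for p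
    using that by (auto simp: curlU_def pd_def frechet_derivative_section(2)[OF differentiable_U])
  moreover have "smooth_on (A \<times> B) (\<lambda>p. ?d i j p - ?d j i p)"
    by (intro smooth_on_diff smooth_on_frechet_derivative smooth_on_component open_base smooth_U)
  ultimately show ?thesis using smooth_on_cong[OF open_base] by (metis (no_types, lifting))
qed

lemma differentiable_curlU:
  "t \<in> A \<Longrightarrow> x \<in> B \<Longrightarrow> (\<lambda>p. curlU U \<gamma> i j (fst p) (snd p)) differentiable (at (t, x))"
  by (rule smooth_on_imp_differentiable[OF smooth_curlU]) simp

lemma smooth_T: "smooth_on A f \<Longrightarrow> smooth_on W (\<lambda>w. f (fst w))"
  by (rule smooth_on_compose_bounded_linear[OF open_W bounded_linear_fst]) auto

lemma smooth_M: "smooth_on B f \<Longrightarrow> smooth_on W (\<lambda>w. f (fst (snd w)))"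
  by (rule smooth_on_compose_bounded_linear[OF open_W bounded_linear_mid]) auto

lemma smooth_K: "smooth_on W (K \<gamma> i j)"
  using smooth_on_compose_bounded_linear[OF open_W bounded_linear_base _ smooth_curlU]
  unfolding jet_curl_def by auto

lemma smooth_velocity: "smooth_on W (\<lambda>w. snd (snd w) $ i $ \<alpha>)"
  by (rule smooth_on_linear[OF bounded_linear_velocity])

lemma frame_coef_T:
  "frame_coef h g U (Tix \<alpha>) j \<beta> =
    (\<lambda>w. \<Sum>\<gamma>\<in>UNIV. christoffel h \<gamma> \<beta> \<alpha> (fst w) * snd (snd w) $ j $ \<gamma>)"
  by (auto simp: Mconn_def)

lemma frame_coef_X:
  "frame_coef h g U (Xix i) j \<beta> =
    (\<lambda>w. - (\<Sum>k\<in>UNIV. christoffel g j i k (fst (snd w)) * snd (snd w) $ k $ \<beta>) -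
      (\<Sum>\<gamma>\<in>UNIV. \<Sum>l\<in>UNIV. h (fst w) $ \<beta> $ \<gamma> * matrix_inv (g (fst (snd w))) $ j $ l / 4 * K \<gamma> l i w))"
  by (auto simp: Nconn_def jet_curl_def)

lemma smooth_frame_coef: "smooth_on W (frame_coef h g U C j \<beta>)"
proof (cases C rule: aidx_cases)
  case (T \<alpha>)
  have "smooth_on W (frame_coef h g U (Tix \<alpha>) j \<beta>)"
    unfolding frame_coef_T
    by (intro smooth_on_sum smooth_on_mult smooth_T T.smooth_christoffel smooth_velocity open_W)
  with T show ?thesis by simp
next
  case (X i)
  have "smooth_on W (frame_coef h g U (Xix i) j \<beta>)"
    unfolding frame_coef_X
    by (intro smooth_on_sum smooth_on_mult smooth_on_diff smooth_on_uminus smooth_T smooth_M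
        M.smooth_christoffel T.smooth_entry M.smooth_inv smooth_K smooth_velocity
        smooth_on_divide smooth_on_const open_W) simp
  with X show ?thesis by simp
qed (auto intro: smooth_on_const)

lemma differentiable_frame_coef:
  "w \<in> W \<Longrightarrow> frame_coef h g U C j \<beta> differentiable (at w)"
  by (rule smooth_on_imp_differentiable[OF smooth_frame_coef])

lemma adapted_sum:
  "e C w = (tpart C, xpart C, 0) +
    (\<Sum>j\<in>UNIV. \<Sum>\<beta>\<in>UNIV. frame_coef h g U C j \<beta> w *\<^sub>R (0, 0, axis j (axis \<beta> 1)))"
  unfolding vertical_sum[symmetric] by (simp add: adapted_eq)

lemma smooth_adapted: "smooth_on W (e C)"
  unfolding adapted_sum[abs_def]
  by (intro smooth_on_add smooth_on_sum smooth_on_scaleR smooth_on_const smooth_frame_coef open_W)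

lemma frechet_derivative_adapted:
  assumes w: "w \<in> W"
  shows "frechet_derivative (e C) (at w) y =
    (\<Sum>j\<in>UNIV. \<Sum>\<beta>\<in>UNIV. frechet_derivative (frame_coef h g U C j \<beta>) (at w) y *\<^sub>R (0, 0, axis j (axis \<beta> 1)))"
proof -
  let ?v = "\<lambda>j \<beta> :: 'p. (0 :: real ^ 'p, 0 :: real ^ 'n, axis j (axis \<beta> (1::real)))"
  let ?f = "\<lambda>j \<beta>. frame_coef h g U C j \<beta>"
  have "e C = (\<lambda>w. (tpart C, xpart C, 0) + (\<Sum>j\<in>UNIV. \<Sum>\<beta>\<in>UNIV. ?f j \<beta> w *\<^sub>R ?v j \<beta>))"
    by (rule ext) (rule adapted_sum)
  moreover have "((\<lambda>w. (tpart C, xpart C, 0) + (\<Sum>j\<in>UNIV. \<Sum>\<beta>\<in>UNIV. ?f j \<beta> w *\<^sub>R ?v j \<beta>)) has_derivative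
      (\<lambda>y. 0 + (\<Sum>j\<in>UNIV. \<Sum>\<beta>\<in>UNIV. frechet_derivative (?f j \<beta>) (at w) y *\<^sub>R ?v j \<beta>))) (at w)"
    by (intro has_derivative_add has_derivative_const has_derivative_sum has_derivative_scaleR_left)
      (rule differentiable_frame_coef[OF w, unfolded frechet_derivative_works])
  ultimately show ?thesis by (simp add: frechet_derivative_eqI)
qed

text \<open>The horizontal parts of both fields are constant and disappear under differentiation;
  what is left is the difference of the derivatives of the vertical coefficients.\<close>

lemma bracket_adapted:
  assumes w: "w \<in> W"
  shows "bracket (e D) (e C) w = (\<Sum>E\<in>UNIV. struct_coef h g U C D E w *\<^sub>R e E w)"
  unfolding bracket_def frechet_derivative_adapted[OF w] sum_aidx
  by (simp add: sum_subtractf scaleR_diff_left del: scaleR_Pair)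

lemma smooth_struct_coef: "smooth_on W (struct_coef h g U C D E)"
  by (cases E rule: aidx_cases)
    (auto intro!: smooth_on_const smooth_on_diff smooth_on_frechet_derivative_field
      smooth_frame_coef smooth_adapted open_W)

lemma smooth_conn: "smooth_on W (\<omega> D C E)"
proof -
  note s = smooth_T[OF T.smooth_christoffel] smooth_M[OF M.smooth_christoffel]
    smooth_on_uminus[OF open_W smooth_T[OF T.smooth_christoffel]] smooth_on_const
  show ?thesis
    by (cases "(h, g, D, C, E)" rule: conn.cases) (simp_all add: s smooth_on_if)
qed

section \<open>Derivatives of chart data and of the frame coefficients on jet space\<close>

lemma frechet_T:
  assumes "w \<in> W" "smooth_on A f"
  shows "frechet_derivative (\<lambda>w. f (fst w)) (at w) y = frechet_derivative f (at (fst w)) (fst y)"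
  using assms smooth_on_imp_differentiable
  by (intro frechet_derivative_compose_bounded_linear bounded_linear_fst) auto

lemma frechet_M:
  assumes "w \<in> W" "smooth_on B f"
  shows "frechet_derivative (\<lambda>w. f (fst (snd w))) (at w) y = frechet_derivative f (at (fst (snd w))) (fst (snd y))"
  using assms smooth_on_imp_differentiable
  by (intro frechet_derivative_compose_bounded_linear bounded_linear_mid) auto

lemma frechet_velocity:
  "frechet_derivative (\<lambda>w. snd (snd w) $ i $ \<alpha>) (at w) y = snd (snd y) $ i $ \<alpha>"
  by (simp add: frechet_derivative_eqI[OF bounded_linear_imp_has_derivative[OF bounded_linear_velocity]])

lemma frechet_zero_T: "smooth_on A f \<Longrightarrow> t \<in> A \<Longrightarrow> frechet_derivative f (at t) 0 = 0"
  by (rule linear_0[OF linear_frechet_derivative[OF smooth_on_imp_differentiable]])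

lemma frechet_zero_M: "smooth_on B f \<Longrightarrow> x \<in> B \<Longrightarrow> frechet_derivative f (at x) 0 = 0"
  by (rule linear_0[OF linear_frechet_derivative[OF smooth_on_imp_differentiable]])

lemma frechet_K:
  assumes "t \<in> A" "x \<in> B"
  shows "frechet_derivative (K \<gamma> i j) (at (t, x, v)) y =
    frechet_derivative (\<lambda>p. curlU U \<gamma> i j (fst p) (snd p)) (at (t, x)) (fst y, fst (snd y))"
  unfolding jet_curl_def[abs_def]
  using frechet_derivative_compose_bounded_linear[OF bounded_linear_base,
    of "\<lambda>p. curlU U \<gamma> i j (fst p) (snd p)" "(t, x, v)"] differentiable_curlU[OF assms] by simp

lemma frechet_K_T:
  assumes "t \<in> A" "x \<in> B"
  shows "frechet_derivative (K \<gamma> i j) (at (t, x, v)) (e (Tix \<alpha>) w) = pd \<alpha> (\<lambda>s. curlU U \<gamma> i j s x) t"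
  using frechet_derivative_section(1)[OF differentiable_curlU[OF assms], of \<gamma> i j "axis \<alpha> 1"]
  by (simp add: frechet_K[OF assms] pd_def)

lemma frechet_frame_coef_T:
  assumes "t \<in> A" "x \<in> B"
  shows "frechet_derivative (frame_coef h g U (Tix \<alpha>) j \<beta>) (at (t, x, v)) y =
    (\<Sum>\<gamma>\<in>UNIV. frechet_derivative (christoffel h \<gamma> \<beta> \<alpha>) (at t) (fst y) * v $ j $ \<gamma>)
    + (\<Sum>\<gamma>\<in>UNIV. christoffel h \<gamma> \<beta> \<alpha> t * snd (snd y) $ j $ \<gamma>)"
proof -
  have W: "(t, x, v) \<in> W" using assms by simp
  have d: "(\<lambda>w. christoffel h \<gamma> \<beta> \<alpha> (fst w)) differentiable (at (t, x, v))"
    "(\<lambda>w. snd (snd w) $ j $ \<gamma>) differentiable (at (t, x, v))" for \<gamma>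
    by (rule smooth_on_imp_differentiable[OF _ W], intro smooth_T T.smooth_christoffel smooth_velocity)+
  show ?thesis
    unfolding frame_coef_T
    by (subst frechet_derivative_sum)
      (auto intro!: differentiable_bilinear[OF bounded_bilinear_mult] d
        simp: frechet_derivative_mult[OF d] frechet_velocity frechet_T[OF W T.smooth_christoffel]
          sum.distrib)
qed

text \<open>The direction \<open>y\<close> stays arbitrary because frame vectors of all three kinds
  are inserted later. The terms are the product rule for the Christoffel part, which is linear in
  the velocity, and for the threefold product in the \<open>U\<close> part.\<close>

lemma frechet_frame_coef_X:
  assumes "t \<in> A" "x \<in> B"
  shows "frechet_derivative (frame_coef h g U (Xix i) j \<beta>) (at (t, x, v)) y =
    - (\<Sum>k\<in>UNIV. frechet_derivative (christoffel g j i k) (at x) (fst (snd y)) * v $ k $ \<beta>)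
    - (\<Sum>k\<in>UNIV. christoffel g j i k x * snd (snd y) $ k $ \<beta>)
    - (\<Sum>\<gamma>\<in>UNIV. \<Sum>l\<in>UNIV. (
        frechet_derivative (\<lambda>s. h s $ \<beta> $ \<gamma>) (at t) (fst y) * matrix_inv (g x) $ j $ l +
        h t $ \<beta> $ \<gamma> * frechet_derivative (\<lambda>y. matrix_inv (g y) $ j $ l) (at x) (fst (snd y))) / 4
          * curlU U \<gamma> l i t x +
        h t $ \<beta> $ \<gamma> * matrix_inv (g x) $ j $ l / 4 * frechet_derivative (K \<gamma> l i) (at (t, x, v)) y)"
proof -
  have W: "(t, x, v) \<in> W" using assms by simp
  have d: "(\<lambda>w. christoffel g j i k (fst (snd w))) differentiable (at (t, x, v))"
    "(\<lambda>w. snd (snd w) $ k $ \<beta>) differentiable (at (t, x, v))" for k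
    by (rule smooth_on_imp_differentiable[OF _ W], intro smooth_M M.smooth_christoffel smooth_velocity)+
  let ?h = "\<lambda>\<gamma> w. h (fst w) $ \<beta> $ \<gamma>" and ?g = "\<lambda>l w. matrix_inv (g (fst (snd w))) $ j $ l"
  have d': "?h \<gamma> differentiable (at (t, x, v))" "?g l differentiable (at (t, x, v))"
    "K \<gamma> l i differentiable (at (t, x, v))" for \<gamma> l
    by (rule smooth_on_imp_differentiable[OF _ W],
        intro smooth_T T.smooth_entry smooth_M M.smooth_inv smooth_K)+
  note m = differentiable_bilinear[OF bounded_bilinear_mult]
  \<comment> \<open>The division by 4 is a product with a constant, so the product rule is nested
    three times.\<close>
  have q: "frechet_derivative (\<lambda>w. ?h \<gamma> w * ?g l w / 4 * K \<gamma> l i w) (at (t, x, v)) y =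
      (frechet_derivative (\<lambda>s. h s $ \<beta> $ \<gamma>) (at t) (fst y) * matrix_inv (g x) $ j $ l +
        h t $ \<beta> $ \<gamma> * frechet_derivative (\<lambda>y. matrix_inv (g y) $ j $ l) (at x) (fst (snd y))) / 4
          * curlU U \<gamma> l i t x +
        h t $ \<beta> $ \<gamma> * matrix_inv (g x) $ j $ l / 4 * frechet_derivative (K \<gamma> l i) (at (t, x, v)) y" for \<gamma> l
    using frechet_derivative_mult[OF d'(1)[of \<gamma>] d'(2)[of l], of y]
      frechet_derivative_mult[OF m[OF m[OF d'(1)[of \<gamma>] d'(2)[of l]] differentiable_const[of "1 / 4"]] d'(3)[of \<gamma> l], of y]
      frechet_derivative_mult[OF m[OF d'(1)[of \<gamma>] d'(2)[of l]] differentiable_const[of "1 / 4"], of y]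
    by (simp add: frechet_T[OF W T.smooth_entry] frechet_M[OF W M.smooth_inv]) (simp add: jet_curl_def)
  have dq: "(\<lambda>w. ?h \<gamma> w * ?g l w / 4 * K \<gamma> l i w) differentiable (at (t, x, v))" for \<gamma> l
    using m[OF m[OF m[OF d'(1)[of \<gamma>] d'(2)[of l]] differentiable_const[of "1 / 4"]] d'(3)[of \<gamma> l]] by simp
  have p: "frechet_derivative (\<lambda>w. \<Sum>k\<in>UNIV. christoffel g j i k (fst (snd w)) * snd (snd w) $ k $ \<beta>) (at (t, x, v)) y =
      (\<Sum>k\<in>UNIV. frechet_derivative (christoffel g j i k) (at x) (fst (snd y)) * v $ k $ \<beta>)
      + (\<Sum>k\<in>UNIV. christoffel g j i k x * snd (snd y) $ k $ \<beta>)"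
    by (subst frechet_derivative_sum)
      (auto intro!: m d simp: frechet_derivative_mult[OF d] frechet_velocity
        frechet_M[OF W M.smooth_christoffel] sum.distrib)
  have dp: "(\<lambda>w. \<Sum>k\<in>UNIV. christoffel g j i k (fst (snd w)) * snd (snd w) $ k $ \<beta>) differentiable (at (t, x, v))"
    by (intro differentiable_sum ballI m d finite)
  let ?Q = "\<lambda>\<gamma> l w. ?h \<gamma> w * ?g l w / 4 * K \<gamma> l i w"
  have dr: "(\<lambda>w. \<Sum>\<gamma>\<in>UNIV. \<Sum>l\<in>UNIV. ?Q \<gamma> l w) differentiable (at (t, x, v))"
    by (intro differentiable_sum ballI dq finite)
  have r: "frechet_derivative (\<lambda>w. \<Sum>\<gamma>\<in>UNIV. \<Sum>l\<in>UNIV. ?Q \<gamma> l w) (at (t, x, v)) y =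
      (\<Sum>\<gamma>\<in>UNIV. \<Sum>l\<in>UNIV. frechet_derivative (?Q \<gamma> l) (at (t, x, v)) y)"
    by (subst frechet_derivative_sum)
      (intro differentiable_sum ballI dq finite, intro sum.cong refl frechet_derivative_sum dq)
  show ?thesis
    unfolding frame_coef_X
    by (simp only: frechet_derivative_diff[OF differentiable_minus[OF dp] dr]
        frechet_derivative_uminus[OF dp] p r q minus_add_distrib)
qed

end

section \<open>Rules of a linear connection for finite frame expansions\<close>

section \<open>Linear connections in a frame\<close>

context
  fixes W :: "'e::real_normed_vector set" and nab
  assumes lin: "linear_connection_on W nab" and open_W: "open W"
begin

text \<open>Frame expansions of derived fields hold on \<open>W\<close> only, while fields are total
  functions; this permits replacing a field by its expansion inside another covariant
  derivative.\<close>

lemma nab_cong: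
  assumes "smooth_on W X" "smooth_on W Y" "w \<in> W"
    and "\<And>w. w \<in> W \<Longrightarrow> X w = X' w" "\<And>w. w \<in> W \<Longrightarrow> Y w = Y' w"
  shows "nab X Y w = nab X' Y' w"
  using lin[unfolded linear_connection_on_def, THEN conjunct1, rule_format, of X Y X' Y'] assms by simp

lemma nab_smooth: "smooth_on W X \<Longrightarrow> smooth_on W Y \<Longrightarrow> smooth_on W (nab X Y)"
  using lin[unfolded linear_connection_on_def, THEN conjunct2, THEN conjunct1] by simp

lemma nab_add_left:
  "smooth_on W X \<Longrightarrow> smooth_on W X' \<Longrightarrow> smooth_on W Y \<Longrightarrow> w \<in> W \<Longrightarrow>
    nab (\<lambda>u. X u + X' u) Y w = nab X Y w + nab X' Y w"
  using lin[unfolded linear_connection_on_def, THEN conjunct2, THEN conjunct2, THEN conjunct1] by simp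

lemma nab_add_right:
  "smooth_on W X \<Longrightarrow> smooth_on W Y \<Longrightarrow> smooth_on W Y' \<Longrightarrow> w \<in> W \<Longrightarrow>
    nab X (\<lambda>u. Y u + Y' u) w = nab X Y w + nab X Y' w"
  using lin[unfolded linear_connection_on_def, THEN conjunct2, THEN conjunct2, THEN conjunct2, THEN conjunct1] by simp

lemma nab_scale_left:
  "smooth_on W f \<Longrightarrow> smooth_on W X \<Longrightarrow> smooth_on W Y \<Longrightarrow> w \<in> W \<Longrightarrow>
    nab (\<lambda>u. f u *\<^sub>R X u) Y w = f w *\<^sub>R nab X Y w"
  using lin[unfolded linear_connection_on_def, THEN conjunct2, THEN conjunct2, THEN conjunct2, THEN conjunct2] by simp

lemma nab_scale_right:
  "smooth_on W f \<Longrightarrow> smooth_on W X \<Longrightarrow> smooth_on W Y \<Longrightarrow> w \<in> W \<Longrightarrow>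
    nab X (\<lambda>u. f u *\<^sub>R Y u) w = frechet_derivative f (at w) (X w) *\<^sub>R Y w + f w *\<^sub>R nab X Y w"
  using lin[unfolded linear_connection_on_def, THEN conjunct2, THEN conjunct2, THEN conjunct2, THEN conjunct2] by simp

lemma nab_sum_left:
  assumes "finite I" "\<And>i. smooth_on W (f i)" "\<And>i. smooth_on W (X i)" "smooth_on W Y" "w \<in> W"
  shows "nab (\<lambda>u. \<Sum>i\<in>I. f i u *\<^sub>R X i u) Y w = (\<Sum>i\<in>I. f i w *\<^sub>R nab (X i) Y w)"
  using assms(1)
proof induction
  case empty
  \<comment> \<open>The zero field is the zero function times a field, so the scaling rule gives
    zero.\<close>
  show ?case
    using nab_scale_left[OF smooth_on_const[of _ 0] smooth_on_const[of _ 0] assms(4,5)] by simp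
next
  case (insert i I)
  then show ?case
    by (simp add: nab_add_left nab_scale_left assms smooth_on_scaleR smooth_on_sum open_W)
qed

lemma nab_sum_right:
  assumes "finite I" "\<And>i. smooth_on W (f i)" "\<And>i. smooth_on W (Y i)" "smooth_on W X" "w \<in> W"
  shows "nab X (\<lambda>u. \<Sum>i\<in>I. f i u *\<^sub>R Y i u) w =
    (\<Sum>i\<in>I. frechet_derivative (f i) (at w) (X w) *\<^sub>R Y i w + f i w *\<^sub>R nab X (Y i) w)"
  using assms(1)
proof induction
  case empty
  show ?case
    using nab_scale_right[OF smooth_on_const[of _ 0] assms(4) smooth_on_const[of _ 0] assms(5)] by simp
next
  case (insert i I)
  then show ?case
    by (simp add: nab_add_right nab_scale_right assms smooth_on_scaleR smooth_on_sum open_W)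
qed

end

section \<open>Coefficients and curvature of the Cartan connection in one chart\<close>

section \<open>The Cartan connection in one chart\<close>

lemma sum_vertical_delta:
  fixes f :: "'n::finite \<Rightarrow> 'p::finite \<Rightarrow> 'c::real_vector"
  shows "(\<Sum>l\<in>UNIV. \<Sum>\<eta>\<in>UNIV. (if l = i then c l \<eta> else 0) *\<^sub>R f l \<eta>) = (\<Sum>\<eta>\<in>UNIV. c i \<eta> *\<^sub>R f i \<eta>)"
    and "(\<Sum>l\<in>UNIV. \<Sum>\<eta>\<in>UNIV. (if \<eta> = \<alpha> then c l \<eta> else 0) *\<^sub>R f l \<eta>) = (\<Sum>l\<in>UNIV. c l \<alpha> *\<^sub>R f l \<alpha>)"
  by (subst sum.swap, simp add: if_distribR if_distrib[of "\<lambda>c. c *\<^sub>R _"] cong: if_cong)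
    (simp add: if_distribR if_distrib[of "\<lambda>c. c *\<^sub>R _"] cong: if_cong)

text \<open>On vertical vectors a connection coefficient acts on one of the two indices and carries
  a Kronecker delta in the other. Two factors of the same kind compose as matrices and keep the
  delta; two factors of different kinds commute, which makes the mixed temporal-spatial curvature
  vanish.\<close>

lemma sum_vertical_delta_mult:
  fixes c d :: "'n::finite \<Rightarrow> 'p::finite \<Rightarrow> real"
  shows "(\<Sum>m\<in>UNIV. \<Sum>\<epsilon>\<in>UNIV. (if m = i then c m \<epsilon> else 0) * (if l = m then d m \<epsilon> else 0)) =
      (if l = i then \<Sum>\<epsilon>\<in>UNIV. c i \<epsilon> * d i \<epsilon> else 0)"
    and "(\<Sum>m\<in>UNIV. \<Sum>\<epsilon>\<in>UNIV. (if \<epsilon> = \<alpha> then c m \<epsilon> else 0) * (if \<eta> = \<epsilon> then d m \<epsilon> else 0)) =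
      (if \<eta> = \<alpha> then \<Sum>m\<in>UNIV. c m \<alpha> * d m \<alpha> else 0)"
    and "(\<Sum>m\<in>UNIV. \<Sum>\<epsilon>\<in>UNIV. (if m = i then c m \<epsilon> else 0) * (if \<eta> = \<epsilon> then d m \<epsilon> else 0)) = c i \<eta> * d i \<eta>"
    and "(\<Sum>m\<in>UNIV. \<Sum>\<epsilon>\<in>UNIV. (if \<epsilon> = \<alpha> then c m \<epsilon> else 0) * (if l = m then d m \<epsilon> else 0)) = c l \<alpha> * d l \<alpha>"
proof -
  have "(\<Sum>m\<in>UNIV. \<Sum>\<epsilon>\<in>UNIV. (if m = i then c m \<epsilon> else 0) * (if l = m then d m \<epsilon> else 0)) =
      (\<Sum>\<epsilon>\<in>UNIV. \<Sum>m\<in>UNIV. if m = i then c m \<epsilon> * (if l = m then d m \<epsilon> else 0) else 0)"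
    by (subst sum.swap) (intro sum.cong, auto)
  then show "(\<Sum>m\<in>UNIV. \<Sum>\<epsilon>\<in>UNIV. (if m = i then c m \<epsilon> else 0) * (if l = m then d m \<epsilon> else 0)) =
      (if l = i then \<Sum>\<epsilon>\<in>UNIV. c i \<epsilon> * d i \<epsilon> else 0)" by simp
  have "(\<Sum>m\<in>UNIV. \<Sum>\<epsilon>\<in>UNIV. (if \<epsilon> = \<alpha> then c m \<epsilon> else 0) * (if \<eta> = \<epsilon> then d m \<epsilon> else 0)) =
      (\<Sum>m\<in>UNIV. \<Sum>\<epsilon>\<in>UNIV. if \<epsilon> = \<alpha> then c m \<epsilon> * (if \<eta> = \<epsilon> then d m \<epsilon> else 0) else 0)"
    by (intro sum.cong) auto
  then show "(\<Sum>m\<in>UNIV. \<Sum>\<epsilon>\<in>UNIV. (if \<epsilon> = \<alpha> then c m \<epsilon> else 0) * (if \<eta> = \<epsilon> then d m \<epsilon> else 0)) =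
      (if \<eta> = \<alpha> then \<Sum>m\<in>UNIV. c m \<alpha> * d m \<alpha> else 0)" by simp
  have "(\<Sum>m\<in>UNIV. \<Sum>\<epsilon>\<in>UNIV. (if m = i then c m \<epsilon> else 0) * (if \<eta> = \<epsilon> then d m \<epsilon> else 0)) =
      (\<Sum>m\<in>UNIV. \<Sum>\<epsilon>\<in>UNIV. if \<eta> = \<epsilon> then (if m = i then c m \<epsilon> else 0) * d m \<epsilon> else 0)"
    by (intro sum.cong) auto
  then show "(\<Sum>m\<in>UNIV. \<Sum>\<epsilon>\<in>UNIV. (if m = i then c m \<epsilon> else 0) * (if \<eta> = \<epsilon> then d m \<epsilon> else 0)) = c i \<eta> * d i \<eta>"
    by (simp add: if_distrib[where f = "\<lambda>y. y * z" for z] cong: if_cong)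
  have "(\<Sum>m\<in>UNIV. \<Sum>\<epsilon>\<in>UNIV. (if \<epsilon> = \<alpha> then c m \<epsilon> else 0) * (if l = m then d m \<epsilon> else 0)) =
      (\<Sum>m\<in>UNIV. \<Sum>\<epsilon>\<in>UNIV. if \<epsilon> = \<alpha> then c m \<epsilon> * (if l = m then d m \<epsilon> else 0) else 0)" (is "?l = ?r")
    by (intro sum.cong) auto
  then show "(\<Sum>m\<in>UNIV. \<Sum>\<epsilon>\<in>UNIV. (if \<epsilon> = \<alpha> then c m \<epsilon> else 0) * (if l = m then d m \<epsilon> else 0)) = c l \<alpha> * d l \<alpha>"
  proof -
    have "(\<Sum>\<epsilon>\<in>UNIV. if \<epsilon> = \<alpha> then c m \<epsilon> * (if l = m then d m \<epsilon> else 0) else 0) =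
        (if l = m then c m \<alpha> * d m \<alpha> else 0)" for m by simp
    with \<open>?l = ?r\<close> show ?thesis by simp
  qed
qed

lemma sum_contract_swap:
  fixes a :: "'i \<Rightarrow> real"
  shows "(\<Sum>\<gamma>\<in>I. a \<gamma> * (\<Sum>\<epsilon>\<in>J. b \<epsilon> \<gamma> * v \<epsilon>)) = (\<Sum>\<epsilon>\<in>J. (\<Sum>\<gamma>\<in>I. a \<gamma> * b \<epsilon> \<gamma>) * v \<epsilon>)"
  unfolding sum_distrib_left sum_distrib_right by (subst sum.swap) (simp add: mult.assoc)

lemma frechet_derivative_if:
  "frechet_derivative (\<lambda>w. if P then f w else 0) (at w) y = (if P then frechet_derivative f (at w) y else 0)"
  by (cases P) simp_all

text \<open>The connection preserves the temporal, the spatial and the vertical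
  distribution.\<close>

lemma conn_mismatch [simp]:
  "conn h g (Tix \<alpha>) (Vix i \<beta>) D = (\<lambda>w. 0)"
  "conn h g (Xix i) (Tix \<alpha>) D = (\<lambda>w. 0)" "conn h g (Xix i) (Vix j \<beta>) D = (\<lambda>w. 0)"
  "conn h g (Vix j \<beta>) (Tix \<alpha>) D = (\<lambda>w. 0)" "conn h g (Vix j \<beta>) (Xix i) D = (\<lambda>w. 0)"
  by (cases D rule: aidx_cases; simp)+

locale edml_connection = edml_chart A h B g U
  for A :: "(real ^ 'p::finite) set" and h and B :: "(real ^ 'n::finite) set" and g U +
  fixes nab :: "(('p, 'n) jet \<Rightarrow> ('p, 'n) jet) \<Rightarrow> (('p, 'n) jet \<Rightarrow> ('p, 'n) jet) \<Rightarrow> ('p, 'n) jet \<Rightarrow> ('p, 'n) jet"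
    and Hc :: "('p, 'n) jet \<Rightarrow> 'p \<Rightarrow> 'p \<Rightarrow> 'p \<Rightarrow> real"
    and Gc :: "('p, 'n) jet \<Rightarrow> 'n \<Rightarrow> 'n \<Rightarrow> 'p \<Rightarrow> real"
    and Lc :: "('p, 'n) jet \<Rightarrow> 'n \<Rightarrow> 'n \<Rightarrow> 'n \<Rightarrow> real"
    and Cc :: "('p, 'n) jet \<Rightarrow> 'n \<Rightarrow> 'p \<Rightarrow> 'n \<Rightarrow> 'n \<Rightarrow> real"
  assumes lin: "linear_connection_on W nab"
    and normal: "h_normal_on W h g U nab Hc Gc Lc Cc"
    and cartan: "cartan_conditions_on W h g U Gc Lc Cc"
begin

lemmas normal_at = normal[unfolded h_normal_on_def Let_def, rule_format]
lemmas cartan_at = cartan[unfolded cartan_conditions_on_def Let_def, rule_format]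
lemmas cartan_X = cartan_at[THEN conjunct1, rule_format]
lemmas cartan_V = cartan_at[THEN conjunct2, THEN conjunct1, rule_format]
lemmas cartan_T = cartan_at[THEN conjunct2, THEN conjunct2, THEN conjunct1, rule_format]
lemmas cartan_L = cartan_at[THEN conjunct2, THEN conjunct2, THEN conjunct2, THEN conjunct1, rule_format]
lemmas cartan_C = cartan_at[THEN conjunct2, THEN conjunct2, THEN conjunct2, THEN conjunct2, rule_format]

lemma Hc_eq: "w \<in> W \<Longrightarrow> Hc w \<gamma> \<alpha> \<beta> = christoffel h \<gamma> \<alpha> \<beta> (fst w)"
  by (rule normal_at[THEN conjunct1, rule_format])

lemma frechet_metric:
  "w \<in> W \<Longrightarrow> frechet_derivative (\<lambda>w. g (fst (snd w)) $ i $ j) (at w) (e C w) =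
    frechet_derivative (\<lambda>x. g x $ i $ j) (at (fst (snd w))) (xpart C)"
  using frechet_M[OF _ M.smooth_entry] by simp

text \<open>The metric \<open>g\<close> depends on \<open>x\<close> alone, and the temporal frame
  vectors have no component along \<open>x\<close>.\<close>

lemma Gc_eq:
  assumes w: "w \<in> W"
  shows "Gc w k j \<gamma> = 0"
proof -
  have "Gc w k j \<gamma> = 1 / 2 * (\<Sum>i\<in>UNIV. matrix_inv (g (fst (snd w))) $ k $ i *
      frechet_derivative (\<lambda>w. g (fst (snd w)) $ i $ j) (at w) (e (Tix \<gamma>) w))"
    by (rule cartan_T[OF w])
  then show ?thesis
    using w by (simp add: frechet_metric[OF w] mem_Times_iff frechet_zero_M[OF M.smooth_entry] del: adapted.simps)
qed

text \<open>Since \<open>g\<close> depends on \<open>x\<close> alone, the spatial frame vectors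
  differentiate it like coordinate derivatives, and the Cartan conditions become those of the
  Levi-Civita connection.\<close>

lemma Lc_eq:
  assumes w: "w \<in> W"
  shows "Lc w i j k = christoffel g i j k (fst (snd w))"
proof (rule M.christoffel_unique)
  show "fst (snd w) \<in> B" using w by (simp add: mem_Times_iff)
  show "Lc w i j k = Lc w i k j" for i j k
    by (rule cartan_L[OF w])
  fix i j k
  have "frechet_derivative (\<lambda>w. g (fst (snd w)) $ i $ j) (at w) (e (Xix k) w)
      - (\<Sum>m\<in>UNIV. Lc w m i k * g (fst (snd w)) $ m $ j)
      - (\<Sum>m\<in>UNIV. Lc w m j k * g (fst (snd w)) $ i $ m) = 0"
    by (rule cartan_X[OF w])
  then show "pd k (\<lambda>z. g z $ i $ j) (fst (snd w)) = (\<Sum>m\<in>UNIV. Lc w m i k * g (fst (snd w)) $ m $ j)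
      + (\<Sum>m\<in>UNIV. Lc w m j k * g (fst (snd w)) $ i $ m)"
    by (simp add: frechet_metric[OF w] pd_def del: adapted.simps)
qed

text \<open>Vertical vectors annihilate \<open>g\<close>, so Koszul's formula applies with vanishing
  derivatives of the metric.\<close>

lemma Cc_eq:
  assumes w: "w \<in> W"
  shows "Cc w i \<gamma> j k = 0"
proof (rule M.lower_cancel[where c = "\<lambda>i. Cc w i \<gamma> j k" and b = "\<lambda>i. 0"])
  show x: "fst (snd w) \<in> B" using w by (simp add: mem_Times_iff)
  fix l
  have "2 * (\<Sum>m\<in>UNIV. Cc w m \<gamma> j k * g (fst (snd w)) $ m $ l) = 0 + 0 - 0"
  proof (rule koszul[where G = "\<lambda>i j. g (fst (snd w)) $ i $ j" and d = "\<lambda>_ _ _. 0"])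
    show "g (fst (snd w)) $ i $ j = g (fst (snd w)) $ j $ i" for i j
      by (rule M.g_sym[OF x])
    show "Cc w i \<gamma> j k = Cc w i \<gamma> k j" for i j k
      by (rule cartan_C[OF w])
    fix k i j
    have "frechet_derivative (\<lambda>w. g (fst (snd w)) $ i $ j) (at w) (e (Vix k \<gamma>) w)
        - (\<Sum>m\<in>UNIV. Cc w m \<gamma> i k * g (fst (snd w)) $ m $ j)
        - (\<Sum>m\<in>UNIV. Cc w m \<gamma> j k * g (fst (snd w)) $ i $ m) = 0"
      by (rule cartan_V[OF w])
    then show "0 = (\<Sum>m\<in>UNIV. Cc w m \<gamma> i k * g (fst (snd w)) $ m $ j)
        + (\<Sum>m\<in>UNIV. Cc w m \<gamma> j k * g (fst (snd w)) $ i $ m)"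
      by (simp add: frechet_metric[OF w] frechet_zero_M[OF M.smooth_entry x] del: adapted.simps)
  qed
  then show "(\<Sum>m\<in>UNIV. Cc w m \<gamma> j k * g (fst (snd w)) $ m $ l) = (\<Sum>m\<in>UNIV. 0 * g (fst (snd w)) $ m $ l)"
    by simp
qed

lemma coefficients:
  assumes "t \<in> A" "x \<in> B"
  shows "Hc (t, x, v) \<gamma> \<alpha> \<beta> = christoffel h \<gamma> \<alpha> \<beta> t" "Gc (t, x, v) k j \<gamma> = 0"
    "Lc (t, x, v) i j k = christoffel g i j k x" "Cc (t, x, v) i \<gamma> j k = 0"
  using assms Hc_eq Gc_eq Lc_eq Cc_eq by simp_all

text \<open>The nine defining equations of an \<open>h\<close>-normal connection become one formula,
  so torsion and curvature are expanded for all index types at once.\<close>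

lemma nab_frame:
  assumes w: "w \<in> W"
  shows "nab (e D) (e C) w = (\<Sum>E\<in>UNIV. \<omega> E C D w *\<^sub>R e E w)"
proof -
  note n = normal_at[OF w, unfolded Hc_eq[OF w] Gc_eq[OF w] Lc_eq[OF w] Cc_eq[OF w]]
  show ?thesis
  proof (cases D rule: aidx_cases)
    case (T \<gamma>)
    with n show ?thesis
      by (cases C rule: aidx_cases)
        (simp_all add: sum_aidx sum_vertical_delta sum_negf del: adapted.simps)
  next
    case (X k)
    with n show ?thesis
      by (cases C rule: aidx_cases)
        (simp_all add: sum_aidx sum_vertical_delta sum_negf del: adapted.simps)
  next
    case (V k \<gamma>)
    with n show ?thesis
      by (cases C rule: aidx_cases) (simp_all add: del: adapted.simps)
  qed
qed

lemma torsion_comp_eq: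
  assumes w: "w \<in> W"
  shows "torsion_comp h g U nab w F C D = \<omega> F C D w - \<omega> F D C w - struct_coef h g U C D F w"
  unfolding torsion_comp_def torsion_def
  by (simp add: linear_diff[OF coframe_linear] nab_frame[OF w] bracket_adapted[OF w] coframe_sum)

text \<open>The inner derivative has variable coefficients in the frame: the Leibniz rule
  differentiates them, and the outer connection acts on the frame once more.\<close>

lemma nab_nab_frame:
  assumes w: "w \<in> W"
  shows "coframe h g U F w (nab (e E) (nab (e D) (e C)) w) =
    frechet_derivative (\<omega> F C D) (at w) (e E w) + (\<Sum>G\<in>UNIV. \<omega> G C D w * \<omega> F G E w)"
proof -
  have "nab (e E) (nab (e D) (e C)) w = nab (e E) (\<lambda>u. \<Sum>G\<in>UNIV. \<omega> G C D u *\<^sub>R e G u) w"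
    by (rule nab_cong[OF lin open_W]) (simp_all add: w nab_frame nab_smooth[OF lin open_W] smooth_adapted)
  also have "\<dots> = (\<Sum>G\<in>UNIV. frechet_derivative (\<omega> G C D) (at w) (e E w) *\<^sub>R e G w
      + \<omega> G C D w *\<^sub>R nab (e E) (e G) w)"
    by (rule nab_sum_right[OF lin open_W]) (simp_all add: smooth_conn smooth_adapted w)
  finally show ?thesis
    by (simp add: sum.distrib coframe_add coframe_sum linear_sum[OF coframe_linear] coframe_scaleR
        nab_frame[OF w] coframe_adapted sum_delta_mult)
qed

lemma curvature_comp_eq:
  assumes w: "w \<in> W"
  shows "curvature_comp h g U nab w F C D E =
    frechet_derivative (\<omega> F C D) (at w) (e E w) - frechet_derivative (\<omega> F C E) (at w) (e D w)
    + (\<Sum>G\<in>UNIV. \<omega> G C D w * \<omega> F G E w - \<omega> G C E w * \<omega> F G D w)"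
proof -
  have "nab (bracket (e E) (e D)) (e C) w = nab (\<lambda>u. \<Sum>G\<in>UNIV. struct_coef h g U D E G u *\<^sub>R e G u) (e C) w"
    by (rule nab_cong[OF lin open_W, symmetric])
      (simp_all add: w bracket_adapted smooth_adapted smooth_on_sum smooth_on_scaleR smooth_struct_coef open_W)
  also have "\<dots> = (\<Sum>G\<in>UNIV. struct_coef h g U D E G w *\<^sub>R nab (e G) (e C) w)"
    by (rule nab_sum_left[OF lin open_W]) (simp_all add: smooth_struct_coef smooth_adapted w)
  also have "\<dots> = 0"
  proof (rule sum.neutral, rule ballI)
    fix G
    \<comment> \<open>For horizontal \<open>G\<close> the structure coefficient is zero, for
      vertical \<open>G\<close> the connection coefficient.\<close>
    show "struct_coef h g U D E G w *\<^sub>R nab (e G) (e C) w = 0"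
      by (cases G rule: aidx_cases) (simp_all add: nab_frame[OF w] del: adapted.simps)
  qed
  finally show ?thesis
    unfolding curvature_comp_def curvature_def
    by (simp add: linear_diff[OF coframe_linear] nab_nab_frame[OF w] sum_subtractf)
qed

lemma curvature_T:
  assumes "t \<in> A" "x \<in> B"
  shows "curvature_comp h g U nab (t, x, v) (Tix \<eta>) (Tix \<alpha>) (Tix \<beta>) (Tix \<gamma>) = riemann h \<eta> \<alpha> \<beta> \<gamma> t"
  using assms
  by (simp add: curvature_comp_eq frechet_T[OF _ T.smooth_christoffel] sum_aidx riemann_def pd_def sum_subtractf
      del: adapted.simps)

lemma curvature_X:
  assumes "t \<in> A" "x \<in> B"
  shows "curvature_comp h g U nab (t, x, v) (Xix l) (Xix i) (Xix j) (Xix k) = riemann g l i j k x"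
  using assms
  by (simp add: curvature_comp_eq frechet_M[OF _ M.smooth_christoffel] sum_aidx riemann_def pd_def sum_subtractf
      del: adapted.simps)

lemma frechet_christoffel:
  assumes "w \<in> W"
  shows "frechet_derivative (\<lambda>w. christoffel h \<alpha> \<beta> \<gamma> (fst w)) (at w) (e C w) =
      frechet_derivative (christoffel h \<alpha> \<beta> \<gamma>) (at (fst w)) (tpart C)"
    and "frechet_derivative (\<lambda>w. - christoffel h \<alpha> \<beta> \<gamma> (fst w)) (at w) (e C w) =
      - frechet_derivative (christoffel h \<alpha> \<beta> \<gamma>) (at (fst w)) (tpart C)"
    and "frechet_derivative (\<lambda>w. christoffel g i j k (fst (snd w))) (at w) (e C w) =
      frechet_derivative (christoffel g i j k) (at (fst (snd w))) (xpart C)"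
  using frechet_T[OF assms T.smooth_christoffel] frechet_M[OF assms M.smooth_christoffel]
    frechet_derivative_uminus[OF smooth_on_imp_differentiable[OF smooth_T[OF T.smooth_christoffel] assms]]
  by simp_all

text \<open>The index \<alpha> of the frame vector \<open>Vix i \<alpha>\<close> behaves like that
  of a temporal covector. The dual connection has minus the transposed curvature, whence the sign
  and the exchange of \<alpha> and \<eta>; the spatial index \<open>i\<close> is carried along by a
  delta.\<close>

lemma curvature_VT:
  assumes "t \<in> A" "x \<in> B"
  shows "curvature_comp h g U nab (t, x, v) (Vix l \<eta>) (Vix i \<alpha>) (Tix \<beta>) (Tix \<gamma>) =
    (if l = i then - riemann h \<alpha> \<eta> \<beta> \<gamma> t else 0)"
  using assms
  by (simp add: curvature_comp_eq sum_aidx riemann_def sum_subtractf pd_def frechet_derivative_if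
      frechet_christoffel sum_vertical_delta_mult mult.commute del: adapted.simps)

text \<open>Along spatial directions only the spatial index of a vertical vector is moved, so the
  curvature of \<open>g\<close> appears with a delta in the temporal index.\<close>

lemma curvature_VX:
  assumes "t \<in> A" "x \<in> B"
  shows "curvature_comp h g U nab (t, x, v) (Vix l \<eta>) (Vix i \<alpha>) (Xix j) (Xix k) =
    (if \<eta> = \<alpha> then riemann g l i j k x else 0)"
  using assms
  by (simp add: curvature_comp_eq sum_aidx riemann_def sum_subtractf pd_def frechet_derivative_if
      frechet_christoffel sum_vertical_delta_mult del: adapted.simps)

lemma curvature_zero:
  assumes w: "t \<in> A" "x \<in> B"
    and "\<nexists>\<eta> \<alpha> \<beta> \<gamma>. (F, C, D, E) = (Tix \<eta>, Tix \<alpha>, Tix \<beta>, Tix \<gamma>)"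
    and "\<nexists>l i j k. (F, C, D, E) = (Xix l, Xix i, Xix j, Xix k)"
    and "\<nexists>l \<eta> i \<alpha> \<beta> \<gamma>. (F, C, D, E) = (Vix l \<eta>, Vix i \<alpha>, Tix \<beta>, Tix \<gamma>)"
    and "\<nexists>l \<eta> i \<alpha> j k. (F, C, D, E) = (Vix l \<eta>, Vix i \<alpha>, Xix j, Xix k)"
  shows "curvature_comp h g U nab (t, x, v) F C D E = 0"
proof -
  have W: "(t, x, v) \<in> W" using w by simp
  note s = curvature_comp_eq[OF W] sum_aidx sum_subtractf frechet_derivative_if frechet_christoffel[OF W]
    sum_vertical_delta_mult frechet_zero_T[OF T.smooth_christoffel w(1)]
    frechet_zero_M[OF M.smooth_christoffel w(2)]
  \<comment> \<open>A product of two connection coefficients is nonzero only if its outer and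
    intermediate indices lie in one block; hence upper and first lower index of a nonzero curvature
    component have the same type.\<close>
  have z: "\<omega> F C D = (\<lambda>w. 0) \<and> \<omega> G C D w * \<omega> F G E w = 0"
    if "\<nexists>\<alpha> \<beta>. F = Tix \<alpha> \<and> C = Tix \<beta>" "\<nexists>i j. F = Xix i \<and> C = Xix j"
      "\<nexists>i \<alpha> j \<beta>. F = Vix i \<alpha> \<and> C = Vix j \<beta>" for D G E w
    using that by (cases F rule: aidx_cases; cases C rule: aidx_cases; cases G rule: aidx_cases) simp_all
  consider "\<exists>\<alpha> \<beta>. F = Tix \<alpha> \<and> C = Tix \<beta>" | "\<exists>i j. F = Xix i \<and> C = Xix j"
    | "\<exists>i \<alpha> j \<beta>. F = Vix i \<alpha> \<and> C = Vix j \<beta>"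
    | "\<And>D. \<omega> F C D = (\<lambda>w. 0)" "\<And>G D E. \<omega> G C D (t, x, v) * \<omega> F G E (t, x, v) = 0"
    using z by blast
  then show ?thesis
  proof cases
    case 1
    with assms show ?thesis
      by (cases D rule: aidx_cases; cases E rule: aidx_cases) (auto simp: s simp del: adapted.simps)
  next
    case 2
    with assms show ?thesis
      by (cases D rule: aidx_cases; cases E rule: aidx_cases) (auto simp: s simp del: adapted.simps)
  next
    case 3
    with assms show ?thesis
      by (cases D rule: aidx_cases; cases E rule: aidx_cases) (auto simp: s simp del: adapted.simps)
  next
    case 4
    then show ?thesis by (simp only: curvature_comp_eq[OF W]) simp
  qed
qed

end

section \<open>Torsion components in one chart\<close>

context edml_connection
begin

text \<open>Brackets contribute nothing horizontal, and the horizontal connection terms cancel by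
  symmetry of the Christoffel symbols.\<close>

lemma torsion_horizontal:
  assumes "t \<in> A" "x \<in> B"
  shows "torsion_comp h g U nab (t, x, v) (Tix \<gamma>) C D = 0"
    and "torsion_comp h g U nab (t, x, v) (Xix k) C D = 0"
  using assms
  by (cases C rule: aidx_cases; cases D rule: aidx_cases;
      simp add: torsion_comp_eq T.christoffel_sym M.christoffel_sym del: adapted.simps)+

lemma torsion_antisym:
  "torsion_comp h g U nab w F C D = - torsion_comp h g U nab w F D C"
proof -
  have "torsion nab (e D) (e C) w = - torsion nab (e C) (e D) w"
    by (simp add: torsion_def bracket_def)
  then show ?thesis
    unfolding torsion_comp_def using linear_neg[OF coframe_linear] by metis
qed

lemma frame_coef_T_vertical:
  assumes "t \<in> A" "x \<in> B"
  shows "frechet_derivative (frame_coef h g U (Tix \<gamma>) m \<mu>) (at (t, x, v)) (e (Vix i \<alpha>) (t, x, v)) =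
    (if m = i then christoffel h \<alpha> \<mu> \<gamma> t else 0)"
  unfolding frechet_frame_coef_T[OF assms]
  by (simp add: frechet_zero_T[OF T.smooth_christoffel] assms if_distrib cong: if_cong del: adapted.simps)

lemma frechet_K_vertical:
  assumes "t \<in> A" "x \<in> B"
  shows "frechet_derivative (K \<gamma> l i) (at (t, x, v)) (e (Vix k \<alpha>) (t, x, v)) = 0"
proof -
  have "frechet_derivative (\<lambda>p. curlU U \<gamma> l i (fst p) (snd p)) (at (t, x)) 0 = 0"
    by (rule linear_0[OF linear_frechet_derivative[OF differentiable_curlU[OF assms]]])
  then show ?thesis by (simp add: frechet_K[OF assms] zero_prod_def del: adapted.simps)
qed

lemma frame_coef_X_vertical:
  assumes "t \<in> A" "x \<in> B"
  shows "frechet_derivative (frame_coef h g U (Xix j) m \<mu>) (at (t, x, v)) (e (Vix i \<alpha>) (t, x, v)) =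
    (if \<mu> = \<alpha> then - christoffel g m j i x else 0)"
  unfolding frechet_frame_coef_X[OF assms]
  by (simp add: frechet_zero_M[OF M.smooth_christoffel] frechet_zero_M[OF M.smooth_inv]
      frechet_zero_T[OF T.smooth_entry] frechet_K_vertical assms if_distrib cong: if_cong del: adapted.simps)

text \<open>The fibre derivatives of the nonlinear connection are the coefficients by which
  horizontal fields move vertical ones, so bracket and connection term cancel. Two vertical fields
  have constant coefficients and commute.\<close>

lemma torsion_vertical:
  assumes "t \<in> A" "x \<in> B"
  shows "torsion_comp h g U nab (t, x, v) (Vix m \<mu>) (Vix i \<alpha>) D = 0"
  using assms
  by (cases D rule: aidx_cases)
    (auto simp: torsion_comp_eq frame_coef_T_vertical frame_coef_X_vertical M.christoffel_sym simp del: adapted.simps frame_coef.simps(1,2))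

text \<open>Only the bracket contributes. The temporal frame is the horizontal lift of the linear
  connection of \<open>h\<close>, and the bracket of such lifts is its curvature applied to the
  velocity.\<close>

lemma torsion_TT:
  assumes "t \<in> A" "x \<in> B"
  shows "torsion_comp h g U nab (t, x, v) (Vix m \<mu>) (Tix \<alpha>) (Tix \<beta>) =
    - (\<Sum>\<gamma>\<in>UNIV. riemann h \<gamma> \<mu> \<alpha> \<beta> t * v $ m $ \<gamma>)"
proof -
  have d: "frechet_derivative (frame_coef h g U (Tix \<alpha>) m \<mu>) (at (t, x, v)) (e (Tix \<beta>) (t, x, v)) =
      (\<Sum>\<gamma>\<in>UNIV. pd \<beta> (christoffel h \<gamma> \<mu> \<alpha>) t * v $ m $ \<gamma>) +
      (\<Sum>\<epsilon>\<in>UNIV. (\<Sum>\<gamma>\<in>UNIV. christoffel h \<gamma> \<mu> \<alpha> t * christoffel h \<epsilon> \<gamma> \<beta> t) * v $ m $ \<epsilon>)" for \<alpha> \<beta>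
    unfolding frechet_frame_coef_T[OF assms]
    unfolding snd_snd_adapted fst_adapted frame_coef_T
    by (simp add: pd_def sum_contract_swap)
  show ?thesis
    using assms
    by (simp add: torsion_comp_eq d riemann_def distrib_right left_diff_distrib sum.distrib sum_subtractf
        del: adapted.simps frame_coef.simps(1,2))
qed

text \<open>Again only the bracket contributes. The velocity terms cancel, as the lifts belong to
  connections on different factors; what survives is the temporal covariant derivative of the
  \<open>U\<close> part.\<close>

lemma torsion_TX:
  assumes "t \<in> A" "x \<in> B"
  shows "torsion_comp h g U nab (t, x, v) (Vix m \<mu>) (Tix \<alpha>) (Xix j) =
    - (\<Sum>\<eta>\<in>UNIV. \<Sum>k\<in>UNIV. h t $ \<mu> $ \<eta> * matrix_inv (g x) $ m $ k / 4 *
         ((\<Sum>\<gamma>\<in>UNIV. christoffel h \<eta> \<alpha> \<gamma> t * curlU U \<gamma> k j t x) + pd \<alpha> (\<lambda>s. curlU U \<eta> k j s x) t))"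
proof -
  let ?G = "\<lambda>\<gamma> \<mu>. christoffel h \<gamma> \<mu> \<alpha> t" and ?q = "\<lambda>l. matrix_inv (g x) $ m $ l / 4"
  define k where "k = (\<lambda>\<gamma>. \<Sum>l\<in>UNIV. ?q l * curlU U \<gamma> l j t x)"
  define dk where "dk = (\<lambda>\<gamma>. \<Sum>l\<in>UNIV. ?q l * pd \<alpha> (\<lambda>s. curlU U \<gamma> l j s x) t)"
  have 1: "frechet_derivative (frame_coef h g U (Tix \<alpha>) m \<mu>) (at (t, x, v)) (e (Xix j) (t, x, v)) =
      - (\<Sum>\<gamma>\<in>UNIV. ?G \<gamma> \<mu> * (\<Sum>k\<in>UNIV. christoffel g m j k x * v $ k $ \<gamma>))
      - (\<Sum>\<gamma>\<in>UNIV. ?G \<gamma> \<mu> * (\<Sum>\<epsilon>\<in>UNIV. h t $ \<gamma> $ \<epsilon> * k \<epsilon>))"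
    unfolding frechet_frame_coef_T[OF assms]
    unfolding snd_snd_adapted fst_adapted frame_coef_X
    by (simp add: frechet_zero_T[OF T.smooth_christoffel] assms right_diff_distrib sum_subtractf sum_negf
        jet_curl_def k_def sum_distrib_left mult.assoc)
  have 2: "frechet_derivative (frame_coef h g U (Xix j) m \<mu>) (at (t, x, v)) (e (Tix \<alpha>) (t, x, v)) =
      - (\<Sum>k\<in>UNIV. christoffel g m j k x * (\<Sum>\<gamma>\<in>UNIV. ?G \<gamma> \<mu> * v $ k $ \<gamma>))
      - (\<Sum>\<gamma>\<in>UNIV. pd \<alpha> (\<lambda>s. h s $ \<mu> $ \<gamma>) t * k \<gamma> + h t $ \<mu> $ \<gamma> * dk \<gamma>)"
    unfolding frechet_frame_coef_X[OF assms]
    unfolding snd_snd_adapted fst_adapted fst_snd_adapted frame_coef_T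
      frechet_K_T[OF assms]
    by (simp add: frechet_zero_M[OF M.smooth_christoffel] frechet_zero_M[OF M.smooth_inv] assms
        pd_def[symmetric] k_def dk_def sum_distrib_left sum.distrib mult.assoc)
  \<comment> \<open>The Christoffel symbols of \<open>h\<close> and \<open>g\<close> act on
    different indices of the velocity, so their order is immaterial.\<close>
  have 3: "(\<Sum>k\<in>UNIV. christoffel g m j k x * (\<Sum>\<gamma>\<in>UNIV. ?G \<gamma> \<mu> * v $ k $ \<gamma>)) =
      (\<Sum>\<gamma>\<in>UNIV. ?G \<gamma> \<mu> * (\<Sum>k\<in>UNIV. christoffel g m j k x * v $ k $ \<gamma>))"
    unfolding sum_distrib_left by (subst sum.swap) (simp add: mult_ac)
  \<comment> \<open>Compatibility splits the derivative of \<open>h\<close> in two: the first sum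
    cancels against the \<open>U\<close> part in \<open>1\<close>, the second completes the time
    derivative of the curl to a covariant one.\<close>
  have 4: "(\<Sum>\<gamma>\<in>UNIV. pd \<alpha> (\<lambda>s. h s $ \<mu> $ \<gamma>) t * k \<gamma>) =
      (\<Sum>\<gamma>\<in>UNIV. ?G \<gamma> \<mu> * (\<Sum>\<epsilon>\<in>UNIV. h t $ \<gamma> $ \<epsilon> * k \<epsilon>)) +
      (\<Sum>\<eta>\<in>UNIV. h t $ \<mu> $ \<eta> * (\<Sum>\<gamma>\<in>UNIV. ?G \<eta> \<gamma> * k \<gamma>))"
    unfolding T.metric_compatible[OF assms(1)] sum_contract_swap distrib_right sum.distrib
    by (simp add: T.g_sym[OF assms(1), of \<mu>] mult.commute sum_contract_swap)
  have 5: "(\<Sum>k\<in>UNIV. h t $ \<mu> $ \<eta> * matrix_inv (g x) $ m $ k / 4 *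
         ((\<Sum>\<gamma>\<in>UNIV. christoffel h \<eta> \<alpha> \<gamma> t * curlU U \<gamma> k j t x) + pd \<alpha> (\<lambda>s. curlU U \<eta> k j s x) t)) =
      h t $ \<mu> $ \<eta> * (\<Sum>\<gamma>\<in>UNIV. ?G \<eta> \<gamma> * k \<gamma>) + h t $ \<mu> $ \<eta> * dk \<eta>" for \<eta>
  proof -
    have "(\<Sum>\<gamma>\<in>UNIV. ?G \<eta> \<gamma> * k \<gamma>) = (\<Sum>l\<in>UNIV. ?q l * (\<Sum>\<gamma>\<in>UNIV. ?G \<eta> \<gamma> * curlU U \<gamma> l j t x))"
      unfolding k_def sum_distrib_left by (subst sum.swap) (simp add: mult_ac)
    then show ?thesis
      by (simp add: T.christoffel_sym[OF assms(1), of \<eta> \<alpha>] dk_def distrib_left sum.distrib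
          sum_distrib_left mult.assoc)
  qed
  show ?thesis
    unfolding 5 using assms
    by (simp add: torsion_comp_eq 1 2 3 4 sum.distrib del: adapted.simps frame_coef.simps(1,2))
qed

text \<open>The bracket of the lifts gives the curvature of \<open>g\<close> on the velocity, and
  the shift by \<open>U\<close> gives an antisymmetrised covariant derivative. The difference of the
  two covariant derivatives matches the skew-symmetry of torsion in \<open>i\<close> and
  \<open>j\<close>.\<close>

lemma torsion_XX:
  assumes "t \<in> A" "x \<in> B"
  shows "torsion_comp h g U nab (t, x, v) (Vix m \<mu>) (Xix i) (Xix j) =
    (\<Sum>k\<in>UNIV. riemann g m k i j x * v $ k $ \<mu>) +
    (\<Sum>\<eta>\<in>UNIV. \<Sum>k\<in>UNIV. h t $ \<mu> $ \<eta> * matrix_inv (g x) $ m $ k / 4 *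
       (hcovU h g U Lc \<eta> k i j (t, x, v) - hcovU h g U Lc \<eta> k j i (t, x, v)))"
proof -
  have W: "(t, x, v) \<in> W" using assms by simp
  let ?G = "\<lambda>i j k. christoffel g i j k x" and ?q = "\<lambda>l. matrix_inv (g x) $ m $ l"
  \<comment> \<open>This is the curl with its temporal index lowered to \<mu> and the factor 1/4 of
    \<open>Nconn\<close>. Below, in \<open>X\<close> a Christoffel symbol acts on the raised spatial
    index, in \<open>Y\<close> on the index before raising.\<close>
  define k where "k = (\<lambda>l i. \<Sum>\<gamma>\<in>UNIV. h t $ \<mu> $ \<gamma> / 4 * curlU U \<gamma> l i t x)"
  define dk where "dk = (\<lambda>j l i. \<Sum>\<gamma>\<in>UNIV. h t $ \<mu> $ \<gamma> / 4 *
    frechet_derivative (K \<gamma> l i) (at (t, x, v)) (e (Xix j) (t, x, v)))"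
  define X where "X = (\<lambda>i j. \<Sum>k'\<in>UNIV. ?G m i k' * (\<Sum>l\<in>UNIV. matrix_inv (g x) $ k' $ l * k l j))"
  define Y where "Y = (\<lambda>i j. \<Sum>l\<in>UNIV. ?q l * (\<Sum>r\<in>UNIV. ?G r l j * k r i))"
  define Q where "Q = (\<lambda>i j. (\<Sum>k\<in>UNIV. pd j (christoffel g m i k) x * v $ k $ \<mu>)
    - (\<Sum>r\<in>UNIV. (\<Sum>k\<in>UNIV. ?G m i k * ?G k j r) * v $ r $ \<mu>))"
  have sw: "(\<Sum>\<gamma>\<in>UNIV. \<Sum>l\<in>UNIV. h t $ \<mu> $ \<gamma> * c l / 4 * f \<gamma> l) =
      (\<Sum>l\<in>UNIV. c l * (\<Sum>\<gamma>\<in>UNIV. h t $ \<mu> $ \<gamma> / 4 * f \<gamma> l))" for c :: "'n \<Rightarrow> real" and f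
    unfolding sum_distrib_left by (subst sum.swap) (simp add: mult_ac)
  have coef: "frame_coef h g U (Xix j) k' \<mu> (t, x, v) = - (\<Sum>r\<in>UNIV. ?G k' j r * v $ r $ \<mu>)
      - (\<Sum>l\<in>UNIV. matrix_inv (g x) $ k' $ l * k l j)" for j k'
    unfolding frame_coef_X by (simp only: sw k_def jet_curl_def fst_conv snd_conv)
  have 1: "(\<Sum>l\<in>UNIV. pd j (\<lambda>y. matrix_inv (g y) $ m $ l) x * k l i) = - Y i j - X j i" for i j
    unfolding M.inverse_metric_compatible[OF assms(2)] X_def Y_def sum_contract_swap
    by (simp add: left_diff_distrib sum_subtractf sum_negf M.christoffel_sym[OF assms(2), of _ _ j])
  \<comment> \<open>One \<open>X\<close> comes from the vertical part of the direction, the other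
    from the derivative of the inverse metric; their sum is symmetric in \<open>i\<close> and
    \<open>j\<close> and drops out of the bracket.\<close>
  have D: "frechet_derivative (frame_coef h g U (Xix i) m \<mu>) (at (t, x, v)) (e (Xix j) (t, x, v)) =
      - Q i j + X i j + Y i j + X j i - (\<Sum>l\<in>UNIV. ?q l * dk j l i)" for i j
  proof -
    have "(\<Sum>\<gamma>\<in>UNIV. \<Sum>l\<in>UNIV. (frechet_derivative (\<lambda>s. h s $ \<mu> $ \<gamma>) (at t) 0 * ?q l +
          h t $ \<mu> $ \<gamma> * pd j (\<lambda>y. matrix_inv (g y) $ m $ l) x) / 4 * curlU U \<gamma> l i t x +
          h t $ \<mu> $ \<gamma> * ?q l / 4 * frechet_derivative (K \<gamma> l i) (at (t, x, v)) (e (Xix j) (t, x, v))) =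
        (- Y i j - X j i) + (\<Sum>l\<in>UNIV. ?q l * dk j l i)"
      by (simp only: frechet_zero_T[OF T.smooth_entry assms(1)] mult_zero_left add_0 sum.distrib sw
          dk_def 1[unfolded k_def])
    moreover have "(\<Sum>k\<in>UNIV. ?G m i k * frame_coef h g U (Xix j) k \<mu> (t, x, v)) =
        - (\<Sum>r\<in>UNIV. (\<Sum>k\<in>UNIV. ?G m i k * ?G k j r) * v $ r $ \<mu>) - X i j"
      unfolding coef X_def sum_contract_swap[symmetric]
      by (simp add: right_diff_distrib sum_subtractf sum_negf)
    ultimately show ?thesis
      unfolding frechet_frame_coef_X[OF assms]
    unfolding snd_snd_adapted fst_adapted fst_snd_adapted tpart.simps xpart.simps
        pd_def[symmetric] Q_def
      by simp
  qed
  have R: "(\<Sum>k\<in>UNIV. riemann g m k i j x * v $ k $ \<mu>) = Q i j - Q j i"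
  proof -
    have "?G m' k' i = ?G m' i k'" for m' k' i
      by (rule M.christoffel_sym[OF assms(2)])
    moreover have "pd l (christoffel g m k i) x = pd l (christoffel g m i k) x" for l k i
      unfolding pd_def
      by (rule fun_cong[OF frechet_derivative_cong_open[OF M.open_S assms(2) M.christoffel_sym]])
    ultimately show ?thesis
      unfolding Q_def riemann_def by (simp add: algebra_simps sum.distrib sum_subtractf)
  qed
  have cov: "(\<Sum>\<eta>\<in>UNIV. h t $ \<mu> $ \<eta> / 4 * hcovU h g U Lc \<eta> l i j (t, x, v)) =
      dk j l i - (\<Sum>r\<in>UNIV. ?G r l j * k r i) - (\<Sum>r\<in>UNIV. ?G r i j * k l r)" for l i j
  proof -
    have "hcovU h g U Lc \<eta> l i j (t, x, v) =
        frechet_derivative (K \<eta> l i) (at (t, x, v)) (e (Xix j) (t, x, v))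
        - (\<Sum>r\<in>UNIV. ?G r l j * curlU U \<eta> r i t x) - (\<Sum>r\<in>UNIV. ?G r i j * curlU U \<eta> l r t x)" for \<eta>
      unfolding hcovU_def Let_def Lc_eq[OF W] jet_curl_def[abs_def] by simp
    moreover have "(\<Sum>r\<in>UNIV. ?G r l j * k r i) =
        (\<Sum>\<eta>\<in>UNIV. h t $ \<mu> $ \<eta> / 4 * (\<Sum>r\<in>UNIV. ?G r l j * curlU U \<eta> r i t x))"
      unfolding k_def sum_distrib_left by (subst sum.swap) (simp add: mult_ac)
    moreover have "(\<Sum>r\<in>UNIV. ?G r i j * k l r) =
        (\<Sum>\<eta>\<in>UNIV. h t $ \<mu> $ \<eta> / 4 * (\<Sum>r\<in>UNIV. ?G r i j * curlU U \<eta> l r t x))"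
      unfolding k_def sum_distrib_left by (subst sum.swap) (simp add: mult_ac)
    ultimately show ?thesis
      by (simp add: dk_def right_diff_distrib sum_subtractf)
  qed
  \<comment> \<open>The connection terms on the second spatial index are symmetric in
    \<open>i\<close> and \<open>j\<close>, so only those collected in \<open>Y\<close> remain in the
    difference.\<close>
  have "(\<Sum>\<eta>\<in>UNIV. \<Sum>k\<in>UNIV. h t $ \<mu> $ \<eta> * ?q k / 4 *
       (hcovU h g U Lc \<eta> k i j (t, x, v) - hcovU h g U Lc \<eta> k j i (t, x, v))) =
     (\<Sum>l\<in>UNIV. ?q l * dk j l i) - Y i j - ((\<Sum>l\<in>UNIV. ?q l * dk i l j) - Y j i)"
    unfolding sw right_diff_distrib sum_subtractf cov Y_def
    by (simp add: M.christoffel_sym[OF assms(2), of _ i j])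
  then show ?thesis
    using W R by (simp add: torsion_comp_eq D del: adapted.simps frame_coef.simps(1,2))
qed

end

section \<open>Vector-valued calculus and contraction of three-index arrays\<close>

section \<open>Tensor calculus under a change of coordinates\<close>

lemma smooth_on_subset: "smooth_on S f \<Longrightarrow> T \<subseteq> S \<Longrightarrow> smooth_on T f"
proof -
  have "Ck_on k S f \<Longrightarrow> T \<subseteq> S \<Longrightarrow> Ck_on k T f" for k
    by (induction k arbitrary: f) (auto intro: continuous_on_subset)
  then show "smooth_on S f \<Longrightarrow> T \<subseteq> S \<Longrightarrow> smooth_on T f" by (auto simp: smooth_on_def)
qed

lemma smooth_on_vec:
  fixes f :: "'i::finite \<Rightarrow> 'a::real_normed_vector \<Rightarrow> 'b::euclidean_space"
  assumes "open S" "\<And>i. smooth_on S (f i)"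
  shows "smooth_on S (\<lambda>x. \<chi> i. f i x)"
proof -
  have "linear (axis i :: 'b \<Rightarrow> 'b ^ 'i)" for i
    by (rule linearI) (auto simp: vec_eq_iff axis_def)
  then have "bounded_linear (axis i :: 'b \<Rightarrow> 'b ^ 'i)" for i
    by (rule linear_conv_bounded_linear[THEN iffD1])
  then have "smooth_on S (\<lambda>x. \<Sum>i\<in>UNIV. axis i (f i x))"
    by (intro smooth_on_sum smooth_on_bounded_linear_compose[of S "axis i" for i] assms)
  moreover have "(\<Sum>i\<in>UNIV. axis i (f i x)) = (\<chi> i. f i x)" for x
    by (simp add: vec_eq_iff axis_def)
  ultimately show ?thesis by simp
qed

lemma frechet_derivative_nth:
  "f differentiable (at x) \<Longrightarrow> frechet_derivative f (at x) v $ i = frechet_derivative (\<lambda>y. f y $ i) (at x) v"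
  using frechet_derivative_bounded_linear_compose[OF bounded_linear_vec_nth] by metis

lemma linear_axis_expand:
  fixes f :: "real ^ 'd \<Rightarrow> 'b::real_vector"
  assumes "linear f"
  shows "f u = (\<Sum>i\<in>UNIV. u $ i *\<^sub>R f (axis i 1))"
proof -
  have "u = (\<Sum>i\<in>UNIV. u $ i *\<^sub>R axis i 1)"
    by (simp add: vec_eq_iff axis_def if_distrib cong: if_cong)
  then have "f u = f (\<Sum>i\<in>UNIV. u $ i *\<^sub>R axis i 1)" by simp
  then show ?thesis by (simp add: linear_sum[OF assms] linear_cmul[OF assms])
qed

lemma bounded_bilinear_matrix_vector:
  "bounded_bilinear ((*v) :: real ^ 'n ^ 'm \<Rightarrow> real ^ 'n \<Rightarrow> real ^ 'm)"
  unfolding bilinear_conv_bounded_bilinear[symmetric] bilinear_def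
  by (auto intro!: linearI simp: matrix_vector_right_distrib matrix_vector_mult_add_rdistrib
      scaleR_matrix_vector_assoc matrix_vector_mult_scaleR)

text \<open>Two nested matrix-vector products rather than an explicit double sum: two uses of the
  bilinear product rule then give its derivative.\<close>

definition app3 :: "real ^ 'c ^ 'b ^ 'a \<Rightarrow> real ^ 'b \<Rightarrow> real ^ 'c \<Rightarrow> real ^ 'a" where
  "app3 T u v = (\<chi> i. T $ i *v v) *v u"

lemma app3_nth: "app3 T u v $ i = (\<Sum>j\<in>UNIV. (\<Sum>k\<in>UNIV. T $ i $ j $ k * v $ k) * u $ j)"
  by (simp add: app3_def matrix_vector_mult_def)

lemma app3_add:
  "app3 (T + T') u v = app3 T u v + app3 T' u v"
  "app3 T (u + u') v = app3 T u v + app3 T u' v"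
  "app3 T u (v + v') = app3 T u v + app3 T u v'"
  by (simp_all add: vec_eq_iff app3_nth algebra_simps sum.distrib)

lemma app3_scale:
  "app3 T (c *\<^sub>R u) v = c *\<^sub>R app3 T u v"
  "app3 T u (c *\<^sub>R v) = c *\<^sub>R app3 T u v"
  "app3 (c *\<^sub>R T) u v = c *\<^sub>R app3 T u v"
  by (simp_all add: vec_eq_iff app3_nth algebra_simps sum_distrib_left)

lemma app3_axis: "app3 T (axis j 1) (axis k 1) $ i = T $ i $ j $ k"
  by (simp add: app3_nth axis_def if_distrib cong: if_cong)

lemma linear_app3:
  "linear (\<lambda>T. app3 T u v)" "linear (\<lambda>u. app3 T u v)" "linear (\<lambda>v. app3 T u v)"
  by (auto intro!: linearI simp: app3_add app3_scale)

lemma bounded_bilinear_contract: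
  "bounded_bilinear (\<lambda>(T :: real ^ 'c ^ 'b ^ 'a) v. \<chi> i. T $ i *v v)"
  unfolding bilinear_conv_bounded_bilinear[symmetric] bilinear_def
  by (auto intro!: linearI simp: vec_eq_iff matrix_vector_right_distrib matrix_vector_mult_add_rdistrib
      scaleR_matrix_vector_assoc[symmetric] matrix_vector_mult_scaleR)

lemma differentiable_app3:
  assumes "T differentiable (at x)" "a differentiable (at x)" "b differentiable (at x)"
  shows "(\<lambda>y. app3 (T y) (a y) (b y)) differentiable (at x)"
  unfolding app3_def
  by (intro differentiable_bilinear[OF bounded_bilinear_matrix_vector]
      differentiable_bilinear[OF bounded_bilinear_contract] assms)

lemma frechet_derivative_app3:
  assumes "T differentiable (at x)" "a differentiable (at x)" "b differentiable (at x)"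
  shows "frechet_derivative (\<lambda>y. app3 (T y) (a y) (b y)) (at x) w =
    app3 (frechet_derivative T (at x) w) (a x) (b x) + app3 (T x) (frechet_derivative a (at x) w) (b x)
    + app3 (T x) (a x) (frechet_derivative b (at x) w)"
  using frechet_derivative_bilinear[OF bounded_bilinear_matrix_vector
      differentiable_bilinear[OF bounded_bilinear_contract assms(1,3)] assms(2), of w]
    frechet_derivative_bilinear[OF bounded_bilinear_contract assms(1,3), of w]
  by (simp add: app3_def matrix_vector_mult_add_rdistrib)

definition jac :: "(real ^ 'd \<Rightarrow> real ^ 'd) \<Rightarrow> real ^ 'd \<Rightarrow> real ^ 'd ^ 'd" where
  "jac \<phi> y = matrix (frechet_derivative \<phi> (at y))"

definition Gam :: "(real ^ 'd \<Rightarrow> real ^ 'd ^ 'd::finite) \<Rightarrow> real ^ 'd \<Rightarrow> real ^ 'd ^ 'd ^ 'd" where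
  "Gam g y = (\<chi> i j k. christoffel g i j k y)"

text \<open>This is R(w, v)u for the Levi-Civita connection, the slots \<open>u\<close>,
  \<open>v\<close>, \<open>w\<close> carrying the three lower indices of \<open>riemann\<close> in
  their order.\<close>

definition Rm :: "(real ^ 'd \<Rightarrow> real ^ 'd ^ 'd::finite) \<Rightarrow> real ^ 'd \<Rightarrow> real ^ 'd \<Rightarrow> real ^ 'd \<Rightarrow>
    real ^ 'd \<Rightarrow> real ^ 'd" where
  "Rm g y u v w = app3 (frechet_derivative (Gam g) (at y) w) u v
    - app3 (frechet_derivative (Gam g) (at y) v) u w
    + app3 (Gam g y) (app3 (Gam g y) u v) w - app3 (Gam g y) (app3 (Gam g y) u w) v"

section \<open>Jacobian and higher derivatives of a change of coordinates\<close>

locale transition =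
  fixes S S' :: "(real ^ 'd::finite) set" and \<phi> \<psi> :: "real ^ 'd \<Rightarrow> real ^ 'd"
  assumes open_dom: "open S" and open_cod: "open S'"
    and maps: "y \<in> S \<Longrightarrow> \<phi> y \<in> S'" and maps': "z \<in> S' \<Longrightarrow> \<psi> z \<in> S"
    and left_inv: "y \<in> S \<Longrightarrow> \<psi> (\<phi> y) = y" and right_inv: "z \<in> S' \<Longrightarrow> \<phi> (\<psi> z) = z"
    and smooth_trans: "smooth_on S \<phi>" and smooth_trans': "smooth_on S' \<psi>"
begin

lemma differentiable_trans: "y \<in> S \<Longrightarrow> \<phi> differentiable (at y)"
  by (rule smooth_on_imp_differentiable[OF smooth_trans])

lemma jac_apply: "y \<in> S \<Longrightarrow> jac \<phi> y *v v = frechet_derivative \<phi> (at y) v"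
  unfolding jac_def using linear_frechet_derivative[OF differentiable_trans]
  by (simp add: matrix_vector_mul(2)[symmetric])

lemma jac_apply': "z \<in> S' \<Longrightarrow> jac \<psi> z *v v = frechet_derivative \<psi> (at z) v"
  unfolding jac_def
  using linear_frechet_derivative[OF smooth_on_imp_differentiable[OF smooth_trans']]
  by (simp add: matrix_vector_mul(2)[symmetric])

lemma jac_left: assumes "y \<in> S" shows "jac \<psi> (\<phi> y) *v (jac \<phi> y *v v) = v"
proof -
  have "frechet_derivative (\<lambda>y. \<psi> (\<phi> y)) (at y) v = frechet_derivative (\<lambda>y. y) (at y) v"
    by (rule fun_cong[OF frechet_derivative_cong_open[OF open_dom assms left_inv]])
  moreover have "frechet_derivative (\<lambda>y. \<psi> (\<phi> y)) (at y) v =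
      frechet_derivative \<psi> (at (\<phi> y)) (frechet_derivative \<phi> (at y) v)"
    using assms by (intro frechet_derivative_compose smooth_on_imp_differentiable[OF smooth_trans']
        differentiable_trans maps)
  ultimately show ?thesis
    using assms by (simp add: jac_apply jac_apply' maps)
qed

lemma jac_right: assumes "y \<in> S" shows "jac \<phi> y *v (jac \<psi> (\<phi> y) *v v) = v"
proof -
  have "frechet_derivative (\<lambda>z. \<phi> (\<psi> z)) (at (\<phi> y)) v = frechet_derivative (\<lambda>z. z) (at (\<phi> y)) v"
    by (rule fun_cong[OF frechet_derivative_cong_open[OF open_cod maps[OF assms] right_inv]])
  moreover have "frechet_derivative (\<lambda>z. \<phi> (\<psi> z)) (at (\<phi> y)) v =
      frechet_derivative \<phi> (at (\<psi> (\<phi> y))) (frechet_derivative \<psi> (at (\<phi> y)) v)"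
    using assms by (intro frechet_derivative_compose smooth_on_imp_differentiable[OF smooth_trans']
        differentiable_trans maps maps')
  ultimately show ?thesis
    using assms by (simp add: jac_apply jac_apply' maps left_inv)
qed

lemma jac_cancel: "y \<in> S \<Longrightarrow> jac \<phi> y *v u = jac \<phi> y *v v \<Longrightarrow> u = v"
  using jac_left by metis

lemma smooth_jac: "smooth_on S (jac \<phi>)"
proof -
  have "smooth_on S (\<lambda>y. \<chi> i j. frechet_derivative \<phi> (at y) (axis j 1) $ i)"
    by (intro smooth_on_vec smooth_on_component smooth_on_frechet_derivative smooth_trans open_dom)
  then show ?thesis unfolding jac_def[abs_def] matrix_def .
qed

lemma differentiable_jac: "y \<in> S \<Longrightarrow> jac \<phi> differentiable (at y)"
  by (rule smooth_on_imp_differentiable[OF smooth_jac])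

text \<open>The second derivative of \<phi>, taken as the derivative of the Jacobian because it
  arises when laws containing the Jacobian are differentiated.\<close>

definition D2 :: "real ^ 'd \<Rightarrow> real ^ 'd \<Rightarrow> real ^ 'd \<Rightarrow> real ^ 'd" where
  "D2 y u w = frechet_derivative (jac \<phi>) (at y) w *v u"

lemma frechet_derivative_jac_mult:
  assumes "y \<in> S" "a differentiable (at y)"
  shows "frechet_derivative (\<lambda>z. jac \<phi> z *v a z) (at y) w =
    jac \<phi> y *v frechet_derivative a (at y) w + D2 y (a y) w"
  unfolding D2_def
  by (rule frechet_derivative_bilinear[OF bounded_bilinear_matrix_vector differentiable_jac[OF assms(1)] assms(2)])

lemma frechet_derivative_jac_const:
  "y \<in> S \<Longrightarrow> frechet_derivative (\<lambda>z. jac \<phi> z *v u) (at y) w = D2 y u w"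
  using frechet_derivative_jac_mult[OF _ differentiable_const] by (simp add: matrix_vector_mult_0_right)

lemma D2_eq:
  assumes "y \<in> S"
  shows "D2 y u w = frechet_derivative (\<lambda>z. frechet_derivative \<phi> (at z) u) (at y) w"
  unfolding frechet_derivative_jac_const[OF assms, symmetric]
  by (rule fun_cong[OF frechet_derivative_cong_open[OF open_dom assms jac_apply]])

lemma D2_sym: "y \<in> S \<Longrightarrow> D2 y u w = D2 y w u"
  by (simp add: D2_eq frechet_derivative_commute[OF open_dom _ smooth_trans])

lemma smooth_D2: "smooth_on S (\<lambda>y. D2 y u v)"
  unfolding D2_def
  by (intro smooth_on_bilinear[OF open_dom bounded_bilinear_matrix_vector]
      smooth_on_frechet_derivative smooth_jac smooth_on_const)

text \<open>Symmetry of second derivatives, applied to the derivative of \<phi> in the fixed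
  direction \<open>u\<close>.\<close>

lemma D3_sym:
  assumes y: "y \<in> S"
  shows "frechet_derivative (\<lambda>z. D2 z u v) (at y) w = frechet_derivative (\<lambda>z. D2 z u w) (at y) v"
proof -
  let ?f = "\<lambda>z. frechet_derivative \<phi> (at z) u"
  have "frechet_derivative (\<lambda>z. D2 z u v) (at y) w =
      frechet_derivative (\<lambda>z. frechet_derivative ?f (at z) v) (at y) w" for v w
    by (rule fun_cong[OF frechet_derivative_cong_open[OF open_dom y D2_eq]])
  moreover have "frechet_derivative (\<lambda>z. frechet_derivative ?f (at z) v) (at y) w =
      frechet_derivative (\<lambda>z. frechet_derivative ?f (at z) w) (at y) v"
    by (rule frechet_derivative_commute[OF open_dom y smooth_on_frechet_derivative[OF smooth_trans]])
  ultimately show ?thesis by simp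
qed

lemma linear_D2: "y \<in> S \<Longrightarrow> linear (D2 y u)" "linear (\<lambda>u. D2 y u w)"
proof -
  show "linear (D2 y u)" if "y \<in> S"
    unfolding D2_def
    by (rule linear_compose[OF linear_frechet_derivative[OF differentiable_jac[OF that]],
          of "\<lambda>A. A *v u", unfolded comp_def])
      (rule bounded_linear.linear[OF bounded_bilinear.bounded_linear_left[OF bounded_bilinear_matrix_vector]])
  show "linear (\<lambda>u. D2 y u w)" unfolding D2_def by (rule matrix_vector_mul_linear)
qed

lemma compose_derivative:
  assumes "y \<in> S" "f differentiable (at (\<phi> y))"
  shows "frechet_derivative (\<lambda>z. f (\<phi> z)) (at y) w = frechet_derivative f (at (\<phi> y)) (jac \<phi> y *v w)"
  using frechet_derivative_compose[OF assms(2) differentiable_trans[OF assms(1)]] jac_apply[OF assms(1)]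
  by simp

lemma differentiable_compose_trans:
  "y \<in> S \<Longrightarrow> f differentiable (at (\<phi> y)) \<Longrightarrow> (\<lambda>z. f (\<phi> z)) differentiable (at y)"
  using differentiable_compose[OF _ differentiable_trans] .

lemma differentiable_jac_const: "y \<in> S \<Longrightarrow> (\<lambda>z. jac \<phi> z *v u) differentiable (at y)"
  by (intro differentiable_bilinear[OF bounded_bilinear_matrix_vector] differentiable_jac differentiable_const)

end

section \<open>Christoffel symbols and curvature as multilinear maps\<close>

context metric_chart
begin

lemma smooth_Gam: "smooth_on S (Gam g)"
  unfolding Gam_def[abs_def] by (intro smooth_on_vec smooth_christoffel open_S)

lemma differentiable_Gam: "y \<in> S \<Longrightarrow> Gam g differentiable (at y)"
  by (rule smooth_on_imp_differentiable[OF smooth_Gam])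

lemma frechet_Gam_nth:
  assumes "y \<in> S"
  shows "frechet_derivative (Gam g) (at y) w $ i $ j $ k = frechet_derivative (christoffel g i j k) (at y) w"
proof -
  have s: "smooth_on S (\<lambda>y. Gam g y $ i)" "smooth_on S (\<lambda>y. Gam g y $ i $ j)" for i j
    by (intro smooth_on_component smooth_Gam open_S)+
  have "frechet_derivative (Gam g) (at y) w $ i $ j $ k =
      frechet_derivative (\<lambda>y. Gam g y $ i $ j $ k) (at y) w"
    using assms s smooth_on_imp_differentiable differentiable_Gam
    by (subst frechet_derivative_nth, blast)+ (rule refl)
  then show ?thesis by (simp add: Gam_def)
qed

lemma Rm_axis:
  assumes "y \<in> S"
  shows "Rm g y (axis i 1) (axis j 1) (axis k 1) $ l = riemann g l i j k y"
proof -
  have "app3 (Gam g y) w (axis k 1) $ l = (\<Sum>m\<in>UNIV. w $ m * christoffel g l m k y)" for w k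
    by (simp add: app3_nth Gam_def axis_def if_distrib mult.commute cong: if_cong)
  then show ?thesis
    by (simp add: Rm_def riemann_def app3_axis frechet_Gam_nth[OF assms] pd_def sum_subtractf)
      (simp add: app3_axis Gam_def)
qed

lemma linear_Rm:
  assumes "y \<in> S"
  shows "linear (\<lambda>u. Rm g y u v w)" "linear (\<lambda>v. Rm g y u v w)" "linear (\<lambda>w. Rm g y u v w)"
proof -
  have l: "linear (frechet_derivative (Gam g) (at y))"
    by (rule linear_frechet_derivative[OF differentiable_Gam[OF assms]])
  show "linear (\<lambda>u. Rm g y u v w)" "linear (\<lambda>v. Rm g y u v w)" "linear (\<lambda>w. Rm g y u v w)"
    by (auto intro!: linearI simp: Rm_def app3_add app3_scale linear_add[OF l] linear_cmul[OF l]
        algebra_simps)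
qed

lemma Gam_compatible:
  assumes y: "y \<in> S"
  shows "u \<bullet> (frechet_derivative g (at y) w *v v) =
    app3 (Gam g y) u w \<bullet> (g y *v v) + app3 (Gam g y) v w \<bullet> (g y *v u)"
proof -
  have d: "g differentiable (at y)" by (rule smooth_on_imp_differentiable[OF smooth y])
  have l: "linear (frechet_derivative g (at y))" by (rule linear_frechet_derivative[OF d])
  have nth: "frechet_derivative g (at y) (axis k 1) $ i $ j = pd k (\<lambda>z. g z $ i $ j) y" for i j k
  proof -
    have "(\<lambda>z. g z $ i) differentiable (at y)"
      by (rule smooth_on_imp_differentiable[OF smooth_on_component[OF open_S smooth] y])
    then show ?thesis by (simp add: frechet_derivative_nth d pd_def)
  qed
  have ax: "x \<bullet> (A *v axis j 1) = (\<Sum>m\<in>UNIV. x $ m * A $ m $ j)" for x and A :: "real ^ 'd ^ 'd" and j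
    by (simp add: inner_vec_def matrix_vector_mult_def axis_def if_distrib cong: if_cong)
  have ax': "axis i 1 \<bullet> (A *v axis j 1) = A $ i $ j" for A :: "real ^ 'd ^ 'd" and i j
    by (simp add: ax axis_def[of i] if_distrib[where f = "\<lambda>c. c * z" for z] cong: if_cong)
  have basis: "axis i 1 \<bullet> (frechet_derivative g (at y) (axis k 1) *v axis j 1) =
    app3 (Gam g y) (axis i 1) (axis k 1) \<bullet> (g y *v axis j 1) +
    app3 (Gam g y) (axis j 1) (axis k 1) \<bullet> (g y *v axis i 1)" for i j k
    unfolding ax' nth metric_compatible[OF y] unfolding ax app3_axis Gam_def by simp
  note lins = linear_add[OF l] linear_cmul[OF l] app3_add app3_scale inner_add_left inner_add_right
    matrix_vector_right_distrib matrix_vector_mult_add_rdistrib algebra_simps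
    scaleR_matrix_vector_assoc[symmetric] matrix_vector_mult_scaleR
  let ?l = "\<lambda>u v w. u \<bullet> (frechet_derivative g (at y) w *v v)"
  let ?r = "\<lambda>u v w. app3 (Gam g y) u w \<bullet> (g y *v v) + app3 (Gam g y) v w \<bullet> (g y *v u)"
  have lin: "linear (\<lambda>u. ?l u v w)" "linear (\<lambda>v. ?l u v w)" "linear (\<lambda>w. ?l u v w)"
    "linear (\<lambda>u. ?r u v w)" "linear (\<lambda>v. ?r u v w)" "linear (\<lambda>w. ?r u v w)" for u v w
    by (auto intro!: linearI simp: lins)
  \<comment> \<open>Both sides are trilinear; the identity on basis vectors is extended one slot at
    a time.\<close>
  have 1: "?l (axis i 1) (axis j 1) w = ?r (axis i 1) (axis j 1) w" for i j
    by (subst linear_axis_expand[OF lin(3)], subst linear_axis_expand[OF lin(6)]) (simp only: basis)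
  have 2: "?l (axis i 1) v w = ?r (axis i 1) v w" for i
    by (subst linear_axis_expand[OF lin(2)], subst linear_axis_expand[OF lin(5)]) (simp only: 1)
  show ?thesis
    by (subst linear_axis_expand[OF lin(1)], subst linear_axis_expand[OF lin(4)]) (simp only: 2)
qed

lemma Gam_sym: "y \<in> S \<Longrightarrow> app3 (Gam g y) u v = app3 (Gam g y) v u"
  unfolding vec_eq_iff app3_nth Gam_def sum_distrib_right
  by (subst sum.swap) (simp add: christoffel_sym mult_ac)

text \<open>Testing with the inverse metric applied to \<open>u - v\<close> yields the Euclidean
  square norm of \<open>u - v\<close>, which is definite whatever the signature of the
  metric.\<close>

lemma nondegenerate:
  assumes "y \<in> S" "\<And>w. u \<bullet> (g y *v w) = v \<bullet> (g y *v w)"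
  shows "u = v"
proof -
  have "g y *v (matrix_inv (g y) *v (u - v)) = u - v"
    by (simp add: matrix_vector_mul_assoc matrix_inv_left_right inv[OF assms(1)])
  then have "(u - v) \<bullet> (u - v) = 0"
    using assms(2)[of "matrix_inv (g y) *v (u - v)"] by (simp add: inner_diff_left)
  then show ?thesis by simp
qed

lemma inner_sym: "y \<in> S \<Longrightarrow> u \<bullet> (g y *v v) = v \<bullet> (g y *v u)"
  using sym[of y] by (metis dot_lmul_matrix inner_commute transpose_matrix_vector)

end

section \<open>Transformation laws of the Levi-Civita connection and its curvature\<close>

locale metric_transition = transition S S' \<phi> \<psi> + M: metric_chart S g + M': metric_chart S' g'
  for S S' :: "(real ^ 'd::finite) set" and \<phi> \<psi> g g' +
  assumes metric_law: "y \<in> S \<Longrightarrow> u \<bullet> (g y *v v) = (jac \<phi> y *v u) \<bullet> (g' (\<phi> y) *v (jac \<phi> y *v v))"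
begin

lemma metric_law_derivative:
  assumes y: "y \<in> S"
  shows "u \<bullet> (frechet_derivative g (at y) w *v v) =
    (jac \<phi> y *v u) \<bullet> (frechet_derivative g' (at (\<phi> y)) (jac \<phi> y *v w) *v (jac \<phi> y *v v))
    + D2 y u w \<bullet> (g' (\<phi> y) *v (jac \<phi> y *v v)) + D2 y v w \<bullet> (g' (\<phi> y) *v (jac \<phi> y *v u))"
proof -
  note mv = bounded_bilinear_matrix_vector
  have dg: "g differentiable (at y)" and dg': "g' differentiable (at (\<phi> y))"
    using smooth_on_imp_differentiable M.smooth M'.smooth y maps by blast+
  have "u \<bullet> (frechet_derivative g (at y) w *v v) = frechet_derivative (\<lambda>z. u \<bullet> (g z *v v)) (at y) w"
    using frechet_derivative_bilinear[OF mv dg differentiable_const, of v w]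
      frechet_derivative_bounded_linear_compose[OF bounded_linear_inner_right
        differentiable_bilinear[OF mv dg differentiable_const], of u v w]
    by (simp add: matrix_vector_mult_0_right)
  also have "\<dots> = frechet_derivative (\<lambda>z. (jac \<phi> z *v u) \<bullet> (g' (\<phi> z) *v (jac \<phi> z *v v))) (at y) w"
    by (rule fun_cong[OF frechet_derivative_cong_open[OF open_dom y metric_law]])
  also have "\<dots> = (jac \<phi> y *v u) \<bullet> (g' (\<phi> y) *v D2 y v w +
      frechet_derivative g' (at (\<phi> y)) (jac \<phi> y *v w) *v (jac \<phi> y *v v))
      + D2 y u w \<bullet> (g' (\<phi> y) *v (jac \<phi> y *v v))"
    using frechet_derivative_bilinear[OF bounded_bilinear_inner differentiable_jac_const[OF y]
        differentiable_bilinear[OF mv differentiable_compose_trans[OF y dg'] differentiable_jac_const[OF y]]]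
      frechet_derivative_bilinear[OF mv differentiable_compose_trans[OF y dg'] differentiable_jac_const[OF y]]
    by (simp add: frechet_derivative_jac_const[OF y] compose_derivative[OF y dg'])
  finally show ?thesis
    by (simp add: inner_add_right M'.inner_sym[OF maps[OF y], of "jac \<phi> y *v u" "D2 y v w"])
qed

text \<open>The pull-back of the connection of \<open>g'\<close> is symmetric and compatible with \<open>g\<close>, so uniqueness
  of the Levi-Civita connection gives the transformation law without any computation of Christoffel
  symbols.\<close>

lemma Gam_law:
  assumes y: "y \<in> S"
  shows "jac \<phi> y *v app3 (Gam g y) u v = app3 (Gam g' (\<phi> y)) (jac \<phi> y *v u) (jac \<phi> y *v v) + D2 y u v"
proof -
  let ?J = "\<lambda>u. jac \<phi> y *v u"
  \<comment> \<open>\<open>P\<close> is the pull-back of the primed connection; the second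
    derivative of \<phi> is its inhomogeneous term.\<close>
  define P where "P u v = jac \<psi> (\<phi> y) *v (app3 (Gam g' (\<phi> y)) (?J u) (?J v) + D2 y u v)" for u v
  have JP: "?J (P u v) = app3 (Gam g' (\<phi> y)) (?J u) (?J v) + D2 y u v" for u v
    unfolding P_def by (rule jac_right[OF y])
  have inP: "P u w \<bullet> (g y *v v) = (app3 (Gam g' (\<phi> y)) (?J u) (?J w) + D2 y u w) \<bullet> (g' (\<phi> y) *v ?J v)" for u v w
    unfolding metric_law[OF y] JP ..
  \<comment> \<open>The second derivatives of \<phi> produced by differentiating the metric law are
    those contained in \<open>P\<close>; the rest is compatibility of the primed connection.\<close>
  have compat: "u \<bullet> (frechet_derivative g (at y) w *v v) = P u w \<bullet> (g y *v v) + P v w \<bullet> (g y *v u)" for u v w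
    unfolding metric_law_derivative[OF y] M'.Gam_compatible[OF maps[OF y]] inP
    by (simp add: inner_add_left)
  have dg: "g differentiable (at y)" by (rule smooth_on_imp_differentiable[OF M.smooth y])
  have "P (axis j 1) (axis k 1) $ i = christoffel g i j k y" for i j k
  proof (rule M.christoffel_unique[OF y, where L = "\<lambda>i j k. P (axis j 1) (axis k 1) $ i"])
    show "P (axis j 1) (axis k 1) $ i = P (axis k 1) (axis j 1) $ i" for i j k
      by (simp add: P_def M'.Gam_sym[OF maps[OF y], of "?J (axis j 1)"] D2_sym[OF y, of "axis j 1"])
    have ax: "x \<bullet> (A *v axis j 1) = (\<Sum>m\<in>UNIV. x $ m * A $ m $ j)" for x and A :: "real ^ 'd ^ 'd" and j
      by (simp add: inner_vec_def matrix_vector_mult_def axis_def if_distrib cong: if_cong)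
    fix i j k
    have "pd k (\<lambda>z. g z $ i $ j) y = frechet_derivative g (at y) (axis k 1) $ i $ j"
      using smooth_on_imp_differentiable[OF smooth_on_component[OF open_dom M.smooth] y, of i]
      by (simp add: frechet_derivative_nth dg pd_def)
    also have "\<dots> = axis i 1 \<bullet> (frechet_derivative g (at y) (axis k 1) *v axis j 1)"
      unfolding ax by (simp add: axis_def[of i] if_distrib[where f = "\<lambda>c. c * z" for z] cong: if_cong)
    finally show "pd k (\<lambda>z. g z $ i $ j) y = (\<Sum>m\<in>UNIV. P (axis i 1) (axis k 1) $ m * g y $ m $ j)
        + (\<Sum>m\<in>UNIV. P (axis j 1) (axis k 1) $ m * g y $ i $ m)"
      unfolding compat unfolding ax by (simp add: M.g_sym[OF y, of i])
  qed
  then have base: "app3 (Gam g y) (axis j 1) (axis k 1) = P (axis j 1) (axis k 1)" for j k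
    by (simp add: vec_eq_iff app3_axis Gam_def)
  have lin: "linear (\<lambda>u. P u v)" "linear (\<lambda>v. P u v)" for u v
    by (auto intro!: linearI simp: P_def app3_add app3_scale linear_add[OF linear_D2(1)[OF y]]
        linear_cmul[OF linear_D2(1)[OF y]] linear_add[OF linear_D2(2)] linear_cmul[OF linear_D2(2)]
        matrix_vector_right_distrib matrix_vector_mult_scaleR algebra_simps)
  have "app3 (Gam g y) (axis j 1) v = P (axis j 1) v" for j v
    by (subst linear_axis_expand[OF linear_app3(3)], subst linear_axis_expand[OF lin(2)]) (simp only: base)
  then have "app3 (Gam g y) u v = P u v" for u v
    by (subst linear_axis_expand[OF linear_app3(2)], subst linear_axis_expand[OF lin(1)]) simp
  then show ?thesis by (simp add: JP)
qed

text \<open>Differentiate \<open>Gam_law\<close> in the direction \<open>w\<close> and antisymmetrise in \<open>v\<close> and \<open>w\<close>: the third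
  derivatives of \<open>\<phi>\<close> cancel.\<close>

lemma Rm_law:
  assumes y: "y \<in> S"
  shows "jac \<phi> y *v Rm g y u v w = Rm g' (\<phi> y) (jac \<phi> y *v u) (jac \<phi> y *v v) (jac \<phi> y *v w)"
proof -
  let ?J = "\<lambda>u. jac \<phi> y *v u" and ?G = "app3 (Gam g y)" and ?G' = "app3 (Gam g' (\<phi> y))"
  note dG = M.differentiable_Gam[OF y] and dG' = M'.differentiable_Gam[OF maps[OF y]]
  have d: "D2 y (?G u v) w + ?J (app3 (frechet_derivative (Gam g) (at y) w) u v) =
      app3 (frechet_derivative (Gam g') (at (\<phi> y)) (?J w)) (?J u) (?J v)
      + ?G' (D2 y u w) (?J v) + ?G' (?J u) (D2 y v w)
      + frechet_derivative (\<lambda>z. D2 z u v) (at y) w" for v w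
  proof -
    have "frechet_derivative (\<lambda>z. jac \<phi> z *v app3 (Gam g z) u v) (at y) w =
        frechet_derivative (\<lambda>z. app3 (Gam g' (\<phi> z)) (jac \<phi> z *v u) (jac \<phi> z *v v) + D2 z u v) (at y) w"
      by (rule fun_cong[OF frechet_derivative_cong_open[OF open_dom y Gam_law]])
    moreover have "frechet_derivative (\<lambda>z. jac \<phi> z *v app3 (Gam g z) u v) (at y) w =
        D2 y (?G u v) w + ?J (app3 (frechet_derivative (Gam g) (at y) w) u v)"
      using frechet_derivative_jac_mult[OF y differentiable_app3[OF dG differentiable_const differentiable_const]]
        frechet_derivative_app3[OF dG differentiable_const differentiable_const]
      by (simp add: linear_0[OF linear_app3(2)] linear_0[OF linear_app3(3)])
    moreover note frechet_derivative_add[OF differentiable_app3[OF differentiable_compose_trans[OF y dG']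
            differentiable_jac_const[OF y] differentiable_jac_const[OF y]]
          smooth_on_imp_differentiable[OF smooth_D2 y], of u v u v w]
      frechet_derivative_app3[OF differentiable_compose_trans[OF y dG']
            differentiable_jac_const[OF y] differentiable_jac_const[OF y], of u v w]
    ultimately show ?thesis
      by (simp add: compose_derivative[OF y dG'] frechet_derivative_jac_const[OF y])
  qed
  \<comment> \<open>The law for the Christoffel symbols is used twice to trade a second derivative
    in a Christoffel direction for quadratic terms.\<close>
  have c: "D2 y (?G u v) w = ?J (?G (?G u v) w) - ?G' (?G' (?J u) (?J v)) (?J w) - ?G' (D2 y u v) (?J w)" for v w
    using Gam_law[OF y, of "?G u v" w] Gam_law[OF y, of u v] by (simp add: app3_add algebra_simps)
  \<comment> \<open>After this substitution the terms with one second derivative of \<phi> are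
    symmetric in \<open>v\<close> and \<open>w\<close>, so they cancel too.\<close>
  show ?thesis
    using d[of v w] d[of w v] c[of v w] c[of w v] D3_sym[OF y, of u v w] D2_sym[OF y, of v w]
    unfolding Rm_def by (simp add: matrix_vector_right_distrib matrix_vector_mult_diff_distrib algebra_simps)
qed

end

section \<open>Covariant derivatives of the curl and raising of an index\<close>

definition curl_tensor :: "((real ^ 'p) \<times> (real ^ 'n::finite) \<Rightarrow> real ^ 'n ^ 'p::finite) \<Rightarrow> real ^ 'p \<Rightarrow> real ^ 'n \<Rightarrow>
    real ^ 'n ^ 'n ^ 'p" where
  "curl_tensor U t x = (\<chi> \<gamma> i j. curlU U \<gamma> i j t x)"

text \<open>The temporal and the spatial covariant derivative of the curl of \<open>U\<close>, the direction being \<open>a\<close>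
  and \<open>w\<close> respectively. Only the upper temporal index of the curl is differentiated covariantly in
  the first one, as \<open>G\<^sup>k\<^sub>j\<^sub>\<gamma> = 0\<close>.\<close>

definition cov_T :: "(real ^ 'p \<Rightarrow> real ^ 'p ^ 'p::finite) \<Rightarrow>
    ((real ^ 'p) \<times> (real ^ 'n::finite) \<Rightarrow> real ^ 'n ^ 'p) \<Rightarrow> real ^ 'p \<Rightarrow> real ^ 'n \<Rightarrow>
    real ^ 'p \<Rightarrow> real ^ 'n \<Rightarrow> real ^ 'n \<Rightarrow> real ^ 'p" where
  "cov_T h U t x a y z = app3 (Gam h t) a (app3 (curl_tensor U t x) y z)
     + app3 (frechet_derivative (\<lambda>s. curl_tensor U s x) (at t) a) y z"

definition cov_X :: "(real ^ 'n \<Rightarrow> real ^ 'n ^ 'n::finite) \<Rightarrow>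
    ((real ^ 'p::finite) \<times> (real ^ 'n) \<Rightarrow> real ^ 'n ^ 'p) \<Rightarrow> real ^ 'p \<Rightarrow> real ^ 'n \<Rightarrow>
    real ^ 'n \<Rightarrow> real ^ 'n \<Rightarrow> real ^ 'n \<Rightarrow> real ^ 'p" where
  "cov_X g U t x y z w = app3 (frechet_derivative (curl_tensor U t) (at x) w) y z
     - app3 (curl_tensor U t x) (app3 (Gam g x) y w) z - app3 (curl_tensor U t x) y (app3 (Gam g x) z w)"

text \<open>For linear \<open>f\<close> this is the vector that represents \<open>f\<close> with
  respect to the metric \<open>G\<close>.\<close>

definition raise :: "real ^ 'n ^ 'n \<Rightarrow> (real ^ 'n \<Rightarrow> real) \<Rightarrow> real ^ 'n::finite" where
  "raise G f = matrix_inv G *v (\<chi> k. f (axis k 1))"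

lemma raise_nth: "raise G f $ m = (\<Sum>k\<in>UNIV. matrix_inv G $ m $ k * f (axis k 1))"
  by (simp add: raise_def matrix_vector_mult_def)

lemma linear_raise:
  assumes "\<And>y. linear (\<lambda>u. f u y)"
  shows "linear (\<lambda>u. raise G (f u))"
  by (rule linearI) (simp_all add: vec_eq_iff raise_nth linear_add[OF assms] linear_cmul[OF assms]
      distrib_left sum.distrib sum_distrib_left mult_ac)

lemma linear_inner_mult: "linear (\<lambda>y. c * (u \<bullet> (A *v f y)))" if "linear f" for A :: "real ^ 'm ^ 'm" and f :: "'a::real_vector \<Rightarrow> real ^ 'm"
  by (rule linearI) (simp_all add: linear_add[OF that] linear_cmul[OF that] matrix_vector_right_distrib
      inner_add_right distrib_left matrix_vector_mult_scaleR)

lemma linear_inner_mult_left: "linear (\<lambda>u. c * (u \<bullet> w))"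
  by (rule linearI) (simp_all add: inner_add_left distrib_left)

text \<open>The bridge from index-free laws to indices: with \<open>M\<close> an inverse Jacobian
  and \<open>p\<close>, \<open>q\<close>, \<open>r\<close> columns of Jacobians, the right-hand side
  is the sum required of a d-tensor.\<close>

lemma trilinear_component_sum:
  fixes f :: "real ^ 'a \<Rightarrow> real ^ 'b \<Rightarrow> real ^ 'c \<Rightarrow> real ^ 'd" and M :: "real ^ 'd ^ 'e"
  assumes "\<And>v w. linear (\<lambda>u. f u v w)" "\<And>u w. linear (\<lambda>v. f u v w)" "\<And>u v. linear (\<lambda>w. f u v w)"
  shows "(M *v f p q r) $ m = (\<Sum>l\<in>UNIV. \<Sum>i\<in>UNIV. \<Sum>j\<in>UNIV. \<Sum>k\<in>UNIV.
    M $ m $ l * p $ i * q $ j * r $ k * f (axis i 1) (axis j 1) (axis k 1) $ l)"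
proof -
  have 1: "f (axis i 1) (axis j 1) r = (\<Sum>k\<in>UNIV. r $ k *\<^sub>R f (axis i 1) (axis j 1) (axis k 1))" for i j
    by (rule linear_axis_expand[OF assms(3)])
  have 2: "f (axis i 1) q r = (\<Sum>j\<in>UNIV. q $ j *\<^sub>R f (axis i 1) (axis j 1) r)" for i
    by (rule linear_axis_expand[OF assms(2)])
  have 3: "f p q r = (\<Sum>i\<in>UNIV. p $ i *\<^sub>R f (axis i 1) q r)"
    by (rule linear_axis_expand[OF assms(1)])
  show ?thesis
    unfolding 3 2 1 by (simp add: matrix_vector_mult_def sum_distrib_left mult.assoc)
qed

context metric_chart
begin

lemma raise_inner:
  assumes "y \<in> S" "linear f"
  shows "raise (g y) f \<bullet> (g y *v w) = f w"
proof -
  have "g y *v raise (g y) f = (\<chi> k. f (axis k 1))"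
    by (simp add: raise_def matrix_vector_mul_assoc matrix_inv_left_right inv[OF assms(1)])
  then have "raise (g y) f \<bullet> (g y *v w) = w \<bullet> (\<chi> k. f (axis k 1))"
    by (simp add: inner_sym[OF assms(1), of "raise (g y) f"])
  also have "\<dots> = f w"
    by (subst linear_axis_expand[OF assms(2), of w]) (simp add: inner_vec_def)
  finally show ?thesis .
qed

end

context metric_transition
begin

text \<open>Representing vectors are determined by their products with all vectors, and each vector
  of the new chart is a Jacobian image; thus the metric law suffices and no law for the inverse
  metric enters.\<close>

lemma raise_law:
  assumes y: "y \<in> S" and "linear f" "linear f'" and f: "\<And>w. f' (jac \<phi> y *v w) = f w"
  shows "jac \<phi> y *v raise (g y) f = raise (g' (\<phi> y)) f'"
proof (rule M'.nondegenerate[OF maps[OF y]])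
  fix w
  define z where "z = jac \<psi> (\<phi> y) *v w"
  have w: "w = jac \<phi> y *v z" unfolding z_def by (rule jac_right[OF y, symmetric])
  show "(jac \<phi> y *v raise (g y) f) \<bullet> (g' (\<phi> y) *v w) = raise (g' (\<phi> y)) f' \<bullet> (g' (\<phi> y) *v w)"
    unfolding M'.raise_inner[OF maps[OF y] assms(3)]
    unfolding w metric_law[OF y, symmetric] M.raise_inner[OF y assms(2)] f ..
qed

end

context edml_chart
begin

lemma smooth_curl_tensor: "smooth_on (A \<times> B) (\<lambda>p. curl_tensor U (fst p) (snd p))"
  unfolding curl_tensor_def by (intro smooth_on_vec open_base smooth_curlU)

lemma differentiable_slice:
  assumes "smooth_on (A \<times> B) f" "t \<in> A" "x \<in> B"
  shows "(\<lambda>s. f (s, x)) differentiable (at t)" "(\<lambda>y. f (t, y)) differentiable (at x)"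
proof -
  have d: "f differentiable (at (t, x))"
    using smooth_on_imp_differentiable[OF assms(1)] assms by simp
  have "((\<lambda>s. (s, x)) has_derivative (\<lambda>a. (a, 0))) (at t)"
    and "((\<lambda>y. (t, y)) has_derivative (\<lambda>b. (0, b))) (at x)"
    by (auto intro!: derivative_eq_intros)
  then show "(\<lambda>s. f (s, x)) differentiable (at t)" "(\<lambda>y. f (t, y)) differentiable (at x)"
    using d has_derivative_compose[where g = f and f = "\<lambda>s. (s, x)"]
      has_derivative_compose[where g = f and f = "\<lambda>y. (t, y)"]
    unfolding differentiable_def by blast+
qed

lemma differentiable_curl_tensor:
  assumes "t \<in> A" "x \<in> B"
  shows "(\<lambda>s. curl_tensor U s x) differentiable (at t)" "curl_tensor U t differentiable (at x)"
  using differentiable_slice[OF smooth_curl_tensor assms] by simp_all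

lemma differentiable_U_slice: "t \<in> A \<Longrightarrow> x \<in> B \<Longrightarrow> (\<lambda>y. U (t, y)) differentiable (at x)"
  by (rule differentiable_slice(2)[OF smooth_U])

lemma frechet_curl_tensor_nth:
  assumes "t \<in> A" "x \<in> B"
  shows "frechet_derivative (\<lambda>s. curl_tensor U s x) (at t) a $ \<eta> $ k $ j =
      frechet_derivative (\<lambda>s. curlU U \<eta> k j s x) (at t) a"
    and "frechet_derivative (curl_tensor U t) (at x) b $ \<eta> $ k $ j =
      frechet_derivative (\<lambda>y. curlU U \<eta> k j t y) (at x) b"
proof -
  have s1: "smooth_on (A \<times> B) (\<lambda>p. curl_tensor U (fst p) (snd p) $ \<eta>)"
    and s2: "smooth_on (A \<times> B) (\<lambda>p. curl_tensor U (fst p) (snd p) $ \<eta> $ k)"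
    by (intro smooth_on_component smooth_curl_tensor open_base)+
  note d = differentiable_curl_tensor[OF assms] differentiable_slice[OF s1 assms, simplified]
    differentiable_slice[OF s2 assms, simplified]
  show "frechet_derivative (\<lambda>s. curl_tensor U s x) (at t) a $ \<eta> $ k $ j =
      frechet_derivative (\<lambda>s. curlU U \<eta> k j s x) (at t) a"
    using d by (simp add: frechet_derivative_nth) (simp add: curl_tensor_def)
  show "frechet_derivative (curl_tensor U t) (at x) b $ \<eta> $ k $ j =
      frechet_derivative (\<lambda>y. curlU U \<eta> k j t y) (at x) b"
    using d by (simp add: frechet_derivative_nth) (simp add: curl_tensor_def)
qed

lemma cov_T_axis:
  assumes "t \<in> A" "x \<in> B"
  shows "cov_T h U t x (axis \<alpha> 1) (axis k 1) (axis j 1) $ \<eta> =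
    (\<Sum>\<gamma>\<in>UNIV. christoffel h \<eta> \<alpha> \<gamma> t * curlU U \<gamma> k j t x) + pd \<alpha> (\<lambda>s. curlU U \<eta> k j s x) t"
proof -
  have "app3 (Gam h t) (axis \<alpha> 1) w $ \<eta> = (\<Sum>\<gamma>\<in>UNIV. christoffel h \<eta> \<alpha> \<gamma> t * w $ \<gamma>)" for w
    by (simp add: app3_nth Gam_def axis_def if_distrib cong: if_cong)
  then show ?thesis
    by (simp add: cov_T_def app3_axis frechet_curl_tensor_nth[OF assms] pd_def) (simp add: app3_axis curl_tensor_def)
qed

lemma cov_X_axis:
  assumes "t \<in> A" "x \<in> B" and L: "\<And>i j k. Lc (t, x, v) i j k = christoffel g i j k x"
  shows "cov_X g U t x (axis k 1) (axis i 1) (axis j 1) $ \<eta> = hcovU h g U Lc \<eta> k i j (t, x, v)"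
proof -
  have 1: "app3 (curl_tensor U t x) w (axis i 1) $ \<eta> = (\<Sum>m\<in>UNIV. w $ m * curlU U \<eta> m i t x)"
    and 2: "app3 (curl_tensor U t x) (axis k 1) w $ \<eta> = (\<Sum>m\<in>UNIV. w $ m * curlU U \<eta> k m t x)" for w
    by (simp_all add: app3_nth curl_tensor_def axis_def if_distrib mult.commute cong: if_cong)
  have "frechet_derivative (K \<eta> k i) (at (t, x, v)) (e (Xix j) (t, x, v)) =
      frechet_derivative (\<lambda>y. curlU U \<eta> k i t y) (at x) (axis j 1)"
    using frechet_derivative_section(2)[OF differentiable_curlU[OF assms(1,2)], of \<eta> k i "axis j 1"]
    by (simp add: frechet_K[OF assms(1,2)])
  then show ?thesis
    unfolding cov_X_def hcovU_def Let_def L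
    by (simp add: 1 2 app3_axis frechet_curl_tensor_nth[OF assms(1,2)] jet_curl_def[abs_def] del: adapted.simps)
      (simp add: app3_axis Gam_def)
qed

text \<open>Up to sign the exterior derivative of \<open>U(t, _)\<close>, regarded as a one-form on
  the spatial chart with values in temporal vectors. In this form the law for \<open>U\<close> can
  be differentiated as a whole.\<close>

lemma curl_tensor_eq:
  assumes "t \<in> A" "x \<in> B"
  shows "app3 (curl_tensor U t x) y z = frechet_derivative (\<lambda>x. U (t, x)) (at x) z *v y
    - frechet_derivative (\<lambda>x. U (t, x)) (at x) y *v z"
proof -
  let ?D = "frechet_derivative (\<lambda>x. U (t, x)) (at x)"
  let ?r = "\<lambda>y z. ?D z *v y - ?D y *v z"
  have d: "(\<lambda>x. U (t, x)) differentiable (at x)" by (rule differentiable_U_slice[OF assms])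
  have l: "linear ?D" by (rule linear_frechet_derivative[OF d])
  have "(\<lambda>x. U (t, x) $ \<gamma>) differentiable (at x)" for \<gamma>
    by (rule differentiable_bounded_linear_compose[OF bounded_linear_vec_nth d])
  then have "?D w $ \<gamma> $ i = frechet_derivative (\<lambda>y. U (t, y) $ \<gamma> $ i) (at x) w" for \<gamma> i w
    using d by (simp add: frechet_derivative_nth)
  then have base: "app3 (curl_tensor U t x) (axis i 1) (axis j 1) = ?r (axis i 1) (axis j 1)" for i j
    by (simp add: vec_eq_iff app3_axis curl_tensor_def curlU_def pd_def matrix_vector_mult_basis column_def)
  have lin: "linear (\<lambda>y. ?r y z)" "linear (\<lambda>z. ?r y z)" for y z
    by (auto intro!: linearI simp: linear_add[OF l] linear_cmul[OF l] matrix_vector_right_distrib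
        matrix_vector_mult_add_rdistrib scaleR_matrix_vector_assoc[symmetric] matrix_vector_mult_scaleR
        algebra_simps)
  have 1: "app3 (curl_tensor U t x) (axis i 1) z = ?r (axis i 1) z" for i
    by (subst linear_axis_expand[OF linear_app3(3)], subst linear_axis_expand[OF lin(2)]) (simp only: base)
  show ?thesis
    by (subst linear_axis_expand[OF linear_app3(2)], subst linear_axis_expand[OF lin(1)]) (simp only: 1)
qed

lemma linear_cov_T:
  assumes "t \<in> A" "x \<in> B"
  shows "linear (\<lambda>a. cov_T h U t x a y z)" "linear (\<lambda>y. cov_T h U t x a y z)" "linear (\<lambda>z. cov_T h U t x a y z)"
proof -
  have l: "linear (frechet_derivative (\<lambda>s. curl_tensor U s x) (at t))"
    by (rule linear_frechet_derivative[OF differentiable_curl_tensor(1)[OF assms]])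
  show "linear (\<lambda>a. cov_T h U t x a y z)" "linear (\<lambda>y. cov_T h U t x a y z)" "linear (\<lambda>z. cov_T h U t x a y z)"
    by (auto intro!: linearI simp: cov_T_def app3_add app3_scale linear_add[OF l] linear_cmul[OF l] algebra_simps)
qed

lemma linear_cov_X:
  assumes "t \<in> A" "x \<in> B"
  shows "linear (\<lambda>y. cov_X g U t x y z w)" "linear (\<lambda>z. cov_X g U t x y z w)" "linear (\<lambda>w. cov_X g U t x y z w)"
proof -
  have l: "linear (frechet_derivative (curl_tensor U t) (at x))"
    by (rule linear_frechet_derivative[OF differentiable_curl_tensor(2)[OF assms]])
  show "linear (\<lambda>y. cov_X g U t x y z w)" "linear (\<lambda>z. cov_X g U t x y z w)" "linear (\<lambda>w. cov_X g U t x y z w)"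
    by (auto intro!: linearI simp: cov_X_def app3_add app3_scale linear_add[OF l] linear_cmul[OF l] algebra_simps)
qed

end

text \<open>The vertical parts of the torsion on pairs of horizontal vectors, read as linear maps in the
  temporal vector \<open>u\<close> that is paired with the lower index \<open>\<mu>\<close> of the vertical component.\<close>

definition torTT where
  "torTT h t v u a b = - (v *v Rm h t u a b)"

definition torTX where
  "torTX h g U t x u a z = raise (g x) (\<lambda>y. (- 1 / 4) * (u \<bullet> (h t *v cov_T h U t x a y z)))"

definition torXX where
  "torXX h g U t x v u y z = Rm g x (v *v u) y z
    + raise (g x) (\<lambda>w. (1 / 4) * (u \<bullet> (h t *v (cov_X g U t x w y z - cov_X g U t x w z y))))"

context edml_chart
begin

lemma linear_torTT:
  fixes v :: "real ^ 'p ^ 'n"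
  assumes "t \<in> A"
  shows "linear (\<lambda>u. torTT h t v u a b)" "linear (\<lambda>a. torTT h t v u a b)" "linear (\<lambda>b. torTT h t v u a b)"
  unfolding torTT_def
  by (intro linear_compose_neg linear_compose[OF T.linear_Rm(1)[OF assms] matrix_vector_mul_linear, unfolded comp_def]
      linear_compose[OF T.linear_Rm(2)[OF assms] matrix_vector_mul_linear, unfolded comp_def]
      linear_compose[OF T.linear_Rm(3)[OF assms] matrix_vector_mul_linear, unfolded comp_def])+

lemma linear_torTX:
  assumes "t \<in> A" "x \<in> B"
  shows "linear (\<lambda>u. torTX h g U t x u a z)" "linear (\<lambda>a. torTX h g U t x u a z)"
    "linear (\<lambda>z. torTX h g U t x u a z)"
  unfolding torTX_def
  by (intro linear_raise linear_inner_mult linear_inner_mult_left linear_cov_T assms)+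

lemma linear_torXX:
  fixes v :: "real ^ 'p ^ 'n"
  assumes "t \<in> A" "x \<in> B"
  shows "linear (\<lambda>u. torXX h g U t x v u y z)" "linear (\<lambda>y. torXX h g U t x v u y z)"
    "linear (\<lambda>z. torXX h g U t x v u y z)"
proof -
  have "linear (\<lambda>u. Rm g x (v *v u) y z)"
    by (rule linear_compose[OF matrix_vector_mul_linear M.linear_Rm(1)[OF assms(2)], unfolded comp_def])
  then show "linear (\<lambda>u. torXX h g U t x v u y z)" "linear (\<lambda>y. torXX h g U t x v u y z)"
    "linear (\<lambda>z. torXX h g U t x v u y z)"
    unfolding torXX_def
    by (intro linear_compose_add linear_raise linear_inner_mult linear_inner_mult_left
        linear_compose_sub linear_cov_X M.linear_Rm assms; assumption)+
qed

end

context edml_connection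
begin

lemma torsion_TT_axis:
  assumes "t \<in> A" "x \<in> B"
  shows "torsion_comp h g U nab (t, x, v) (Vix m \<mu>) (Tix \<alpha>) (Tix \<beta>) =
    torTT h t v (axis \<mu> 1) (axis \<alpha> 1) (axis \<beta> 1) $ m"
  by (simp add: torsion_TT[OF assms] torTT_def matrix_vector_mult_def T.Rm_axis[OF assms(1)] mult.commute)

lemma inner_axis_matrix: "axis \<mu> 1 \<bullet> (G *v w) = (\<Sum>\<eta>\<in>UNIV. G $ \<mu> $ \<eta> * w $ \<eta>)" for G :: "real ^ 'p ^ 'p"
  by (simp add: inner_axis' matrix_vector_mult_def)

lemma torsion_TX_axis:
  assumes "t \<in> A" "x \<in> B"
  shows "torsion_comp h g U nab (t, x, v) (Vix m \<mu>) (Tix \<alpha>) (Xix j) =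
    torTX h g U t x (axis \<mu> 1) (axis \<alpha> 1) (axis j 1) $ m"
  unfolding torsion_TX[OF assms] torTX_def raise_nth inner_axis_matrix cov_T_axis[OF assms, symmetric]
    sum_distrib_left
  by (subst sum.swap) (simp add: sum_negf[symmetric] mult_ac)

lemma torsion_XX_axis:
  assumes "t \<in> A" "x \<in> B"
  shows "torsion_comp h g U nab (t, x, v) (Vix m \<mu>) (Xix i) (Xix j) =
    torXX h g U t x v (axis \<mu> 1) (axis i 1) (axis j 1) $ m"
proof -
  have "Rm g x (v *v axis \<mu> 1) (axis i 1) (axis j 1) $ m = (\<Sum>k\<in>UNIV. riemann g m k i j x * v $ k $ \<mu>)"
    by (subst linear_axis_expand[OF M.linear_Rm(1)[OF assms(2)]])
      (simp add: M.Rm_axis[OF assms(2)] matrix_vector_mult_basis column_def mult.commute)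
  then show ?thesis
    unfolding torsion_XX[OF assms] torXX_def raise_nth vector_add_component inner_axis_matrix
      cov_X_axis[of t x Lc v, OF assms coefficients(3)[OF assms], symmetric] vector_minus_component sum_distrib_left
    by (subst sum.swap) (simp add: mult_ac)
qed

end

section \<open>Transformation laws of the curl, its covariant derivatives and the torsion\<close>

locale edml_transition = tt: metric_transition S S' \<phi> \<phi>' h h' + xx: metric_transition R R' \<xi> \<xi>' g g'
    + E: edml_chart S h R g U + E': edml_chart S' h' R' g' U'
  for S S' :: "(real ^ 'p::finite) set" and \<phi> \<phi>' h h' and R R' :: "(real ^ 'n::finite) set" and \<xi> \<xi>' g g'
    and U U' +
  assumes U_law: "t \<in> S \<Longrightarrow> x \<in> R \<Longrightarrow> jac \<phi> t *v (U (t, x) *v y) = U' (\<phi> t, \<xi> x) *v (jac \<xi> x *v y)"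
begin

text \<open>Differentiating the law for \<open>U\<close> leaves one term with the second derivative
  of \<xi>; it is symmetric in \<open>y\<close> and \<open>z\<close> and vanishes in the
  curl.\<close>

lemma curl_law:
  assumes t: "t \<in> S" and x: "x \<in> R"
  shows "jac \<phi> t *v app3 (curl_tensor U t x) y z = app3 (curl_tensor U' (\<phi> t) (\<xi> x)) (jac \<xi> x *v y) (jac \<xi> x *v z)"
proof -
  note mv = bounded_bilinear_matrix_vector
  let ?J = "\<lambda>u. jac \<xi> x *v u"
  let ?D = "frechet_derivative (\<lambda>x. U (t, x)) (at x)"
    and ?D' = "frechet_derivative (\<lambda>x. U' (\<phi> t, x)) (at (\<xi> x))"
  have d: "(\<lambda>x. U (t, x)) differentiable (at x)" "(\<lambda>x. U' (\<phi> t, x)) differentiable (at (\<xi> x))"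
    using E.differentiable_U_slice E'.differentiable_U_slice t x tt.maps xx.maps by auto
  have "jac \<phi> t *v (?D z *v y) = ?D' (?J z) *v ?J y + U' (\<phi> t, \<xi> x) *v xx.D2 x y z" for y z
  proof -
    have "frechet_derivative (\<lambda>x. jac \<phi> t *v (U (t, x) *v y)) (at x) z =
        frechet_derivative (\<lambda>x. U' (\<phi> t, \<xi> x) *v (jac \<xi> x *v y)) (at x) z"
      by (rule fun_cong[OF frechet_derivative_cong_open[OF xx.open_dom x U_law[OF t]]])
    moreover have "frechet_derivative (\<lambda>x. jac \<phi> t *v (U (t, x) *v y)) (at x) z = jac \<phi> t *v (?D z *v y)"
      using frechet_derivative_bounded_linear_compose[OF matrix_vector_mul_bounded_linear
          differentiable_bilinear[OF mv d(1) differentiable_const], of "jac \<phi> t" y z]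
        frechet_derivative_bilinear[OF mv d(1) differentiable_const, of y z]
      by (simp add: matrix_vector_mult_0_right)
    moreover have "frechet_derivative (\<lambda>x. U' (\<phi> t, \<xi> x) *v (jac \<xi> x *v y)) (at x) z =
        ?D' (?J z) *v ?J y + U' (\<phi> t, \<xi> x) *v xx.D2 x y z"
      using frechet_derivative_bilinear[OF mv xx.differentiable_compose_trans[OF x d(2)] xx.differentiable_jac_const[OF x]]
      by (simp add: xx.compose_derivative[OF x d(2)] xx.frechet_derivative_jac_const[OF x])
    ultimately show ?thesis by simp
  qed
  then show ?thesis
    unfolding E.curl_tensor_eq[OF t x] E'.curl_tensor_eq[OF tt.maps[OF t] xx.maps[OF x]]
    by (simp add: matrix_vector_mult_diff_distrib xx.D2_sym[OF x, of y z])
qed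

text \<open>The time derivative of the law for the curl meets only the temporal Jacobian, and the
  resulting second derivative of \<phi> is the inhomogeneous term of the law for \<open>h\<close>.
  The spatial Jacobian is constant in time, so the spatial slots need no correction.\<close>

lemma cov_T_law:
  assumes t: "t \<in> S" and x: "x \<in> R"
  shows "jac \<phi> t *v cov_T h U t x a y z =
    cov_T h' U' (\<phi> t) (\<xi> x) (jac \<phi> t *v a) (jac \<xi> x *v y) (jac \<xi> x *v z)"
proof -
  note d = E.differentiable_curl_tensor(1)[OF t x] E'.differentiable_curl_tensor(1)[OF tt.maps[OF t] xx.maps[OF x]]
  have "frechet_derivative (\<lambda>s. jac \<phi> s *v app3 (curl_tensor U s x) y z) (at t) a =
      frechet_derivative (\<lambda>s. app3 (curl_tensor U' (\<phi> s) (\<xi> x)) (jac \<xi> x *v y) (jac \<xi> x *v z)) (at t) a"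
    by (rule fun_cong[OF frechet_derivative_cong_open[OF tt.open_dom t curl_law[OF _ x]]])
  moreover have "frechet_derivative (\<lambda>s. jac \<phi> s *v app3 (curl_tensor U s x) y z) (at t) a =
      jac \<phi> t *v app3 (frechet_derivative (\<lambda>s. curl_tensor U s x) (at t) a) y z + tt.D2 t (app3 (curl_tensor U t x) y z) a"
    using tt.frechet_derivative_jac_mult[OF t differentiable_app3[OF d(1) differentiable_const differentiable_const]]
      frechet_derivative_app3[OF d(1) differentiable_const differentiable_const]
    by (simp add: linear_0[OF linear_app3(2)] linear_0[OF linear_app3(3)])
  moreover have "frechet_derivative (\<lambda>s. app3 (curl_tensor U' (\<phi> s) (\<xi> x)) (jac \<xi> x *v y) (jac \<xi> x *v z)) (at t) a =
      app3 (frechet_derivative (\<lambda>s. curl_tensor U' s (\<xi> x)) (at (\<phi> t)) (jac \<phi> t *v a)) (jac \<xi> x *v y) (jac \<xi> x *v z)"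
    using frechet_derivative_app3[OF tt.differentiable_compose_trans[OF t d(2)] differentiable_const differentiable_const]
      tt.compose_derivative[OF t d(2)]
    by (simp add: linear_0[OF linear_app3(2)] linear_0[OF linear_app3(3)])
  ultimately show ?thesis
    unfolding cov_T_def
    by (simp add: matrix_vector_right_distrib tt.Gam_law[OF t] curl_law[OF t x] tt.D2_sym[OF t, of a] add.commute)
qed

text \<open>Here the temporal Jacobian is constant, and the second derivatives of \<xi> in the two
  spatial slots are absorbed by the two connection terms.\<close>

lemma cov_X_law:
  assumes t: "t \<in> S" and x: "x \<in> R"
  shows "jac \<phi> t *v cov_X g U t x y z w =
    cov_X g' U' (\<phi> t) (\<xi> x) (jac \<xi> x *v y) (jac \<xi> x *v z) (jac \<xi> x *v w)"
proof -
  let ?J = "\<lambda>u. jac \<xi> x *v u" and ?K' = "app3 (curl_tensor U' (\<phi> t) (\<xi> x))"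
  note d = E.differentiable_curl_tensor(2)[OF t x] E'.differentiable_curl_tensor(2)[OF tt.maps[OF t] xx.maps[OF x]]
  have "frechet_derivative (\<lambda>x. jac \<phi> t *v app3 (curl_tensor U t x) y z) (at x) w =
      frechet_derivative (\<lambda>x. app3 (curl_tensor U' (\<phi> t) (\<xi> x)) (jac \<xi> x *v y) (jac \<xi> x *v z)) (at x) w"
    by (rule fun_cong[OF frechet_derivative_cong_open[OF xx.open_dom x curl_law[OF t]]])
  moreover have "frechet_derivative (\<lambda>x. jac \<phi> t *v app3 (curl_tensor U t x) y z) (at x) w =
      jac \<phi> t *v app3 (frechet_derivative (curl_tensor U t) (at x) w) y z"
    using frechet_derivative_bounded_linear_compose[OF matrix_vector_mul_bounded_linear
        differentiable_app3[OF d(1) differentiable_const differentiable_const]]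
      frechet_derivative_app3[OF d(1) differentiable_const differentiable_const]
    by (simp add: linear_0[OF linear_app3(2)] linear_0[OF linear_app3(3)])
  moreover have "frechet_derivative (\<lambda>x. app3 (curl_tensor U' (\<phi> t) (\<xi> x)) (jac \<xi> x *v y) (jac \<xi> x *v z)) (at x) w =
      app3 (frechet_derivative (curl_tensor U' (\<phi> t)) (at (\<xi> x)) (?J w)) (?J y) (?J z)
      + ?K' (xx.D2 x y w) (?J z) + ?K' (?J y) (xx.D2 x z w)"
    using frechet_derivative_app3[OF xx.differentiable_compose_trans[OF x d(2)] xx.differentiable_jac_const[OF x]
        xx.differentiable_jac_const[OF x]]
    by (simp add: xx.compose_derivative[OF x d(2)] xx.frechet_derivative_jac_const[OF x])
  ultimately show ?thesis
    unfolding cov_X_def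
    by (simp add: matrix_vector_mult_diff_distrib xx.Gam_law[OF x] curl_law[OF t x] app3_add)
qed

text \<open>The velocity is a linear map from temporal to spatial vectors; the assumption on
  \<open>v'\<close> says that the two velocities are intertwined by the Jacobians.\<close>

lemma torTT_law:
  assumes t: "t \<in> S" and v: "\<And>u. v' *v (jac \<phi> t *v u) = jac \<xi> x *v (v *v u)"
  shows "jac \<xi> x *v torTT h t v u a b =
    torTT h' (\<phi> t) v' (jac \<phi> t *v u) (jac \<phi> t *v a) (jac \<phi> t *v b)"
  unfolding torTT_def tt.Rm_law[OF t, symmetric] v by (simp add: linear_neg[OF matrix_vector_mul_linear])

lemma torTX_law:
  assumes t: "t \<in> S" and x: "x \<in> R"
  shows "jac \<xi> x *v torTX h g U t x u a z =
    torTX h' g' U' (\<phi> t) (\<xi> x) (jac \<phi> t *v u) (jac \<phi> t *v a) (jac \<xi> x *v z)"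
  unfolding torTX_def
proof (rule xx.raise_law[OF x])
  fix w
  show "- 1 / 4 * ((jac \<phi> t *v u) \<bullet> (h' (\<phi> t) *v cov_T h' U' (\<phi> t) (\<xi> x) (jac \<phi> t *v a) (jac \<xi> x *v w) (jac \<xi> x *v z))) =
      - 1 / 4 * (u \<bullet> (h t *v cov_T h U t x a w z))"
    unfolding cov_T_law[OF t x, symmetric] tt.metric_law[OF t, symmetric] ..
qed (intro linear_inner_mult E.linear_cov_T E'.linear_cov_T t x tt.maps xx.maps)+

lemma torXX_law:
  assumes t: "t \<in> S" and x: "x \<in> R" and v: "\<And>u. v' *v (jac \<phi> t *v u) = jac \<xi> x *v (v *v u)"
  shows "jac \<xi> x *v torXX h g U t x v u y z =
    torXX h' g' U' (\<phi> t) (\<xi> x) v' (jac \<phi> t *v u) (jac \<xi> x *v y) (jac \<xi> x *v z)"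
proof -
  have "jac \<xi> x *v raise (g x) (\<lambda>w. (1 / 4) * (u \<bullet> (h t *v (cov_X g U t x w y z - cov_X g U t x w z y)))) =
    raise (g' (\<xi> x)) (\<lambda>w. (1 / 4) * ((jac \<phi> t *v u) \<bullet> (h' (\<phi> t) *v
      (cov_X g' U' (\<phi> t) (\<xi> x) w (jac \<xi> x *v y) (jac \<xi> x *v z) -
       cov_X g' U' (\<phi> t) (\<xi> x) w (jac \<xi> x *v z) (jac \<xi> x *v y)))))"
  proof (rule xx.raise_law[OF x])
    fix w
    show "(1 / 4) * ((jac \<phi> t *v u) \<bullet> (h' (\<phi> t) *v
      (cov_X g' U' (\<phi> t) (\<xi> x) (jac \<xi> x *v w) (jac \<xi> x *v y) (jac \<xi> x *v z) -
       cov_X g' U' (\<phi> t) (\<xi> x) (jac \<xi> x *v w) (jac \<xi> x *v z) (jac \<xi> x *v y)))) =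
      (1 / 4) * (u \<bullet> (h t *v (cov_X g U t x w y z - cov_X g U t x w z y)))"
      unfolding cov_X_law[OF t x, symmetric] matrix_vector_mult_diff_distrib[symmetric]
        tt.metric_law[OF t, symmetric] ..
  qed (intro linear_inner_mult linear_compose_sub E.linear_cov_X E'.linear_cov_X t x tt.maps xx.maps)+
  then show ?thesis
    unfolding torXX_def by (simp add: matrix_vector_right_distrib xx.Rm_law[OF x] v)
qed

end

section \<open>From atlases to transition data, in matrix form\<close>

section \<open>Changes of charts\<close>

lemma smooth_manifold_inj:
  assumes "smooth_manifold X \<A>" "c \<in> \<A>"
  shows "inj_on (snd c) (fst c)"
proof -
  have "openin X (fst c)" "homeomorphic_map (subtopology X (fst c)) (top_of_set (cimg c)) (snd c)"
    using assms unfolding smooth_manifold_def by blast+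
  then show ?thesis
    using homeomorphic_imp_injective_map openin_subset by (metis topspace_subtopology_subset)
qed

lemma open_cimg: "smooth_manifold X \<A> \<Longrightarrow> c \<in> \<A> \<Longrightarrow> open (cimg c)"
  unfolding smooth_manifold_def by blast

lemma overlap_subset: "overlap c d \<subseteq> cimg c"
  unfolding overlap_def cimg_def by blast

lemma transition_overlap:
  assumes X: "smooth_manifold X \<A>" and c: "c \<in> \<A>" "d \<in> \<A>"
  shows "transition (overlap c d) (overlap d c) (trans_map c d) (trans_map d c)"
proof -
  have opn: "open (overlap c d)" if "c \<in> \<A>" "d \<in> \<A>" for c d
  proof -
    have "openin X (fst c)" "openin X (fst d)"
      and hm: "homeomorphic_map (subtopology X (fst c)) (top_of_set (cimg c)) (snd c)"
      using X that unfolding smooth_manifold_def by blast+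
    then have "openin (subtopology X (fst c)) (fst c \<inter> fst d)"
      by (metis inf_commute openin_subtopology)
    then have "openin (top_of_set (cimg c)) (overlap c d)"
      unfolding overlap_def using homeomorphic_imp_open_map[OF hm] open_map_def by blast
    then show ?thesis using openin_open_trans open_cimg[OF X that(1)] by blast
  qed
  have tm: "trans_map c d (snd c p) = snd d p" if "c \<in> \<A>" "p \<in> fst c" for c d p
    using inv_into_f_f[OF smooth_manifold_inj[OF X that(1)] that(2)] by (simp add: trans_map_def cinv_def)
  have sm: "smooth_on (overlap c d) (trans_map c d)" if "c \<in> \<A>" "d \<in> \<A>" for c d
    using X that unfolding smooth_manifold_def by blast
  show ?thesis
    by unfold_locales (use opn sm c in \<open>auto simp: overlap_def tm\<close>)
qed

lemma dcoord_jac: "dcoord c d y i j = jac (trans_map c d) y $ i $ j"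
  by (simp add: dcoord_def jac_def matrix_def)

lemma metric_chart_cimg:
  assumes "smooth_manifold X \<A>" "semi_riemannian \<A> g" "c \<in> \<A>"
  shows "metric_chart (cimg c) (g c)"
  using assms(2,3) open_cimg[OF assms(1,3)] unfolding semi_riemannian_def by unfold_locales blast+

lemma metric_chart_subset:
  assumes "metric_chart S g" "open T" "T \<subseteq> S"
  shows "metric_chart T g"
proof -
  interpret metric_chart S g by fact
  show ?thesis by unfold_locales (use assms smooth_on_subset[OF smooth] sym inv in blast)+
qed

text \<open>In matrix form the tensor law is a congruence by the Jacobian; its transpose passes to
  the other side of the Euclidean product.\<close>

lemma metric_transition_overlap:
  assumes X: "smooth_manifold X \<A>" and g: "semi_riemannian \<A> g" and c: "c \<in> \<A>" "d \<in> \<A>"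
  shows "metric_transition (overlap c d) (overlap d c) (trans_map c d) (trans_map d c) (g c) (g d)"
proof -
  interpret transition "overlap c d" "overlap d c" "trans_map c d" "trans_map d c"
    by (rule transition_overlap[OF X c])
  interpret M: metric_chart "overlap c d" "g c"
    by (rule metric_chart_subset[OF metric_chart_cimg[OF X g c(1)] open_dom overlap_subset])
  interpret M': metric_chart "overlap d c" "g d"
    by (rule metric_chart_subset[OF metric_chart_cimg[OF X g c(2)] open_cod overlap_subset])
  show ?thesis
  proof unfold_locales
    fix y u v assume y: "y \<in> overlap c d"
    let ?J = "jac (trans_map c d) y" and ?G = "g d (trans_map c d y)"
    have "g c y $ i $ j = (transpose ?J ** ?G ** ?J) $ i $ j" for i j
    proof -
      have "g c y $ i $ j = (\<Sum>k\<in>UNIV. \<Sum>l\<in>UNIV. ?J $ k $ i * ?J $ l $ j * ?G $ k $ l)"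
        using g c y unfolding semi_riemannian_def dcoord_jac by blast
      also have "\<dots> = (\<Sum>l\<in>UNIV. (\<Sum>k\<in>UNIV. ?J $ k $ i * ?G $ k $ l) * ?J $ l $ j)"
        by (subst sum.swap) (simp add: sum_distrib_left sum_distrib_right mult_ac)
      finally show ?thesis by (simp add: matrix_matrix_mult_def transpose_def)
    qed
    then have "g c y = transpose ?J ** ?G ** ?J" by (simp add: vec_eq_iff)
    then have "u \<bullet> (g c y *v v) = u \<bullet> (transpose ?J *v (?G *v (?J *v v)))"
      by (simp add: matrix_vector_mul_assoc matrix_mul_assoc)
    also have "\<dots> = (?J *v u) \<bullet> (?G *v (?J *v v))"
      by (metis dot_lmul_matrix inner_commute transpose_matrix_vector)
    finally show "u \<bullet> (g c y *v v) = (?J *v u) \<bullet> (?G *v (?J *v v))" .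
  qed
qed

lemma edml_chart_cimg:
  assumes "edml_space XT AT XM AM h g U F L" "a \<in> AT" "b \<in> AM"
  shows "edml_chart (cimg a) (h a) (cimg b) (g b) (U a b)"
proof -
  interpret T: metric_chart "cimg a" "h a"
    using assms metric_chart_cimg unfolding edml_space_def by blast
  interpret M: metric_chart "cimg b" "g b"
    using assms metric_chart_cimg unfolding edml_space_def by blast
  show ?thesis
    by unfold_locales (use assms in \<open>auto simp: edml_space_def d_tensor_U_def\<close>)
qed

lemma edml_connection_cimg:
  assumes "edml_space XT AT XM AM h g U F L" "cartan_connection AT AM h g U nab Hc Gc Lc Cc"
    "a \<in> AT" "b \<in> AM"
  shows "edml_connection (cimg a) (h a) (cimg b) (g b) (U a b) (nab a b) (Hc a b) (Gc a b) (Lc a b) (Cc a b)"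
proof -
  interpret edml_chart "cimg a" "h a" "cimg b" "g b" "U a b"
    by (rule edml_chart_cimg[OF assms(1,3,4)])
  have "linear_connection_on (jet_dom a b) (nab a b)"
    and "h_normal_on (jet_dom a b) (h a) (g b) (U a b) (nab a b) (Hc a b) (Gc a b) (Lc a b) (Cc a b)"
    and "cartan_conditions_on (jet_dom a b) (h a) (g b) (U a b) (Gc a b) (Lc a b) (Cc a b)"
    using assms(2,3,4) unfolding cartan_connection_def linear_connection_J1_def by metis+
  then show ?thesis by unfold_locales (simp_all add: jet_dom_def)
qed

text \<open>The law for \<open>U\<close> contains the inverse temporal Jacobian. Multiplying by the
  Jacobian makes \<open>U\<close> a linear map that intertwines the spatial and the temporal change
  of coordinates.\<close>

lemma edml_transition_overlap:
  assumes sp: "edml_space XT AT XM AM h g U F L" and a: "a \<in> AT" "a' \<in> AT" and b: "b \<in> AM" "b' \<in> AM"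
  shows "edml_transition (overlap a a') (overlap a' a) (trans_map a a') (trans_map a' a) (h a) (h a')
    (overlap b b') (overlap b' b) (trans_map b b') (trans_map b' b) (g b) (g b') (U a b) (U a' b')"
proof -
  have m: "smooth_manifold XT AT" "smooth_manifold XM AM" "semi_riemannian AT h" "semi_riemannian AM g"
    and dU: "d_tensor_U AT AM U"
    using sp unfolding edml_space_def by blast+
  interpret tt: metric_transition "overlap a a'" "overlap a' a" "trans_map a a'" "trans_map a' a" "h a" "h a'"
    by (rule metric_transition_overlap[OF m(1,3) a])
  interpret xx: metric_transition "overlap b b'" "overlap b' b" "trans_map b b'" "trans_map b' b" "g b" "g b'"
    by (rule metric_transition_overlap[OF m(2,4) b])
  have su: "smooth_on (overlap a a' \<times> overlap b b') (U a b)"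
    if "a \<in> AT" "b \<in> AM" for a a' b b'
  proof -
    have "smooth_on (cimg a \<times> cimg b) (U a b)" using dU that unfolding d_tensor_U_def by blast
    then show ?thesis by (rule smooth_on_subset) (intro Sigma_mono overlap_subset)
  qed
  show ?thesis
  proof unfold_locales
    show "smooth_on (overlap a a' \<times> overlap b b') (U a b)" "smooth_on (overlap a' a \<times> overlap b' b) (U a' b')"
      using su a b by blast+
    fix t x y assume t: "t \<in> overlap a a'" and x: "x \<in> overlap b b'"
    let ?U' = "U a' b' (trans_map a a' t, trans_map b b' x)"
      and ?J = "jac (trans_map a' a) (trans_map a a' t)" and ?Jx = "jac (trans_map b b') x"
    have "U a b (t, x) $ \<alpha> $ i = (?J ** ?U' ** ?Jx) $ \<alpha> $ i" for \<alpha> i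
    proof -
      have "U a b (t, x) $ \<alpha> $ i = (\<Sum>\<beta>\<in>UNIV. \<Sum>j\<in>UNIV. ?J $ \<alpha> $ \<beta> * ?Jx $ j $ i * ?U' $ \<beta> $ j)"
        using dU a b t x unfolding d_tensor_U_def dcoord_jac by blast
      also have "\<dots> = (\<Sum>j\<in>UNIV. (\<Sum>\<beta>\<in>UNIV. ?J $ \<alpha> $ \<beta> * ?U' $ \<beta> $ j) * ?Jx $ j $ i)"
        by (subst sum.swap) (simp add: sum_distrib_left sum_distrib_right mult_ac)
      finally show ?thesis by (simp add: matrix_matrix_mult_def)
    qed
    then have "U a b (t, x) = ?J ** ?U' ** ?Jx" by (simp add: vec_eq_iff)
    then have "U a b (t, x) *v y = ?J *v (?U' *v (?Jx *v y))" by (simp add: matrix_vector_mul_assoc matrix_mul_assoc)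
    then show "jac (trans_map a a') t *v (U a b (t, x) *v y) = ?U' *v (?Jx *v y)"
      by (simp add: tt.jac_right[OF t])
  qed
qed

lemma jet_trans_velocity:
  fixes a a' :: "('a, 'p::finite) chart" and b b' :: "('b, 'n::finite) chart"
  shows "jet_trans a a' b b' (t, x, v) = (trans_map a a' t, trans_map b b' x,
    jac (trans_map b b') x ** v ** jac (trans_map a' a) (trans_map a a' t))"
proof -
  have "(\<Sum>j\<in>UNIV. \<Sum>\<beta>\<in>UNIV. A $ i $ j * B $ \<beta> $ \<alpha> * v $ j $ \<beta>) = (A ** v ** B) $ i $ \<alpha>"
    for A :: "real ^ 'n ^ 'n" and B :: "real ^ 'p ^ 'p" and v :: "real ^ 'p ^ 'n" and i \<alpha>
    unfolding matrix_matrix_mult_def by (subst sum.swap) (simp add: sum_distrib_left sum_distrib_right mult_ac)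
  then show ?thesis
    by (simp add: jet_trans_def vec_eq_iff dcoord_jac)
qed

lemma matrix_vector_axis_nth: "(A *v axis j 1) $ i = A $ i $ j" for A :: "real ^ 'n ^ 'm"
  by (simp add: matrix_vector_mult_basis column_def)

context transition
begin

lemma jac_delta:
  assumes "y \<in> S"
  shows "(\<Sum>l\<in>UNIV. jac \<psi> (\<phi> y) $ i $ l * jac \<phi> y $ l $ j) = (if i = j then 1 else 0)"
proof -
  have "(jac \<psi> (\<phi> y) *v (jac \<phi> y *v axis j 1)) $ i = axis j 1 $ i"
    by (simp add: jac_left[OF assms])
  then show ?thesis
    by (simp add: matrix_vector_mult_def[of "jac \<psi> (\<phi> y)"] matrix_vector_axis_nth) (simp add: axis_def)
qed

end

section \<open>Torsion and curvature components as d-tensors\<close>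

lemma frame_change_type:
  assumes "frame_change a a' b b' w A A' \<noteq> 0"
  shows "(\<exists>\<alpha>. A = Tix \<alpha>) \<longleftrightarrow> (\<exists>\<alpha>. A' = Tix \<alpha>)" "(\<exists>i. A = Xix i) \<longleftrightarrow> (\<exists>i. A' = Xix i)"
    "(\<exists>i \<alpha>. A = Vix i \<alpha>) \<longleftrightarrow> (\<exists>i \<alpha>. A' = Vix i \<alpha>)"
  using assms by (cases w; cases A rule: aidx_cases; cases A' rule: aidx_cases; simp)+

text \<open>The components that can be nonzero are those on two horizontal arguments, and for these
  the index-free laws apply. Elsewhere both sides vanish since the change of frames is block
  diagonal.\<close>

lemma torsion_d_tensor:
  assumes sp: "edml_space XT AT XM AM h g U F L" and ca: "cartan_connection AT AM h g U nab Hc Gc Lc Cc"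
  shows "d_tensor_1_2 AT AM (\<lambda>a b. torsion_comp (h a) (g b) (U a b) (nab a b))"
  unfolding d_tensor_1_2_def
proof (intro ballI allI)
  fix a a' b b' w C A B
  assume ab: "a \<in> AT" "a' \<in> AT" "b \<in> AM" "b' \<in> AM" and w: "w \<in> jet_overlap a a' b b'"
  obtain t x v where wt: "w = (t, x, v)" by (cases w)
  then have t: "t \<in> overlap a a'" and x: "x \<in> overlap b b'" using w by (auto simp: jet_overlap_def)
  define t' x' where "t' = trans_map a a' t" and "x' = trans_map b b' x"
  define v' where "v' = jac (trans_map b b') x ** v ** jac (trans_map a' a) t'"
  have jt: "jet_trans a a' b b' w = (t', x', v')"
    unfolding wt jet_trans_velocity t'_def x'_def v'_def ..
  interpret c: edml_connection "cimg a" "h a" "cimg b" "g b" "U a b" "nab a b" "Hc a b" "Gc a b" "Lc a b" "Cc a b"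
    by (rule edml_connection_cimg[OF sp ca ab(1,3)])
  interpret c': edml_connection "cimg a'" "h a'" "cimg b'" "g b'" "U a' b'" "nab a' b'" "Hc a' b'" "Gc a' b'" "Lc a' b'" "Cc a' b'"
    by (rule edml_connection_cimg[OF sp ca ab(2,4)])
  interpret tr: edml_transition "overlap a a'" "overlap a' a" "trans_map a a'" "trans_map a' a" "h a" "h a'"
    "overlap b b'" "overlap b' b" "trans_map b b'" "trans_map b' b" "g b" "g b'" "U a b" "U a' b'"
    by (rule edml_transition_overlap[OF sp ab])
  have tx: "t \<in> cimg a" "x \<in> cimg b" and tx': "t' \<in> cimg a'" "x' \<in> cimg b'"
    using t x tr.tt.maps[OF t] tr.xx.maps[OF x] overlap_subset unfolding t'_def x'_def by blast+
  \<comment> \<open>The vertical block of the reverse change of frames evaluates a Jacobian at the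
    twice transformed point.\<close>
  have t_eq: "trans_map a' a t' = t" unfolding t'_def by (rule tr.tt.left_inv[OF t])
  have v': "v' *v (jac (trans_map a a') t *v u) = jac (trans_map b b') x *v (v *v u)" for u
    unfolding v'_def t'_def using tr.tt.jac_left[OF t, of u]
    by (simp only: matrix_vector_mul_assoc[symmetric])
  let ?S = "torsion_comp (h a) (g b) (U a b) (nab a b) w"
  let ?S' = "torsion_comp (h a') (g b') (U a' b') (nab a' b') (t', x', v')"
  let ?F' = "frame_change a' a b' b (t', x', v')" and ?F = "frame_change a a' b b' w"
  let ?R = "\<lambda>C A B. \<Sum>C'\<in>UNIV. \<Sum>A'\<in>UNIV. \<Sum>B'\<in>UNIV. ?F' C' C * ?F A A' * ?F B B' * ?S' C' A' B'"
  let ?J = "jac (trans_map a a') t" and ?Jx = "jac (trans_map b b') x" and ?Jx' = "jac (trans_map b' b) x'"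
  note z = c.torsion_horizontal[OF tx] c'.torsion_horizontal[OF tx']
    c.torsion_vertical[OF tx] c'.torsion_vertical[OF tx']
  \<comment> \<open>The transformed components inherit skew-symmetry, which settles the pairs of
    arguments in reversed order.\<close>
  have Rs: "?R C A B = - ?R C B A" for C A B
  proof -
    have "?R C A B = (\<Sum>C'\<in>UNIV. \<Sum>B'\<in>UNIV. \<Sum>A'\<in>UNIV. ?F' C' C * ?F A A' * ?F B B' * ?S' C' A' B')"
      by (rule sum.cong[OF refl], rule sum.swap)
    also have "\<dots> = (\<Sum>C'\<in>UNIV. \<Sum>B'\<in>UNIV. \<Sum>A'\<in>UNIV. - (?F' C' C * ?F B B' * ?F A A' * ?S' C' B' A'))"
      by (intro sum.cong refl) (subst c'.torsion_antisym, simp)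
    finally show ?thesis by (simp add: sum_negf)
  qed
  have Jinv: "?Jx' *v (?Jx *v y) = y" for y
    unfolding x'_def by (rule tr.xx.jac_left[OF x])
  have VTT: "?S (Vix m \<mu>) (Tix \<alpha>) (Tix \<beta>) = ?R (Vix m \<mu>) (Tix \<alpha>) (Tix \<beta>)" for m \<mu> \<alpha> \<beta>
  proof -
    have "?S (Vix m \<mu>) (Tix \<alpha>) (Tix \<beta>) =
        (?Jx' *v torTT (h a') t' v' (?J *v axis \<mu> 1) (?J *v axis \<alpha> 1) (?J *v axis \<beta> 1)) $ m"
      unfolding wt c.torsion_TT_axis[OF tx] t'_def tr.torTT_law[OF t v', symmetric] Jinv ..
    also have "\<dots> = ?R (Vix m \<mu>) (Tix \<alpha>) (Tix \<beta>)"
      by (simp add: trilinear_component_sum[of "torTT (h a') t' v'", OF c'.linear_torTT[OF tx'(1)]]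
          sum_aidx wt c'.torsion_TT_axis[OF tx'] t_eq dcoord_jac matrix_vector_axis_nth)
    finally show ?thesis .
  qed
  have VTX: "?S (Vix m \<mu>) (Tix \<alpha>) (Xix j) = ?R (Vix m \<mu>) (Tix \<alpha>) (Xix j)" for m \<mu> \<alpha> j
  proof -
    have "?S (Vix m \<mu>) (Tix \<alpha>) (Xix j) =
        (?Jx' *v torTX (h a') (g b') (U a' b') t' x' (?J *v axis \<mu> 1) (?J *v axis \<alpha> 1) (?Jx *v axis j 1)) $ m"
      unfolding wt c.torsion_TX_axis[OF tx] t'_def x'_def tr.torTX_law[OF t x, symmetric] Jinv[unfolded x'_def] ..
    also have "\<dots> = ?R (Vix m \<mu>) (Tix \<alpha>) (Xix j)"
      by (simp add: trilinear_component_sum[of "torTX (h a') (g b') (U a' b') t' x'", OF c'.linear_torTX[OF tx']]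
          sum_aidx wt c'.torsion_TX_axis[OF tx'] t_eq dcoord_jac matrix_vector_axis_nth)
    finally show ?thesis .
  qed
  have VXX: "?S (Vix m \<mu>) (Xix i) (Xix j) = ?R (Vix m \<mu>) (Xix i) (Xix j)" for m \<mu> i j
  proof -
    have "?S (Vix m \<mu>) (Xix i) (Xix j) =
        (?Jx' *v torXX (h a') (g b') (U a' b') t' x' v' (?J *v axis \<mu> 1) (?Jx *v axis i 1) (?Jx *v axis j 1)) $ m"
      unfolding wt c.torsion_XX_axis[OF tx] t'_def x'_def tr.torXX_law[OF t x v', symmetric] Jinv[unfolded x'_def] ..
    also have "\<dots> = ?R (Vix m \<mu>) (Xix i) (Xix j)"
      by (simp add: trilinear_component_sum[of "torXX (h a') (g b') (U a' b') t' x' v'", OF c'.linear_torXX[OF tx']]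
          sum_aidx wt c'.torsion_XX_axis[OF tx'] t_eq dcoord_jac matrix_vector_axis_nth)
    finally show ?thesis .
  qed
  have VX: "?S (Vix m \<mu>) (Xix j) (Tix \<alpha>) = ?R (Vix m \<mu>) (Xix j) (Tix \<alpha>)" for m \<mu> \<alpha> j
    using VTX[of m \<mu> \<alpha> j] Rs[of "Vix m \<mu>" "Tix \<alpha>" "Xix j"] c.torsion_antisym[of w "Vix m \<mu>" "Xix j" "Tix \<alpha>"]
    by simp
  have VV: "?S (Vix m \<mu>) (Vix i \<alpha>) B = ?R (Vix m \<mu>) (Vix i \<alpha>) B" for m \<mu> i \<alpha> B
  proof -
    have "?F' C' C * ?F (Vix i \<alpha>) A' * ?F B B' * ?S' C' A' B' = 0" for C' A' B' C
      by (cases A' rule: aidx_cases; cases C' rule: aidx_cases) (auto simp: wt z)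
    then show ?thesis by (simp only: z wt sum.neutral_const)
  qed
  have T: "?S (Tix \<gamma>) A B = ?R (Tix \<gamma>) A B" for \<gamma> A B
  proof -
    have "?F' C' (Tix \<gamma>) * ?F A A' * ?F B B' * ?S' C' A' B' = 0" for C' A' B'
      by (cases C' rule: aidx_cases) (auto simp: z)
    then show ?thesis by (simp only: z wt sum.neutral_const)
  qed
  have X: "?S (Xix k) A B = ?R (Xix k) A B" for k A B
  proof -
    have "?F' C' (Xix k) * ?F A A' * ?F B B' * ?S' C' A' B' = 0" for C' A' B'
      by (cases C' rule: aidx_cases) (auto simp: z)
    then show ?thesis by (simp only: z wt sum.neutral_const)
  qed
  have VAV: "?S (Vix m \<mu>) A (Vix i \<alpha>) = ?R (Vix m \<mu>) A (Vix i \<alpha>)" for m \<mu> i \<alpha> A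
    using VV[of m \<mu> i \<alpha> A] Rs[of "Vix m \<mu>" A "Vix i \<alpha>"] c.torsion_antisym[of w "Vix m \<mu>" A "Vix i \<alpha>"]
    by simp
  have "?S C A B = ?R C A B"
    by (cases C rule: aidx_cases; cases A rule: aidx_cases; cases B rule: aidx_cases;
        simp only: VTT VTX VXX VX VV VAV T X)
  then show "?S C A B = (\<Sum>C'\<in>UNIV. \<Sum>A'\<in>UNIV. \<Sum>B'\<in>UNIV.
      frame_change a' a b' b (jet_trans a a' b b' w) C' C * ?F A A' * ?F B B' *
      torsion_comp (h a') (g b') (U a' b') (nab a' b') (jet_trans a a' b b' w) C' A' B')"
    unfolding jt .
qed

text \<open>The two pure blocks follow from the law for the Riemann tensor. In the vertical blocks
  the index moved only by a delta meets a Jacobian and its inverse, which contract to the delta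
  again.\<close>

lemma curvature_d_tensor:
  assumes sp: "edml_space XT AT XM AM h g U F L" and ca: "cartan_connection AT AM h g U nab Hc Gc Lc Cc"
  shows "d_tensor_1_3 AT AM (\<lambda>a b. curvature_comp (h a) (g b) (U a b) (nab a b))"
  unfolding d_tensor_1_3_def
proof (intro ballI allI)
  fix a a' b b' w D A B C
  assume ab: "a \<in> AT" "a' \<in> AT" "b \<in> AM" "b' \<in> AM" and w: "w \<in> jet_overlap a a' b b'"
  obtain t x v where wt: "w = (t, x, v)" by (cases w)
  then have t: "t \<in> overlap a a'" and x: "x \<in> overlap b b'" using w by (auto simp: jet_overlap_def)
  obtain t' x' v' where jt: "jet_trans a a' b b' w = (t', x', v')"
    and t': "t' = trans_map a a' t" and x': "x' = trans_map b b' x"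
    unfolding wt jet_trans_velocity by blast
  interpret c: edml_connection "cimg a" "h a" "cimg b" "g b" "U a b" "nab a b" "Hc a b" "Gc a b" "Lc a b" "Cc a b"
    by (rule edml_connection_cimg[OF sp ca ab(1,3)])
  interpret c': edml_connection "cimg a'" "h a'" "cimg b'" "g b'" "U a' b'" "nab a' b'" "Hc a' b'" "Gc a' b'" "Lc a' b'" "Cc a' b'"
    by (rule edml_connection_cimg[OF sp ca ab(2,4)])
  interpret tr: edml_transition "overlap a a'" "overlap a' a" "trans_map a a'" "trans_map a' a" "h a" "h a'"
    "overlap b b'" "overlap b' b" "trans_map b b'" "trans_map b' b" "g b" "g b'" "U a b" "U a' b'"
    by (rule edml_transition_overlap[OF sp ab])
  have tx: "t \<in> cimg a" "x \<in> cimg b" and tx': "t' \<in> cimg a'" "x' \<in> cimg b'"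
    using t x tr.tt.maps[OF t] tr.xx.maps[OF x] overlap_subset unfolding t' x' by blast+
  have t_eq: "trans_map a' a t' = t" unfolding t' by (rule tr.tt.left_inv[OF t])
  let ?S = "curvature_comp (h a) (g b) (U a b) (nab a b) w"
  let ?S' = "curvature_comp (h a') (g b') (U a' b') (nab a' b') (t', x', v')"
  let ?F' = "frame_change a' a b' b (t', x', v')" and ?F = "frame_change a a' b b' w"
  let ?R = "\<lambda>D A B C. \<Sum>D'\<in>UNIV. \<Sum>A'\<in>UNIV. \<Sum>B'\<in>UNIV. \<Sum>C'\<in>UNIV.
    ?F' D' D * ?F A A' * ?F B B' * ?F C C' * ?S' D' A' B' C'"
  let ?J = "jac (trans_map a a') t" and ?J' = "jac (trans_map a' a) t'"
    and ?Jx = "jac (trans_map b b') x" and ?Jx' = "jac (trans_map b' b) x'"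
  note s = sum_aidx wt t_eq dcoord_jac
  have RT: "riemann (h a) \<eta> \<alpha> \<beta> \<gamma> t = (\<Sum>\<eta>'\<in>UNIV. \<Sum>\<alpha>'\<in>UNIV. \<Sum>\<beta>'\<in>UNIV. \<Sum>\<gamma>'\<in>UNIV.
      ?J' $ \<eta> $ \<eta>' * ?J $ \<alpha>' $ \<alpha> * ?J $ \<beta>' $ \<beta> * ?J $ \<gamma>' $ \<gamma> * riemann (h a') \<eta>' \<alpha>' \<beta>' \<gamma>' t')" for \<eta> \<alpha> \<beta> \<gamma>
  proof -
    have "riemann (h a) \<eta> \<alpha> \<beta> \<gamma> t = (?J' *v (?J *v Rm (h a) t (axis \<alpha> 1) (axis \<beta> 1) (axis \<gamma> 1))) $ \<eta>"
      unfolding t' tr.tt.jac_left[OF t] c.T.Rm_axis[OF tx(1)] ..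
    also have "\<dots> = (?J' *v Rm (h a') t' (?J *v axis \<alpha> 1) (?J *v axis \<beta> 1) (?J *v axis \<gamma> 1)) $ \<eta>"
      unfolding tr.tt.Rm_law[OF t] t' ..
    finally show ?thesis
      by (simp add: trilinear_component_sum[of "Rm (h a') t'", OF c'.T.linear_Rm[OF tx'(1)]]
          matrix_vector_axis_nth c'.T.Rm_axis[OF tx'(1)])
  qed
  have RX: "riemann (g b) l i j k x = (\<Sum>l'\<in>UNIV. \<Sum>i'\<in>UNIV. \<Sum>j'\<in>UNIV. \<Sum>k'\<in>UNIV.
      ?Jx' $ l $ l' * ?Jx $ i' $ i * ?Jx $ j' $ j * ?Jx $ k' $ k * riemann (g b') l' i' j' k' x')" for l i j k
  proof -
    have "riemann (g b) l i j k x = (?Jx' *v (?Jx *v Rm (g b) x (axis i 1) (axis j 1) (axis k 1))) $ l"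
      unfolding x' tr.xx.jac_left[OF x] c.M.Rm_axis[OF tx(2)] ..
    also have "\<dots> = (?Jx' *v Rm (g b') x' (?Jx *v axis i 1) (?Jx *v axis j 1) (?Jx *v axis k 1)) $ l"
      unfolding tr.xx.Rm_law[OF x] x' ..
    finally show ?thesis
      by (simp add: trilinear_component_sum[of "Rm (g b') x'", OF c'.M.linear_Rm[OF tx'(2)]]
          matrix_vector_axis_nth c'.M.Rm_axis[OF tx'(2)])
  qed
  have TT: "?S (Tix \<eta>) (Tix \<alpha>) (Tix \<beta>) (Tix \<gamma>) = ?R (Tix \<eta>) (Tix \<alpha>) (Tix \<beta>) (Tix \<gamma>)" for \<eta> \<alpha> \<beta> \<gamma>
    by (simp add: s c.curvature_T[OF tx] c'.curvature_T[OF tx'] RT)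
  have XX: "?S (Xix l) (Xix i) (Xix j) (Xix k) = ?R (Xix l) (Xix i) (Xix j) (Xix k)" for l i j k
    by (simp add: s c.curvature_X[OF tx] c'.curvature_X[OF tx'] RX)
  have dx: "(\<Sum>l'\<in>UNIV. ?Jx' $ l $ l' * ?Jx $ l' $ i) = (if l = i then 1 else 0)" for l i
    unfolding x' by (rule tr.xx.jac_delta[OF x])
  have dt: "(\<Sum>\<eta>'\<in>UNIV. ?J' $ \<alpha> $ \<eta>' * ?J $ \<eta>' $ \<eta>) = (if \<alpha> = \<eta> then 1 else 0)" for \<alpha> \<eta>
    unfolding t' by (rule tr.tt.jac_delta[OF t])
  have VT: "?S (Vix l \<eta>) (Vix i \<alpha>) (Tix \<beta>) (Tix \<gamma>) = ?R (Vix l \<eta>) (Vix i \<alpha>) (Tix \<beta>) (Tix \<gamma>)" for l \<eta> i \<alpha> \<beta> \<gamma>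
  proof -
    \<comment> \<open>The vertical block acts inversely on temporal indices, so \<alpha> and \<eta>
      exchange the roles they have in \<open>RT\<close>; an exchange of summations repairs
      this.\<close>
    define Y where "Y \<eta>' = (\<Sum>\<alpha>'\<in>UNIV. \<Sum>\<beta>'\<in>UNIV. \<Sum>\<gamma>'\<in>UNIV.
      ?J' $ \<alpha> $ \<alpha>' * ?J $ \<eta>' $ \<eta> * ?J $ \<beta>' $ \<beta> * ?J $ \<gamma>' $ \<gamma> * riemann (h a') \<alpha>' \<eta>' \<beta>' \<gamma>' t')" for \<eta>'
    have Y: "(\<Sum>\<eta>'\<in>UNIV. Y \<eta>') = riemann (h a) \<alpha> \<eta> \<beta> \<gamma> t"
      unfolding RT Y_def by (rule sum.swap)
    have "?R (Vix l \<eta>) (Vix i \<alpha>) (Tix \<beta>) (Tix \<gamma>) = (\<Sum>l'\<in>UNIV. \<Sum>\<eta>'\<in>UNIV. \<Sum>i'\<in>UNIV.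
        if l' = i' then (?Jx' $ l $ l' * ?Jx $ l' $ i) * - Y \<eta>' else 0)"
    proof -
      have "(\<Sum>\<alpha>'\<in>UNIV. \<Sum>\<beta>'\<in>UNIV. \<Sum>\<gamma>'\<in>UNIV. ?Jx' $ l $ l' * ?J $ \<eta>' $ \<eta> * (?Jx $ i' $ i * ?J' $ \<alpha> $ \<alpha>') *
          ?J $ \<beta>' $ \<beta> * ?J $ \<gamma>' $ \<gamma> * (if l' = i' then - riemann (h a') \<alpha>' \<eta>' \<beta>' \<gamma>' t' else 0)) =
        (if l' = i' then (?Jx' $ l $ l' * ?Jx $ l' $ i) * - Y \<eta>' else 0)" for l' \<eta>' i'
        by (cases "l' = i'") (simp_all add: Y_def sum_distrib_left sum_negf mult_ac)
      then show ?thesis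
        by (simp add: s c'.curvature_VT[OF tx'] t'[symmetric] del: mult_minus_right mult_minus_left)
    qed
    also have "\<dots> = (\<Sum>l'\<in>UNIV. \<Sum>\<eta>'\<in>UNIV. (?Jx' $ l $ l' * ?Jx $ l' $ i) * - Y \<eta>')"
      by simp
    also have "\<dots> = (if l = i then 1 else 0) * - riemann (h a) \<alpha> \<eta> \<beta> \<gamma> t"
      unfolding sum_product[symmetric] dx sum_negf Y ..
    finally show ?thesis
      by (simp add: wt c.curvature_VT[OF tx])
  qed
  have VX: "?S (Vix l \<eta>) (Vix i \<alpha>) (Xix j) (Xix k) = ?R (Vix l \<eta>) (Vix i \<alpha>) (Xix j) (Xix k)" for l \<eta> i \<alpha> j k
  proof -
    define Y where "Y l' i' = (\<Sum>j'\<in>UNIV. \<Sum>k'\<in>UNIV.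
      ?Jx' $ l $ l' * ?Jx $ i' $ i * ?Jx $ j' $ j * ?Jx $ k' $ k * riemann (g b') l' i' j' k' x')" for l' i'
    have Y: "(\<Sum>l'\<in>UNIV. \<Sum>i'\<in>UNIV. Y l' i') = riemann (g b) l i j k x"
      unfolding RX Y_def ..
    have "?R (Vix l \<eta>) (Vix i \<alpha>) (Xix j) (Xix k) = (\<Sum>l'\<in>UNIV. \<Sum>\<eta>'\<in>UNIV. \<Sum>i'\<in>UNIV. \<Sum>\<alpha>'\<in>UNIV.
        if \<eta>' = \<alpha>' then (?J' $ \<alpha> $ \<eta>' * ?J $ \<eta>' $ \<eta>) * Y l' i' else 0)"
    proof -
      have "(\<Sum>j'\<in>UNIV. \<Sum>k'\<in>UNIV. ?Jx' $ l $ l' * ?J $ \<eta>' $ \<eta> * (?Jx $ i' $ i * ?J' $ \<alpha> $ \<alpha>') *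
          ?Jx $ j' $ j * ?Jx $ k' $ k * (if \<eta>' = \<alpha>' then riemann (g b') l' i' j' k' x' else 0)) =
        (if \<eta>' = \<alpha>' then (?J' $ \<alpha> $ \<eta>' * ?J $ \<eta>' $ \<eta>) * Y l' i' else 0)" for l' \<eta>' i' \<alpha>'
        by (cases "\<eta>' = \<alpha>'") (simp_all add: Y_def sum_distrib_left mult_ac)
      then show ?thesis
        by (simp add: s c'.curvature_VX[OF tx'] t'[symmetric])
    qed
    also have "\<dots> = (\<Sum>l'\<in>UNIV. \<Sum>\<eta>'\<in>UNIV. (?J' $ \<alpha> $ \<eta>' * ?J $ \<eta>' $ \<eta>) * (\<Sum>i'\<in>UNIV. Y l' i'))"
      by (simp add: sum_distrib_left)
    also have "\<dots> = (if \<alpha> = \<eta> then 1 else 0) * riemann (g b) l i j k x"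
      by (subst sum.swap) (simp only: sum_product[symmetric] dt Y)
    finally show ?thesis
      by (simp add: wt c.curvature_VX[OF tx])
  qed
  have "?S D A B C = ?R D A B C"
  proof (cases "(\<exists>\<eta> \<alpha> \<beta> \<gamma>. (D, A, B, C) = (Tix \<eta>, Tix \<alpha>, Tix \<beta>, Tix \<gamma>)) \<or>
      (\<exists>l i j k. (D, A, B, C) = (Xix l, Xix i, Xix j, Xix k)) \<or>
      (\<exists>l \<eta> i \<alpha> \<beta> \<gamma>. (D, A, B, C) = (Vix l \<eta>, Vix i \<alpha>, Tix \<beta>, Tix \<gamma>)) \<or>
      (\<exists>l \<eta> i \<alpha> j k. (D, A, B, C) = (Vix l \<eta>, Vix i \<alpha>, Xix j, Xix k))")
    case True
    then show ?thesis
      by (elim disjE exE) (simp_all only: prod.inject TT XX VT VX)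
  next
    case False
    \<comment> \<open>A nonzero summand would force each primed index into the block of its unprimed
      partner, and hence into an excluded combination.\<close>
    have "?F' D' D * ?F A A' * ?F B B' * ?F C C' * ?S' D' A' B' C' = 0" for D' A' B' C'
    proof (rule ccontr)
      assume "\<not> ?thesis"
      then have nz: "?F' D' D \<noteq> 0" "?F A A' \<noteq> 0" "?F B B' \<noteq> 0" "?F C C' \<noteq> 0" "?S' D' A' B' C' \<noteq> 0"
        by auto
      have "?S' D' A' B' C' = 0"
        by (rule c'.curvature_zero[OF tx'])
          (use False in \<open>simp add: frame_change_type[OF nz(1)] frame_change_type[OF nz(2), symmetric]
            frame_change_type[OF nz(3), symmetric] frame_change_type[OF nz(4), symmetric]\<close>)+
      with nz(5) show False ..
    qed
    moreover have "?S D A B C = 0"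
      unfolding wt by (rule c.curvature_zero[OF tx]) (use False in blast)+
    ultimately show ?thesis by (simp only: sum.neutral_const)
  qed
  then show "?S D A B C = (\<Sum>D'\<in>UNIV. \<Sum>A'\<in>UNIV. \<Sum>B'\<in>UNIV. \<Sum>C'\<in>UNIV.
      frame_change a' a b' b (jet_trans a a' b b' w) D' D * ?F A A' * ?F B B' * ?F C C' *
      curvature_comp (h a') (g b') (U a' b') (nab a' b') (jet_trans a a' b b' w) D' A' B' C')"
    unfolding jt .
qed

text \<open>"Determined by" is rendered by explicit components together with the vanishing of the
  remaining ones, up to skew-symmetry of torsion; the vertical curvature blocks are expressed by the
  same two Riemann tensors. The spatial torsion has a minus sign between the covariant derivatives
  where the informal statement has a plus: torsion and the Riemann term are skew in \<open>i\<close>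
  and \<open>j\<close>, whereas the sum of the covariant derivatives would be symmetric.\<close>

theorem theorem2p3:
  fixes XT :: "'a topology" and AT :: "('a, 'p::finite) chart set"
    and XM :: "'b topology" and AM :: "('b, 'n::finite) chart set"
    and h :: "('a, 'p) chart \<Rightarrow> real ^ 'p \<Rightarrow> real ^ 'p ^ 'p"
    and g :: "('b, 'n) chart \<Rightarrow> real ^ 'n \<Rightarrow> real ^ 'n ^ 'n"
    and U :: "('a, 'p) chart \<Rightarrow> ('b, 'n) chart \<Rightarrow> (real ^ 'p) \<times> (real ^ 'n) \<Rightarrow> real ^ 'n ^ 'p"
    and F :: "'a \<times> 'b \<Rightarrow> real"
    and L :: "('a, 'p) chart \<Rightarrow> ('b, 'n) chart \<Rightarrow> ('p, 'n) jet \<Rightarrow> real"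
    and nab :: "('a, 'p) chart \<Rightarrow> ('b, 'n) chart \<Rightarrow> (('p, 'n) jet \<Rightarrow> ('p, 'n) jet) \<Rightarrow>
      (('p, 'n) jet \<Rightarrow> ('p, 'n) jet) \<Rightarrow> ('p, 'n) jet \<Rightarrow> ('p, 'n) jet"
    and Hc :: "('a, 'p) chart \<Rightarrow> ('b, 'n) chart \<Rightarrow> ('p, 'n) jet \<Rightarrow> 'p \<Rightarrow> 'p \<Rightarrow> 'p \<Rightarrow> real"
    and Gc :: "('a, 'p) chart \<Rightarrow> ('b, 'n) chart \<Rightarrow> ('p, 'n) jet \<Rightarrow> 'n \<Rightarrow> 'n \<Rightarrow> 'p \<Rightarrow> real"
    and Lc :: "('a, 'p) chart \<Rightarrow> ('b, 'n) chart \<Rightarrow> ('p, 'n) jet \<Rightarrow> 'n \<Rightarrow> 'n \<Rightarrow> 'n \<Rightarrow> real"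
    and Cc :: "('a, 'p) chart \<Rightarrow> ('b, 'n) chart \<Rightarrow> ('p, 'n) jet \<Rightarrow> 'n \<Rightarrow> 'p \<Rightarrow> 'n \<Rightarrow> 'n \<Rightarrow> real"
  assumes space: "edml_space XT AT XM AM h g U F L"
    and cartan: "cartan_connection AT AM h g U nab Hc Gc Lc Cc"
  shows
    "let tor = (\<lambda>a b. torsion_comp (h a) (g b) (U a b) (nab a b));
         cur = (\<lambda>a b. curvature_comp (h a) (g b) (U a b) (nab a b)) in
     (\<forall>a\<in>AT. \<forall>b\<in>AM. \<forall>t\<in>cimg a. \<forall>x\<in>cimg b. \<forall>v.
       (\<forall>\<alpha> \<beta> \<gamma>. Hc a b (t, x, v) \<gamma> \<alpha> \<beta> = christoffel (h a) \<gamma> \<alpha> \<beta> t) \<and>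
       (\<forall>k j \<gamma>. Gc a b (t, x, v) k j \<gamma> = 0) \<and>
       (\<forall>i j k. Lc a b (t, x, v) i j k = christoffel (g b) i j k x) \<and>
       (\<forall>i \<gamma> j k. Cc a b (t, x, v) i \<gamma> j k = 0)) \<and>
     d_tensor_1_2 AT AM tor \<and>
     (\<forall>a\<in>AT. \<forall>b\<in>AM. \<forall>t\<in>cimg a. \<forall>x\<in>cimg b. \<forall>v.
       (\<forall>m \<mu> \<alpha> \<beta>. tor a b (t, x, v) (Vix m \<mu>) (Tix \<alpha>) (Tix \<beta>) =
          - (\<Sum>\<gamma>\<in>UNIV. riemann (h a) \<gamma> \<mu> \<alpha> \<beta> t * v $ m $ \<gamma>)) \<and>
       (\<forall>m \<mu> \<alpha> j. tor a b (t, x, v) (Vix m \<mu>) (Tix \<alpha>) (Xix j) =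
          - (\<Sum>\<eta>\<in>UNIV. \<Sum>k\<in>UNIV. h a t $ \<mu> $ \<eta> * matrix_inv (g b x) $ m $ k / 4 *
               ((\<Sum>\<gamma>\<in>UNIV. christoffel (h a) \<eta> \<alpha> \<gamma> t * curlU (U a b) \<gamma> k j t x) +
                pd \<alpha> (\<lambda>s. curlU (U a b) \<eta> k j s x) t))) \<and>
       (\<forall>m \<mu> i j. tor a b (t, x, v) (Vix m \<mu>) (Xix i) (Xix j) =
          (\<Sum>k\<in>UNIV. riemann (g b) m k i j x * v $ k $ \<mu>) +
          (\<Sum>\<eta>\<in>UNIV. \<Sum>k\<in>UNIV. h a t $ \<mu> $ \<eta> * matrix_inv (g b x) $ m $ k / 4 *
             (hcovU (h a) (g b) (U a b) (Lc a b) \<eta> k i j (t, x, v) -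
              hcovU (h a) (g b) (U a b) (Lc a b) \<eta> k j i (t, x, v)))) \<and>
       (\<forall>C A B. tor a b (t, x, v) C A B = - tor a b (t, x, v) C B A) \<and>
       (\<forall>\<gamma> A B. tor a b (t, x, v) (Tix \<gamma>) A B = 0) \<and>
       (\<forall>k A B. tor a b (t, x, v) (Xix k) A B = 0) \<and>
       (\<forall>m \<mu> i \<alpha> B. tor a b (t, x, v) (Vix m \<mu>) (Vix i \<alpha>) B = 0)) \<and>
     d_tensor_1_3 AT AM cur \<and>
     (\<forall>a\<in>AT. \<forall>b\<in>AM. \<forall>t\<in>cimg a. \<forall>x\<in>cimg b. \<forall>v.
       (\<forall>\<eta> \<alpha> \<beta> \<gamma>. cur a b (t, x, v) (Tix \<eta>) (Tix \<alpha>) (Tix \<beta>) (Tix \<gamma>) =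
          riemann (h a) \<eta> \<alpha> \<beta> \<gamma> t) \<and>
       (\<forall>l i j k. cur a b (t, x, v) (Xix l) (Xix i) (Xix j) (Xix k) =
          riemann (g b) l i j k x) \<and>
       (\<forall>l \<eta> i \<alpha> \<beta> \<gamma>. cur a b (t, x, v) (Vix l \<eta>) (Vix i \<alpha>) (Tix \<beta>) (Tix \<gamma>) =
          (if l = i then - riemann (h a) \<alpha> \<eta> \<beta> \<gamma> t else 0)) \<and>
       (\<forall>l \<eta> i \<alpha> j k. cur a b (t, x, v) (Vix l \<eta>) (Vix i \<alpha>) (Xix j) (Xix k) =
          (if \<eta> = \<alpha> then riemann (g b) l i j k x else 0)) \<and>
       (\<forall>D A B C.
          (\<nexists>\<eta> \<alpha> \<beta> \<gamma>. (D, A, B, C) = (Tix \<eta>, Tix \<alpha>, Tix \<beta>, Tix \<gamma>)) \<longrightarrow>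
          (\<nexists>l i j k. (D, A, B, C) = (Xix l, Xix i, Xix j, Xix k)) \<longrightarrow>
          (\<nexists>l \<eta> i \<alpha> \<beta> \<gamma>. (D, A, B, C) = (Vix l \<eta>, Vix i \<alpha>, Tix \<beta>, Tix \<gamma>)) \<longrightarrow>
          (\<nexists>l \<eta> i \<alpha> j k. (D, A, B, C) = (Vix l \<eta>, Vix i \<alpha>, Xix j, Xix k)) \<longrightarrow>
          cur a b (t, x, v) D A B C = 0))"
proof -
  note con = edml_connection_cimg[OF space cartan]
  show ?thesis
    unfolding Let_def
    by (intro conjI ballI allI impI torsion_d_tensor[OF space cartan] curvature_d_tensor[OF space cartan];
        (rule edml_connection.coefficients[OF con] edml_connection.torsion_TT[OF con]
          edml_connection.torsion_TX[OF con] edml_connection.torsion_XX[OF con]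
          edml_connection.torsion_antisym[OF con] edml_connection.torsion_horizontal[OF con]
          edml_connection.torsion_vertical[OF con] edml_connection.curvature_T[OF con]
          edml_connection.curvature_X[OF con] edml_connection.curvature_VT[OF con]
          edml_connection.curvature_VX[OF con] edml_connection.curvature_zero[OF con]; assumption))
qed

end
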